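(* Let $q$ be a prime power. For every $\delta\in[0,1]$, $$\alpha_q^Q(\delta)\ \ge\ 1-\delta\log_q(q+1)-H_q(\delta),$$ where $H_q(x)=x\log_q(q-1)-x\log_q x-(1-x)\log_q(1-x)$ is the $q$-ary entropy function (with $0\log_q 0=0$).
   Context: A $q$-ary quantum code $Q$ of length $n=n(Q)$ and dimension $K=K(Q)\ge 1$ is a $K$-dimensional complex subspace of $(\mathbb{C}^q)^{\otimes n}$. Write $P$ for the orthogonal projection onto $Q$. An error of weight $w$ is an operator $E=E_1\otimes\cdots\otimes E_n$ on $(\mathbb{C}^q)^{\otimes n}$ in which exactly $w$ of the factors $E_j$ (linear operators on $\mathbb{C}^q$) are not scalar multiples of the identity. The minimum distance $d(Q)$ is the largest integer $d\le n+1$ such that for every error $E$ of weight less than $d$ one has $PEP=c_E P$ for some scalar $c_E\in\mathbb{C}$; when $K=1$ one uses the usual convention that in addition $PEP=0$ is required for every such $E$ of weight $w$ with $1\le w<d$ whose non-scalar factors all have trace zero and whose other factors are the identity. $U_q^Q\subseteq[0,1]\times[0,1]$ is the set of ordered pairs $(\delta,R)\in[0,1]\times[0,1]$ for which there exists a family $\{Q_i\}_{i=1}^\infty$ of $q$-ary quantum codes with $n(Q_i)\to\infty$, $R=\lim_{i\to\infty}\log_q K(Q_i)/n(Q_i)$ and $\delta=\lim_{i\to\infty}d(Q_i)/n(Q_i)$. The function $\alpha_q^Q:[0,1]\to[0,1]$ is the function for which $U_q^Q$ is the union of $\{(\delta,R)\in\mathbb{R}^2:0\le R<\alpha_q^Q(\delta),\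 0\le\delta\le 1\}$ with some points of the boundary $R=\alpha_q^Q(\delta)$; that is, $\alpha_q^Q(\delta)=\sup\{R:(\delta,R)\in U_q^Q\}$, with the supremum of the empty set taken to be $0$. *)

theory Defs
  imports
    Complex_Main
    "HOL-Number_Theory.Prime_Powers"
    "Jordan_Normal_Form.VS_Connect"
begin

text \<open>
  The space of \<open>n\<close> qudits, i.e. the \<open>n\<close>-fold tensor power of complex \<open>q\<close>-space, is
  identified with \<open>carrier_vec (q ^ n)\<close> through the product basis: the basis vector
  belonging to the word \<open>a\<^sub>1 \<dots> a\<^sub>n\<close> over \<open>{0..<q}\<close> is the unit vector whose index has
  these base-\<open>q\<close> digits, most significant digit first.  Tensor products of operators are
  then Kronecker products of matrices.
\<close>

definition kronecker :: "complex mat \<Rightarrow> complex mat \<Rightarrow> complex mat" where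
  "kronecker A B = mat (dim_row A * dim_row B) (dim_col A * dim_col B)
     (\<lambda>(i, j). A $$ (i div dim_row B, j div dim_col B) * B $$ (i mod dim_row B, j mod dim_col B))"

definition tensor_list :: "complex mat list \<Rightarrow> complex mat" where
  "tensor_list Es = foldr kronecker Es (1\<^sub>m 1)"

definition mat_trace :: "complex mat \<Rightarrow> complex" where
  "mat_trace A = (\<Sum>i<dim_row A. A $$ (i, i))"

definition scalar_op :: "nat \<Rightarrow> complex mat \<Rightarrow> bool" where
  "scalar_op q E \<longleftrightarrow> (\<exists>c. E = c \<cdot>\<^sub>m 1\<^sub>m q)"

text \<open>An error is given by the list of its tensor factors.\<close>

definition factor_lists :: "nat \<Rightarrow> nat \<Rightarrow> complex mat list set" where
  "factor_lists q n = {Es. length Es = n \<and> set Es \<subseteq> carrier_mat q q}"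

definition error_weight :: "nat \<Rightarrow> complex mat list \<Rightarrow> nat" where
  "error_weight q Es = length (filter (\<lambda>E. \<not> scalar_op q E) Es)"

definition code_dim :: "nat \<Rightarrow> nat \<Rightarrow> complex vec set \<Rightarrow> nat" where
  "code_dim q n Q =
     vectorspace.dim class_ring ((module_vec TYPE(complex) (q ^ n))\<lparr>carrier := Q\<rparr>)"

definition quantum_code :: "nat \<Rightarrow> nat \<Rightarrow> complex vec set \<Rightarrow> bool" where
  "quantum_code q n Q \<longleftrightarrow>
     VectorSpace.subspace class_ring Q (module_vec TYPE(complex) (q ^ n)) \<and> code_dim q n Q \<ge> 1"

definition is_orth_projection :: "nat \<Rightarrow> complex vec set \<Rightarrow> complex mat \<Rightarrow> bool" where
  "is_orth_projection N Q P \<longleftrightarrow> P \<in> carrier_mat N N \<and>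
     (\<forall>v\<in>carrier_vec N. P *\<^sub>v v \<in> Q \<and> (\<forall>w\<in>Q. (v - P *\<^sub>v v) \<bullet>c w = 0))"

definition orth_projection :: "nat \<Rightarrow> complex vec set \<Rightarrow> complex mat" where
  "orth_projection N Q = (THE P. is_orth_projection N Q P)"

text \<open>The last conjunct is the additional (purity) requirement for one-dimensional codes.\<close>

definition detects_below :: "nat \<Rightarrow> nat \<Rightarrow> complex vec set \<Rightarrow> nat \<Rightarrow> bool" where
  "detects_below q n Q d \<longleftrightarrow>
     (let P = orth_projection (q ^ n) Q in
       (\<forall>Es\<in>factor_lists q n. error_weight q Es < d \<longrightarrow>
          (\<exists>c. P * tensor_list Es * P = c \<cdot>\<^sub>m P)) \<and>
       (code_dim q n Q = 1 \<longrightarrow>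
          (\<forall>Es\<in>factor_lists q n. 1 \<le> error_weight q Es \<and> error_weight q Es < d \<and>
             (\<forall>E\<in>set Es. if scalar_op q E then E = 1\<^sub>m q else mat_trace E = 0) \<longrightarrow>
             P * tensor_list Es * P = 0\<^sub>m (q ^ n) (q ^ n))))"

definition min_distance :: "nat \<Rightarrow> nat \<Rightarrow> complex vec set \<Rightarrow> nat" where
  "min_distance q n Q = Max {d. d \<le> n + 1 \<and> detects_below q n Q d}"

definition U_Q :: "nat \<Rightarrow> (real \<times> real) set" where
  "U_Q q = {(\<delta>, R). \<delta> \<in> {0..1} \<and> R \<in> {0..1} \<and>
     (\<exists>(n :: nat \<Rightarrow> nat) (Q :: nat \<Rightarrow> complex vec set).
        (\<forall>i. quantum_code q (n i) (Q i)) \<and>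
        filterlim n at_top sequentially \<and>
        (\<lambda>i. log (real q) (real (code_dim q (n i) (Q i))) / real (n i)) \<longlonglongrightarrow> R \<and>
        (\<lambda>i. real (min_distance q (n i) (Q i)) / real (n i)) \<longlonglongrightarrow> \<delta>)}"

text \<open>The case distinction is needed because \<^term>\<open>Sup {} :: real\<close> is unspecified.\<close>

definition alpha_Q :: "nat \<Rightarrow> real \<Rightarrow> real" where
  "alpha_Q q \<delta> = (if \<exists>R. (\<delta>, R) \<in> U_Q q then Sup {R. (\<delta>, R) \<in> U_Q q} else 0)"

text \<open>
  Since \<^term>\<open>0 * log b 0 = (0 :: real)\<close>, the convention for the entropy at the endpoints
  holds automatically.
\<close>

definition entropy_q :: "nat \<Rightarrow> real \<Rightarrow> real" where
  "entropy_q q x =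
     x * log (real q) (real q - 1) - x * log (real q) x - (1 - x) * log (real q) (1 - x)"

end

theory Submission
  imports
    Defs
    "HOL-Algebra.Coset"
    "HOL-Number_Theory.Cong"
begin

text \<open>
  Fix a prime \<open>p\<close> with \<open>q = p\<^sup>m\<close>.  Tensor products of shift and clock operators on complex
  \<open>p\<close>-space span all operators on \<open>n\<close> qudits; up to phases they form an elementary abelian group,
  and their commutation relations define a nondegenerate alternating bicharacter \<open>\<chi>\<close> on it.  A
  stabilizer projection \<open>P\<close> is refined greedily: a label \<open>e\<close> of low weight is undetected if it
  commutes with the stabilizer \<open>S\<close> of \<open>P\<close> but does not belong to it.  As \<open>S\<^sup>\<bottom>\<^sup>\<bottom> = S\<close>, a random
  element \<open>s\<close> of \<open>S\<^sup>\<bottom>\<close> commutes with such an \<open>e\<close> with probability \<open>1/p\<close>, so some \<open>s\<close> reduces the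
  number of undetected labels by a factor \<open>p\<close>, while passing to the best eigenspace of its operator
  costs at most a factor \<open>p\<close> in dimension.  Hence the dimension \<open>q\<^sup>n / (p B)\<close> is reached, where \<open>B\<close> is
  the volume of the Hamming ball of radius \<open>\<delta> n\<close> over \<open>q\<^sup>2\<close> letters.

  The relative distance of these codes may exceed \<open>\<delta>\<close>.  Projecting one qudit onto a basis state keeps
  the dimension and lowers the distance by at most one, so repeated puncturing stops at a code whose
  distance lies between \<open>\<delta> n'\<close> and \<open>\<delta> n' + 1\<close>; its rate has not decreased.  A convergent subsequence of
  the rates gives a point of \<open>U_Q\<close> above \<open>\<delta>\<close>.
\<close>

section \<open>Adjoints, traces and isometries\<close>

text \<open>A single qudit has q^2 error labels, and q^2 - 1 = (q + 1)(q - 1) is the number of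
  nontrivial ones: this is why \<delta> log_q(q + 1) and H_q(\<delta>) appear together, their sum
  being the exponent of a Hamming ball over q^2 letters. That exponential estimate holds for
  \<delta> up to 1 - 1/q^2, and a positive bound already forces \<delta> into this range; a
  nonpositive bound is trivial.

  A q-qudit is treated as a block of m qudits of dimension p, so that the pairing takes values in
  p-th roots of unity and every nontrivial character has a kernel of index exactly p, while weights
  are still counted per block.

  Dimensions are tracked through traces of projections, which add up over eigenspaces, so no
  eigenspace dimension has to be computed.

  Two side conditions shape the final choice of lengths. The dimension has to stay at least two, so
  that the purity convention for one-dimensional codes does not intervene, and the punctured lengths
  have to tend to infinity, which follows because log_q of the dimension cannot exceed the
  length.\<close>

definition adj :: "complex mat \<Rightarrow> complex mat" where
  "adj A = mat (dim_col A) (dim_row A) (\<lambda>(i, j). cnj (A $$ (j, i)))"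

lemma adj_carrier [simp]: "A \<in> carrier_mat n m \<Longrightarrow> adj A \<in> carrier_mat m n"
  by (simp add: adj_def)

lemma adj_dim [simp]: "dim_row (adj A) = dim_col A" "dim_col (adj A) = dim_row A"
  by (simp_all add: adj_def)

lemma adj_index [simp]: "i < dim_col A \<Longrightarrow> j < dim_row A \<Longrightarrow> adj A $$ (i, j) = cnj (A $$ (j, i))"
  by (simp add: adj_def)

lemma adj_adj [simp]: "adj (adj A) = A"
  by (rule eq_matI) auto

lemma adj_one [simp]: "adj (1\<^sub>m n) = 1\<^sub>m n"
  by (rule eq_matI) auto

lemma adj_smult: "adj (c \<cdot>\<^sub>m A) = cnj c \<cdot>\<^sub>m adj A"
  by (rule eq_matI) auto

lemma smult_smult_mat: "a \<cdot>\<^sub>m (b \<cdot>\<^sub>m A) = (a * b :: 'a :: semigroup_mult) \<cdot>\<^sub>m A"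
  by (rule eq_matI) (auto simp: mult.assoc)

lemma smult_one_mat: "(1 :: 'a :: monoid_mult) \<cdot>\<^sub>m A = A"
  by (rule eq_matI) auto

lemma mult_index:
  fixes A :: "'a :: semiring_0 mat"
  assumes "A \<in> carrier_mat n m" "B \<in> carrier_mat m l" "i < n" "j < l"
  shows "(A * B) $$ (i, j) = (\<Sum>k<m. A $$ (i, k) * B $$ (k, j))"
  using assms by (simp add: scalar_prod_def lessThan_atLeast0)

lemma mult_vec_index:
  fixes A :: "'a :: semiring_0 mat"
  assumes "A \<in> carrier_mat n m" "v \<in> carrier_vec m" "i < n"
  shows "(A *\<^sub>v v) $ i = (\<Sum>k<m. A $$ (i, k) * v $ k)"
  using assms by (simp add: scalar_prod_def lessThan_atLeast0)

lemma adj_mult: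
  assumes "A \<in> carrier_mat n m" "B \<in> carrier_mat m l"
  shows "adj (A * B) = adj B * adj A"
proof (rule eq_matI)
  fix i j assume "i < dim_row (adj B * adj A)" "j < dim_col (adj B * adj A)"
  then have ij: "i < l" "j < n" using assms by auto
  have "adj (A * B) $$ (i, j) = (\<Sum>k<m. cnj (A $$ (j, k)) * cnj (B $$ (k, i)))"
    using assms ij by (subst adj_index) (auto simp: mult_index simp del: index_mult_mat(1))
  also have "\<dots> = (adj B * adj A) $$ (i, j)"
    using assms ij by (subst mult_index[OF adj_carrier adj_carrier]) (auto simp: mult.commute)
  finally show "adj (A * B) $$ (i, j) = (adj B * adj A) $$ (i, j)" .
qed (use assms in auto)

lemma mat_eqI_vec:
  fixes A B :: "complex mat"
  assumes A: "A \<in> carrier_mat n m" and B: "B \<in> carrier_mat n m"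
    and eq: "\<And>v. v \<in> carrier_vec m \<Longrightarrow> A *\<^sub>v v = B *\<^sub>v v"
  shows "A = B"
proof (rule eq_matI)
  fix i j assume "i < dim_row B" "j < dim_col B"
  then have ij: "i < n" "j < m" using B by auto
  have "(A *\<^sub>v unit_vec m j) $ i = (B *\<^sub>v unit_vec m j) $ i"
    by (simp add: eq)
  then show "A $$ (i, j) = B $$ (i, j)"
    using A B ij by simp
qed (use A B in auto)

lemma cinner_mult_mat_vec:
  assumes A: "A \<in> carrier_mat n m" and x: "x \<in> carrier_vec m" and y: "y \<in> carrier_vec n"
  shows "(A *\<^sub>v x) \<bullet>c y = x \<bullet>c (adj A *\<^sub>v y)"
proof -
  have "(A *\<^sub>v x) \<bullet>c y = (\<Sum>i<n. (\<Sum>j<m. A $$ (i, j) * x $ j) * cnj (y $ i))"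
    using assms by (auto simp: scalar_prod_def lessThan_atLeast0)
  also have "\<dots> = (\<Sum>j<m. x $ j * cnj (\<Sum>i<n. cnj (A $$ (i, j)) * y $ i))"
    by (simp add: sum_distrib_left sum_distrib_right mult_ac) (rule sum.swap)
  also have "\<dots> = x \<bullet>c (adj A *\<^sub>v y)"
    using assms by (auto simp: scalar_prod_def lessThan_atLeast0 intro!: sum.cong)
  finally show ?thesis .
qed

lemma mat_trace_comm:
  assumes "A \<in> carrier_mat n m" "B \<in> carrier_mat m n"
  shows "mat_trace (A * B) = mat_trace (B * A)"
proof -
  have "mat_trace (A * B) = (\<Sum>i<n. \<Sum>k<m. A $$ (i, k) * B $$ (k, i))"
    using assms by (auto simp: mat_trace_def mult_index simp del: index_mult_mat(1))
  also have "\<dots> = (\<Sum>k<m. \<Sum>i<n. B $$ (k, i) * A $$ (i, k))"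
    by (subst sum.swap) (simp add: mult.commute)
  also have "\<dots> = mat_trace (B * A)"
    using assms by (auto simp: mat_trace_def mult_index simp del: index_mult_mat(1))
  finally show ?thesis .
qed

lemma mat_trace_one: "mat_trace (1\<^sub>m n) = of_nat n"
  by (simp add: mat_trace_def)

text \<open>For a Hermitian idempotent, P_ii is the sum over k of |P_ik|^2, hence at least P_ii^2,
  so each diagonal entry is at most 1.\<close>

lemma trace_projection_le:
  assumes P: "P \<in> carrier_mat n n" and idem: "P * P = P" and herm: "adj P = P"
  shows "Re (mat_trace P) \<le> real n"
proof -
  have "Re (P $$ (i, i)) \<le> 1" if i: "i < n" for i
  proof -
    have sym: "P $$ (k, i) = cnj (P $$ (i, k))" if "k < n" for k
      using herm P i that adj_index[of k P i] by auto
    have "P $$ (i, i) = (\<Sum>k<n. P $$ (i, k) * P $$ (k, i))"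
      using mult_index[OF P P i i] idem by simp
    also have "\<dots> = (\<Sum>k<n. of_real ((cmod (P $$ (i, k)))\<^sup>2))"
      by (intro sum.cong refl) (simp add: sym complex_norm_square[symmetric] del: of_real_power)
    finally have eq: "Re (P $$ (i, i)) = (\<Sum>k<n. (cmod (P $$ (i, k)))\<^sup>2)"
      by (metis Re_complex_of_real of_real_sum)
    have "(Re (P $$ (i, i)))\<^sup>2 \<le> (cmod (P $$ (i, i)))\<^sup>2"
      by (simp add: abs_Re_le_cmod abs_le_square_iff[symmetric])
    also have "\<dots> \<le> (\<Sum>k<n. (cmod (P $$ (i, k)))\<^sup>2)"
      using i by (intro member_le_sum) auto
    finally have sq: "(Re (P $$ (i, i)))\<^sup>2 \<le> Re (P $$ (i, i))" using eq by simp
    show ?thesis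
    proof (rule ccontr)
      assume "\<not> ?thesis"
      then have "Re (P $$ (i, i)) * 1 < Re (P $$ (i, i)) * Re (P $$ (i, i))"
        by (intro mult_strict_left_mono) auto
      then show False using sq by (simp add: power2_eq_square)
    qed
  qed
  then have "(\<Sum>i<n. Re (P $$ (i, i))) \<le> (\<Sum>i<n. 1)"
    by (intro sum_mono) auto
  then show ?thesis using P by (simp add: mat_trace_def)
qed

section \<open>Codes as ranges of isometries\<close>

text \<open>The columns of \<open>U\<close> form an orthonormal basis of a code. In this form the
  projection is \<open>U * adj U\<close>, the dimension is the number of columns, and the error
  conditions become identities between K by K matrices.\<close>

definition isometry :: "nat \<Rightarrow> nat \<Rightarrow> complex mat \<Rightarrow> bool" where
  "isometry N K U \<longleftrightarrow> U \<in> carrier_mat N K \<and> adj U * U = 1\<^sub>m K"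

definition mrange :: "complex mat \<Rightarrow> complex vec set" where
  "mrange U = (\<lambda>x. U *\<^sub>v x) ` carrier_vec (dim_col U)"

context
  fixes N K :: nat and U :: "complex mat"
  assumes iso: "isometry N K U"
begin

lemma isometry_carrier: "U \<in> carrier_mat N K"
  using iso by (simp add: isometry_def)

lemma isometry_adj_mult: "adj U * U = 1\<^sub>m K"
  using iso by (simp add: isometry_def)

lemma isometry_proj_idem: "U * adj U * (U * adj U) = U * adj U"
proof -
  note U = isometry_carrier and aU = adj_carrier[OF isometry_carrier]
  have "U * adj U * (U * adj U) = U * (adj U * (U * adj U))"
    by (rule assoc_mult_mat[OF U aU mult_carrier_mat[OF U aU]])
  also have "\<dots> = U * (adj U * U * adj U)"
    by (simp only: assoc_mult_mat[OF aU U aU])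
  finally show ?thesis by (simp add: isometry_adj_mult left_mult_one_mat[OF aU])
qed

lemma isometry_proj_herm: "adj (U * adj U) = U * adj U"
  using isometry_carrier by (simp add: adj_mult[OF _ adj_carrier])

lemma isometry_proj_trace: "mat_trace (U * adj U) = of_nat K"
  using mat_trace_comm[OF isometry_carrier adj_carrier[OF isometry_carrier]]
  by (simp add: isometry_adj_mult mat_trace_one)

lemma isometry_dim_le: "K \<le> N"
proof -
  have "Re (mat_trace (U * adj U)) \<le> real N"
    by (intro trace_projection_le isometry_proj_idem isometry_proj_herm mult_carrier_mat[of _ N K]
         isometry_carrier adj_carrier)
  then show ?thesis by (simp add: isometry_proj_trace)
qed

lemma isometry_left_inverse: "x \<in> carrier_vec K \<Longrightarrow> adj U *\<^sub>v (U *\<^sub>v x) = x"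
  using isometry_carrier
  by (subst assoc_mult_mat_vec[of _ K N _ K, symmetric]) (auto simp: isometry_adj_mult)

lemma isometry_is_orth_projection: "is_orth_projection N (mrange U) (U * adj U)"
  unfolding is_orth_projection_def
proof (intro conjI ballI)
  note U = isometry_carrier
  show "U * adj U \<in> carrier_mat N N" using U by simp
  fix v :: "complex vec" assume v: "v \<in> carrier_vec N"
  have eq: "U * adj U *\<^sub>v v = U *\<^sub>v (adj U *\<^sub>v v)"
    using U v by (intro assoc_mult_mat_vec[of _ N K _ N]) auto
  have av: "adj U *\<^sub>v v \<in> carrier_vec K" by (rule mult_mat_vec_carrier[OF adj_carrier[OF U] v])
  show "U * adj U *\<^sub>v v \<in> mrange U"
    unfolding eq mrange_def using U av by auto
  fix w assume "w \<in> mrange U"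
  then obtain y where y: "y \<in> carrier_vec K" "w = U *\<^sub>v y"
    using U by (auto simp: mrange_def)
  have aU: "adj U *\<^sub>v (U * adj U *\<^sub>v v) = adj U *\<^sub>v v"
    unfolding eq by (rule isometry_left_inverse[OF av])
  have d: "U * adj U *\<^sub>v v \<in> carrier_vec N" using U by (metis eq av mult_mat_vec_carrier)
  have "w \<bullet>c (v - U * adj U *\<^sub>v v) = y \<bullet>c (adj U *\<^sub>v (v - U * adj U *\<^sub>v v))"
    unfolding y using U y v d by (intro cinner_mult_mat_vec) auto
  also have "adj U *\<^sub>v (v - U * adj U *\<^sub>v v) = adj U *\<^sub>v v - adj U *\<^sub>v (U * adj U *\<^sub>v v)"
    using U v d by (intro mult_minus_distrib_mat_vec) auto
  also have "\<dots> = 0\<^sub>v K" unfolding aU using av by simp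
  finally have "w \<bullet>c (v - U * adj U *\<^sub>v v) = 0" using y by simp
  moreover have "(v - U * adj U *\<^sub>v v) \<bullet>c w = conjugate (w \<bullet>c (v - U * adj U *\<^sub>v v))"
  proof -
    have "w \<in> carrier_vec N" using U y by auto
    then show ?thesis using v d
      by (subst conjugate_sprod_vec[of _ N]) (auto simp: comm_scalar_prod[of _ N])
  qed
  ultimately show "(v - U * adj U *\<^sub>v v) \<bullet>c w = 0" by simp
qed

text \<open>The residual of v is orthogonal to the range, so \<open>adj U\<close> kills it, and this
  determines the coordinates of the projected vector. Together with existence it makes the definite
  description in \<open>orth_projection\<close> meaningful.\<close>

lemma orth_projection_unique:
  assumes P: "is_orth_projection N (mrange U) P"
  shows "P = U * adj U"
proof (rule mat_eqI_vec)
  note U = isometry_carrier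
  show Pc: "P \<in> carrier_mat N N" using P by (simp add: is_orth_projection_def)
  show "U * adj U \<in> carrier_mat N N" using U by simp
  fix v :: "complex vec" assume v: "v \<in> carrier_vec N"
  then obtain x where x: "x \<in> carrier_vec K" "P *\<^sub>v v = U *\<^sub>v x"
    using P U by (auto simp: is_orth_projection_def mrange_def)
  define z where "z = v - P *\<^sub>v v"
  have z: "z \<in> carrier_vec N" using v Pc by (simp add: z_def)
  have az: "adj U *\<^sub>v z \<in> carrier_vec K" by (rule mult_mat_vec_carrier[OF adj_carrier[OF U] z])
  \<comment> \<open>Testing the residual against its own image in the range gives the squared norm
    of \<open>adj U *\<^sub>v z\<close>.\<close>
  have "z \<bullet>c (U *\<^sub>v (adj U *\<^sub>v z)) = 0"
    using P v U az by (auto simp: is_orth_projection_def z_def mrange_def)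
  then have "(adj U *\<^sub>v z) \<bullet>c (adj U *\<^sub>v z) = 0"
    using cinner_mult_mat_vec[OF adj_carrier[OF U] z az] by simp
  then have "adj U *\<^sub>v z = 0\<^sub>v K" using az by simp
  moreover have "adj U *\<^sub>v z = adj U *\<^sub>v v - x"
    unfolding z_def x(2) using U v x
    by (subst mult_minus_distrib_mat_vec[of _ K N]) (auto simp: isometry_left_inverse)
  ultimately have "x = adj U *\<^sub>v v"
  proof -
    assume a: "adj U *\<^sub>v z = 0\<^sub>v K" "adj U *\<^sub>v z = adj U *\<^sub>v v - x"
    have "(adj U *\<^sub>v v) $ i = x $ i" if "i < K" for i
    proof -
      have "(adj U *\<^sub>v v - x) $ i = 0" using a that by simp
      then show ?thesis using x that U by simp
    qed
    then show ?thesis using x U by (intro eq_vecI) auto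
  qed
  then show "P *\<^sub>v v = U * adj U *\<^sub>v v"
    using U v x by (simp add: assoc_mult_mat_vec[of _ N K _ N])
qed

lemma isometry_orth_projection: "orth_projection N (mrange U) = U * adj U"
  unfolding orth_projection_def
  using isometry_is_orth_projection orth_projection_unique by (rule the_equality)

text \<open>Rank-nullity for x \<mapsto> U x: the kernel is trivial because \<open>adj U\<close> is
  a left inverse, so the image has dimension K.\<close>

lemma isometry_subspace:
  "VectorSpace.subspace class_ring (mrange U) (module_vec TYPE(complex) N)" (is ?sub)
  and isometry_dim:
  "vectorspace.dim class_ring ((module_vec TYPE(complex) N)\<lparr>carrier := mrange U\<rparr>) = K" (is ?dim)
proof -
  note U = isometry_carrier
  let ?V = "module_vec TYPE(complex) K" and ?W = "module_vec TYPE(complex) N"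
  interpret V: vec_space "TYPE(complex)" K .
  interpret lm: linear_map class_ring ?V ?W "\<lambda>x. U *\<^sub>v x"
    unfolding linear_map_def mod_hom_def mod_hom_axioms_def module_hom_def
    using U by (auto simp: vec_vs vec_module module_vec_simps class_ring_simps
        mult_add_distrib_mat_vec mult_mat_vec)
  have im: "lm.im = mrange U"
    using U by (auto simp: lm.im_def mrange_def module_vec_simps)
  have ker: "lm.ker = {0\<^sub>v K}"
  proof -
    have "x = 0\<^sub>v K" if "x \<in> carrier_vec K" "U *\<^sub>v x = 0\<^sub>v N" for x
      using isometry_left_inverse[OF that(1)] that U by auto
    then show ?thesis using U by (auto simp: lm.ker_def module_vec_simps)
  qed
  show ?sub using lm.imT_is_subspace im by simp
  have "vectorspace.dim class_ring (?W\<lparr>carrier := lm.im\<rparr>)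
      + vectorspace.dim class_ring (?V\<lparr>carrier := lm.ker\<rparr>) = V.dim"
    by (rule lm.rank_nullity) (rule V.fin_dim)
  moreover have "vectorspace.dim class_ring (?V\<lparr>carrier := {0\<^sub>v K}\<rparr>) = 0"
  proof -
    have "vectorspace class_ring (?V\<lparr>carrier := {0\<^sub>v K}\<rparr>)"
      using V.subspace_is_vs[OF lm.kerT_is_subspace] ker by simp
    then interpret k: vectorspace class_ring "?V\<lparr>carrier := {0\<^sub>v K}\<rparr>" .
    have "k.gen_set {}"
      using k.span_empty by (simp add: module_vec_simps)
    then show ?thesis
      unfolding k.dim_def by (intro Least_eq_0 exI[of _ "{}"]) auto
  qed
  ultimately show ?dim by (simp add: im ker V.dim_is_n)
qed

end

text \<open>One Gram-Schmidt step: a unit vector orthogonal to all columns is appended as a new last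
  column.\<close>

lemma isometry_append:
  assumes iso: "isometry N k U" and u: "u \<in> carrier_vec N"
    and orth: "adj U *\<^sub>v u = 0\<^sub>v k" and unit: "u \<bullet>c u = 1"
  defines "U' \<equiv> mat N (Suc k) (\<lambda>(i, j). if j < k then U $$ (i, j) else u $ i)"
  shows "isometry N (Suc k) U'"
    and "x \<in> carrier_vec (Suc k) \<Longrightarrow> U' *\<^sub>v x = U *\<^sub>v vec k (\<lambda>i. x $ i) + x $ k \<cdot>\<^sub>v u"
proof -
  note U = isometry_carrier[OF iso]
  have U': "U' \<in> carrier_mat N (Suc k)" by (simp add: U'_def)
  have c1: "(\<Sum>l<N. cnj (U $$ (l, i)) * U $$ (l, j)) = (if i = j then 1 else 0)"
    if "i < k" "j < k" for i j
  proof -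
    have "(adj U * U) $$ (i, j) = (\<Sum>l<N. cnj (U $$ (l, i)) * U $$ (l, j))"
      using U that by (subst mult_index[OF adj_carrier[OF U] U]) auto
    then show ?thesis using that isometry_adj_mult[OF iso] by simp
  qed
  have c2: "(\<Sum>l<N. cnj (U $$ (l, i)) * u $ l) = 0" if "i < k" for i
  proof -
    have "(adj U *\<^sub>v u) $ i = (\<Sum>l<N. cnj (U $$ (l, i)) * u $ l)"
      using U that by (subst mult_vec_index[OF adj_carrier[OF U] u]) auto
    then show ?thesis using that orth by simp
  qed
  have c3: "(\<Sum>l<N. cnj (u $ l) * U $$ (l, i)) = 0" if "i < k" for i
    using arg_cong[OF c2[OF that], of cnj] by (simp add: mult.commute)
  have c4: "(\<Sum>l<N. cnj (u $ l) * u $ l) = 1"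
    using unit u by (simp add: scalar_prod_def lessThan_atLeast0 mult.commute)
  have "adj U' * U' = 1\<^sub>m (Suc k)"
  proof (rule eq_matI)
    fix i j assume "i < dim_row (1\<^sub>m (Suc k))" "j < dim_col (1\<^sub>m (Suc k))"
    then have ij: "i < Suc k" "j < Suc k" by auto
    have "(adj U' * U') $$ (i, j) = (\<Sum>l<N. cnj (U' $$ (l, i)) * U' $$ (l, j))"
      using U' ij by (subst mult_index[OF adj_carrier[OF U'] U']) auto
    also have "\<dots> = (\<Sum>l<N. cnj (if i < k then U $$ (l, i) else u $ l) *
        (if j < k then U $$ (l, j) else u $ l))"
      using ij by (intro sum.cong) (auto simp: U'_def)
    also have "\<dots> = (if i = j then 1 else 0)"
      using ij c1 c2 c3 c4 by (cases "i < k"; cases "j < k") auto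
    finally show "(adj U' * U') $$ (i, j) = 1\<^sub>m (Suc k) $$ (i, j)" using ij by simp
  qed (use U' in auto)
  then show "isometry N (Suc k) U'" using U' by (simp add: isometry_def)
  assume x: "x \<in> carrier_vec (Suc k)"
  show "U' *\<^sub>v x = U *\<^sub>v vec k (\<lambda>i. x $ i) + x $ k \<cdot>\<^sub>v u"
  proof (rule eq_vecI)
    fix i assume "i < dim_vec (U *\<^sub>v vec k (\<lambda>i. x $ i) + x $ k \<cdot>\<^sub>v u)"
    then have i: "i < N" using u by simp
    have "(U' *\<^sub>v x) $ i = (\<Sum>j<Suc k. (if j < k then U $$ (i, j) else u $ i) * x $ j)"
      using i unfolding mult_vec_index[OF U' x i] by (intro sum.cong) (auto simp: U'_def)
    also have "\<dots> = (\<Sum>j<k. U $$ (i, j) * vec k (\<lambda>i. x $ i) $ j) + x $ k * u $ i"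
      by simp
    also have "\<dots> = (U *\<^sub>v vec k (\<lambda>i. x $ i)) $ i + x $ k * u $ i"
      using i by (subst mult_vec_index[OF U]) auto
    finally show "(U' *\<^sub>v x) $ i = (U *\<^sub>v vec k (\<lambda>i. x $ i) + x $ k \<cdot>\<^sub>v u) $ i"
      using i u U by simp
  qed (use U' U u in auto)
qed

text \<open>An isometry into Q with the largest possible number of columns exists, since that number
  is at most N. A vector of Q outside its range could be made orthogonal to the range and
  normalised, giving one more column.\<close>

lemma subspace_mrange:
  assumes sub: "VectorSpace.subspace class_ring Q (module_vec TYPE(complex) N)"
  obtains k U where "isometry N k U" "Q = mrange U"
proof -
  have Q: "Q \<subseteq> carrier_vec N" and Q0: "0\<^sub>v N \<in> Q"
    and Qadd: "\<And>v w. v \<in> Q \<Longrightarrow> w \<in> Q \<Longrightarrow> v + w \<in> Q"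
    and Qsm: "\<And>c v. v \<in> Q \<Longrightarrow> c \<cdot>\<^sub>v v \<in> Q"
    using sub unfolding VectorSpace.subspace_def submodule_def
    by (auto simp: module_vec_simps class_ring_simps)
  define S where "S = {k. \<exists>U. isometry N k U \<and> mrange U \<subseteq> Q}"
  have "isometry N 0 (0\<^sub>m N 0)"
    unfolding isometry_def by (auto intro!: eq_matI)
  moreover have "mrange (0\<^sub>m N 0) \<subseteq> Q"
  proof -
    have "0\<^sub>m N 0 *\<^sub>v x = 0\<^sub>v N" if "x \<in> carrier_vec 0" for x :: "complex vec"
      using that by (intro eq_vecI) (auto simp: scalar_prod_def)
    then show ?thesis using Q0 by (auto simp: mrange_def)
  qed
  ultimately have "0 \<in> S" by (auto simp: S_def)
  have "S \<subseteq> {..N}" using isometry_dim_le by (auto simp: S_def)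
  then have fin: "finite S" by (rule finite_subset) simp
  define k where "k = Max S"
  have "k \<in> S" unfolding k_def using fin \<open>0 \<in> S\<close> by (intro Max_in) auto
  then obtain U where iso: "isometry N k U" and UQ: "mrange U \<subseteq> Q" by (auto simp: S_def)
  note U = isometry_carrier[OF iso]
  have "v \<in> mrange U" if v: "v \<in> Q" for v
  proof (rule ccontr)
    assume nv: "v \<notin> mrange U"
    have vc: "v \<in> carrier_vec N" using v Q by auto
    define a where "a = adj U *\<^sub>v v"
    have a: "a \<in> carrier_vec k" unfolding a_def by (rule mult_mat_vec_carrier[OF adj_carrier[OF U] vc])
    define z where "z = v + (- 1) \<cdot>\<^sub>v (U *\<^sub>v a)"
    have Ua: "U *\<^sub>v a \<in> mrange U" using a U by (auto simp: mrange_def)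
    then have zQ: "z \<in> Q" unfolding z_def using UQ v by (intro Qadd Qsm) auto
    then have z: "z \<in> carrier_vec N" using Q by auto
    have zeq: "z = v - U *\<^sub>v a" unfolding z_def using vc U a by auto
    have z0: "z \<noteq> 0\<^sub>v N"
    proof
      assume "z = 0\<^sub>v N"
      have "v $ i = (U *\<^sub>v a) $ i" if "i < N" for i
      proof -
        have "(v - U *\<^sub>v a) $ i = 0" using \<open>z = 0\<^sub>v N\<close> zeq that by simp
        then show ?thesis using vc U a that by simp
      qed
      then have "v = U *\<^sub>v a" using vc U by (intro eq_vecI) auto
      then show False using Ua nv by simp
    qed
    have az: "adj U *\<^sub>v z = 0\<^sub>v k"
    proof -
      have "adj U *\<^sub>v z = adj U *\<^sub>v v - adj U *\<^sub>v (U *\<^sub>v a)"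
        unfolding zeq using U vc a by (intro mult_minus_distrib_mat_vec[of _ k N]) auto
      then show ?thesis using isometry_left_inverse[OF iso a] a by (simp add: a_def[symmetric])
    qed
    define t where "t = Re (z \<bullet>c z)"
    have zz: "z \<bullet>c z = of_real t" and t: "t > 0"
    proof -
      have eq: "z \<bullet>c z = of_real (\<Sum>i<N. (cmod (z $ i))\<^sup>2)"
        using z by (simp add: scalar_prod_def lessThan_atLeast0 complex_norm_square del: of_real_power)
      then show e: "z \<bullet>c z = of_real t" by (metis t_def Re_complex_of_real)
      have "t = (\<Sum>i<N. (cmod (z $ i))\<^sup>2)" using e eq by (metis of_real_eq_iff)
      then have "t \<ge> 0" by (simp add: sum_nonneg)
      moreover have "t \<noteq> 0" using e z z0 by auto
      ultimately show "t > 0" by simp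
    qed
    define c where "c = complex_of_real (1 / sqrt t)"
    define u where "u = c \<cdot>\<^sub>v z"
    have u: "u \<in> carrier_vec N" using z by (simp add: u_def)
    have au: "adj U *\<^sub>v u = 0\<^sub>v k"
      unfolding u_def using mult_mat_vec[OF adj_carrier[OF U] z] az by auto
    have uu: "u \<bullet>c u = 1"
    proof -
      have "u \<bullet>c u = c * cnj c * (z \<bullet>c z)"
        unfolding u_def using z by (simp add: conjugate_smult_vec)
      also have "\<dots> = 1"
        using t unfolding zz c_def
        by (simp flip: of_real_mult of_real_divide)
      finally show ?thesis .
    qed
    note app = isometry_append[OF iso u au uu]
    define U' where "U' = mat N (Suc k) (\<lambda>(i, j). if j < k then U $$ (i, j) else u $ i)"
    have U': "isometry N (Suc k) U'"
      and act: "\<And>x. x \<in> carrier_vec (Suc k) \<Longrightarrow> U' *\<^sub>v x = U *\<^sub>v vec k (\<lambda>i. x $ i) + x $ k \<cdot>\<^sub>v u"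
      unfolding U'_def using app by blast+
    have "mrange U' \<subseteq> Q"
    proof -
      have "U *\<^sub>v vec k (\<lambda>i. x $ i) + x $ k \<cdot>\<^sub>v u \<in> Q" for x
        unfolding u_def using UQ U by (intro Qadd Qsm zQ) (auto simp: mrange_def)
      then show ?thesis using isometry_carrier[OF U'] act by (auto simp: mrange_def)
    qed
    then have "Suc k \<in> S" using U' by (auto simp: S_def)
    then show False using Max_ge[OF fin] k_def by fastforce
  qed
  then show thesis using that[OF iso] UQ by blast
qed

text \<open>Applied to the fixed space of P, the uniqueness of orthogonal projections identifies P
  with \<open>U * adj U\<close>. This is the passage from a lower bound on the trace of a projection
  to a lower bound on the dimension of a code.\<close>

lemma projection_mrange:
  assumes P: "P \<in> carrier_mat N N" and idem: "P * P = P" and herm: "adj P = P"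
  obtains k U where "isometry N k U" "P = U * adj U" "mat_trace P = of_nat k"
proof -
  define Q where "Q = {v \<in> carrier_vec N. P *\<^sub>v v = v}"
  have "VectorSpace.subspace class_ring Q (module_vec TYPE(complex) N)"
    unfolding VectorSpace.subspace_def submodule_def Q_def using P
    by (auto simp: vec_vs vec_module module_vec_simps class_ring_simps
        mult_add_distrib_mat_vec mult_mat_vec)
  then obtain k U where iso: "isometry N k U" and Q: "Q = mrange U"
    by (rule subspace_mrange)
  have "is_orth_projection N (mrange U) P"
    unfolding is_orth_projection_def Q[symmetric]
  proof (intro conjI ballI P)
    fix v :: "complex vec" assume v: "v \<in> carrier_vec N"
    have PP: "P *\<^sub>v (P *\<^sub>v v) = P *\<^sub>v v"
      using assoc_mult_mat_vec[OF P P v] idem by simp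
    then show "P *\<^sub>v v \<in> Q" using P v by (simp add: Q_def)
    fix w assume "w \<in> Q"
    then have w: "w \<in> carrier_vec N" "P *\<^sub>v w = w" by (auto simp: Q_def)
    have Pv: "P *\<^sub>v v \<in> carrier_vec N" using P v by simp
    have "(v - P *\<^sub>v v) \<bullet>c w = v \<bullet>c w - (P *\<^sub>v v) \<bullet>c w"
      using v w Pv by (intro minus_scalar_prod_distrib[of _ N]) auto
    also have "(P *\<^sub>v v) \<bullet>c w = v \<bullet>c w"
      using cinner_mult_mat_vec[OF P v w(1)] herm w(2) by simp
    finally show "(v - P *\<^sub>v v) \<bullet>c w = 0" by simp
  qed
  then have "P = U * adj U" by (rule orth_projection_unique[OF iso])
  then show thesis using that[OF iso] isometry_proj_trace[OF iso] by simp
qed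

text \<open>Knill--Laflamme: conjugating with the isometry turns \<open>P E P = c P\<close> into \<open>U\<^sup>* E U = c\<close>.\<close>

lemma isometry_knill_laflamme:
  assumes iso: "isometry N k U" and E: "E \<in> carrier_mat N N"
  shows "U * adj U * E * (U * adj U) = c \<cdot>\<^sub>m (U * adj U) \<longleftrightarrow> adj U * E * U = c \<cdot>\<^sub>m 1\<^sub>m k"
proof -
  note U = isometry_carrier[OF iso] and aUU = isometry_adj_mult[OF iso]
  note aU = adj_carrier[OF U]
  note aUE = mult_carrier_mat[OF aU E]
  note M = mult_carrier_mat[OF aUE U]
  have eq: "U * adj U * E * (U * adj U) = U * (adj U * E * U) * adj U"
    by (simp only: assoc_mult_mat[OF U aU E] assoc_mult_mat[OF U aUE mult_carrier_mat[OF U aU]]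
        assoc_mult_mat[OF aUE U aU, symmetric] assoc_mult_mat[OF U M aU])
  show ?thesis
  proof
    assume a: "adj U * E * U = c \<cdot>\<^sub>m 1\<^sub>m k"
    have "U * (c \<cdot>\<^sub>m 1\<^sub>m k) * adj U = c \<cdot>\<^sub>m (U * adj U)"
      by (simp only: mult_smult_distrib[OF U one_carrier_mat] right_mult_one_mat[OF U]
          mult_smult_assoc_mat[OF U aU])
    then show "U * adj U * E * (U * adj U) = c \<cdot>\<^sub>m (U * adj U)" using eq a by simp
  next
    assume a: "U * adj U * E * (U * adj U) = c \<cdot>\<^sub>m (U * adj U)"
    have gen: "adj U * (U * X * adj U) * U = X" if X: "X \<in> carrier_mat k k" for X
    proof -
      have "adj U * (U * X * adj U) * U = adj U * (U * X) * adj U * U"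
        by (simp only: assoc_mult_mat[OF aU mult_carrier_mat[OF U X] aU])
      also have "\<dots> = adj U * (U * X) * (adj U * U)"
        by (rule assoc_mult_mat[OF mult_carrier_mat[OF aU mult_carrier_mat[OF U X]] aU U])
      also have "adj U * (U * X) = X"
        by (simp only: assoc_mult_mat[OF aU U X, symmetric] aUU left_mult_one_mat[OF X])
      finally show ?thesis using right_mult_one_mat[OF X] by (simp only: aUU)
    qed
    have l: "adj U * (U * (adj U * E * U) * adj U) * U = adj U * E * U" by (rule gen[OF M])
    have "adj U * (c \<cdot>\<^sub>m (U * adj U)) * U = c \<cdot>\<^sub>m (adj U * (U * adj U) * U)"
      by (simp only: mult_smult_distrib[OF aU mult_carrier_mat[OF U aU]]
         mult_smult_assoc_mat[OF mult_carrier_mat[OF aU mult_carrier_mat[OF U aU]] U])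
    also have "adj U * (U * adj U) * U = 1\<^sub>m k"
      by (simp only: assoc_mult_mat[OF aU U aU, symmetric] 
         assoc_mult_mat[OF mult_carrier_mat[OF aU U] aU U] aUU left_mult_one_mat[OF aU])
    finally show "adj U * E * U = c \<cdot>\<^sub>m 1\<^sub>m k" using l eq a by simp
  qed
qed

section \<open>Kronecker products and puncturing\<close>

lemma sum_lessThan_mult:
  fixes f :: "nat \<Rightarrow> 'a :: comm_monoid_add"
  shows "(\<Sum>k<m * n. f k) = (\<Sum>i<m. \<Sum>j<n. f (i * n + j))"
proof (induction m)
  case (Suc m)
  have "{..<Suc m * n} = {..<m * n} \<union> {m * n..<m * n + n}" by auto
  then have "(\<Sum>k<Suc m * n. f k) = (\<Sum>k<m * n. f k) + (\<Sum>k=m * n..<m * n + n. f k)"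
    by (simp add: sum.union_disjoint ivl_disj_int)
  also have "(\<Sum>k=m * n..<m * n + n. f k) = (\<Sum>j<n. f (m * n + j))"
    using sum.shift_bounds_nat_ivl[of f 0 "m * n" n]
    by (simp add: lessThan_atLeast0 add.commute)
  finally show ?case using Suc by simp
qed simp

lemma less_mult_div_mod:
  fixes i :: nat
  assumes "i < a * b"
  shows "i div b < a" "i mod b < b"
  using assms by (auto simp: less_mult_imp_div_less) (metis mod_less_divisor mult_0_right neq0_conv not_less0)

lemma kronecker_carrier [simp]:
  "A \<in> carrier_mat a b \<Longrightarrow> B \<in> carrier_mat c d \<Longrightarrow> kronecker A B \<in> carrier_mat (a * c) (b * d)"
  by (simp add: kronecker_def)

lemma kronecker_dim [simp]:
  "dim_row (kronecker A B) = dim_row A * dim_row B" "dim_col (kronecker A B) = dim_col A * dim_col B"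
  by (simp_all add: kronecker_def)

lemma kronecker_index [simp]:
  assumes "i < dim_row A * dim_row B" "j < dim_col A * dim_col B"
  shows "kronecker A B $$ (i, j) =
    A $$ (i div dim_row B, j div dim_col B) * B $$ (i mod dim_row B, j mod dim_col B)"
  using assms by (simp add: kronecker_def)

lemma kronecker_mult:
  assumes A: "A \<in> carrier_mat a b" and B: "B \<in> carrier_mat a' b'"
    and C: "C \<in> carrier_mat b c" and D: "D \<in> carrier_mat b' c'"
  shows "kronecker A B * kronecker C D = kronecker (A * C) (B * D)"
proof (rule eq_matI)
  fix i j assume "i < dim_row (kronecker (A * C) (B * D))" "j < dim_col (kronecker (A * C) (B * D))"
  then have ij: "i < a * a'" "j < c * c'" using assms by auto
  note ij' = less_mult_div_mod[OF ij(1)] less_mult_div_mod[OF ij(2)]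
  have "(kronecker A B * kronecker C D) $$ (i, j) =
      (\<Sum>k<b * b'. kronecker A B $$ (i, k) * kronecker C D $$ (k, j))"
    using assms ij by (intro mult_index) auto
  also have "\<dots> = (\<Sum>k<b. \<Sum>l<b'. kronecker A B $$ (i, k * b' + l) * kronecker C D $$ (k * b' + l, j))"
    by (rule sum_lessThan_mult)
  also have "\<dots> = (\<Sum>k<b. \<Sum>l<b'. (A $$ (i div a', k) * C $$ (k, j div c')) *
      (B $$ (i mod a', l) * D $$ (l, j mod c')))"
  proof (intro sum.cong refl)
    fix k l assume kl: "k \<in> {..<b}" "l \<in> {..<b'}"
    have "k * b' + l < b * b'"
    proof -
      have "k * b' + l < Suc k * b'" using kl by simp
      also have "\<dots> \<le> b * b'" using kl by (intro mult_le_mono1) auto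
      finally show ?thesis .
    qed
    then show "kronecker A B $$ (i, k * b' + l) * kronecker C D $$ (k * b' + l, j) =
      (A $$ (i div a', k) * C $$ (k, j div c')) * (B $$ (i mod a', l) * D $$ (l, j mod c'))"
      using assms ij kl by simp
  qed
  also have "\<dots> = (A * C) $$ (i div a', j div c') * (B * D) $$ (i mod a', j mod c')"
    unfolding mult_index[OF A C ij'(1,3)] mult_index[OF B D ij'(2,4)]
    by (simp add: sum_product)
  also have "\<dots> = kronecker (A * C) (B * D) $$ (i, j)"
    using assms ij by simp
  finally show "(kronecker A B * kronecker C D) $$ (i, j) = kronecker (A * C) (B * D) $$ (i, j)" .
qed (use assms in auto)

lemma kronecker_adj: "adj (kronecker A B) = kronecker (adj A) (adj B)"
  by (rule eq_matI) (auto simp: less_mult_div_mod)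

lemma kronecker_one: "kronecker (1\<^sub>m a) (1\<^sub>m b) = 1\<^sub>m (a * b)"
proof (rule eq_matI)
  fix i j assume "i < dim_row (1\<^sub>m (a * b))" "j < dim_col (1\<^sub>m (a * b))"
  then have ij: "i < a * b" "j < a * b" by auto
  have "i = j \<longleftrightarrow> i div b = j div b \<and> i mod b = j mod b" by (metis div_mult_mod_eq)
  then show "kronecker (1\<^sub>m a) (1\<^sub>m b) $$ (i, j) = 1\<^sub>m (a * b) $$ (i, j)"
    using ij less_mult_div_mod[OF ij(1)] less_mult_div_mod[OF ij(2)] by auto
qed auto

lemma kronecker_smult:
  "kronecker (c \<cdot>\<^sub>m A) (d \<cdot>\<^sub>m B) = (c * d) \<cdot>\<^sub>m kronecker A B"
  by (rule eq_matI) (auto simp: less_mult_div_mod)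

lemma kronecker_smult1: "kronecker (c \<cdot>\<^sub>m A) B = c \<cdot>\<^sub>m kronecker A B"
  by (rule eq_matI) (auto simp: less_mult_div_mod)

lemma kronecker_smult2: "kronecker A (c \<cdot>\<^sub>m B) = c \<cdot>\<^sub>m kronecker A B"
  by (rule eq_matI) (auto simp: less_mult_div_mod)

lemma kronecker_add1:
  assumes "A \<in> carrier_mat a b" "A' \<in> carrier_mat a b"
  shows "kronecker (A + A') B = kronecker A B + kronecker A' B"
  using assms by (intro eq_matI) (auto simp: less_mult_div_mod distrib_right)

lemma kronecker_add2:
  assumes "B \<in> carrier_mat a b" "B' \<in> carrier_mat a b"
  shows "kronecker A (B + B') = kronecker A B + kronecker A B'"
  using assms by (intro eq_matI) (auto simp: less_mult_div_mod distrib_left)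

lemma kronecker_one_left: "kronecker (1\<^sub>m 1) B = B"
  by (rule eq_matI) auto

lemma tensor_list_simps [simp]:
  "tensor_list [] = 1\<^sub>m 1" "tensor_list (E # Es) = kronecker E (tensor_list Es)"
  by (simp_all add: tensor_list_def)

lemma tensor_list_carrier:
  "set Es \<subseteq> carrier_mat q q \<Longrightarrow> tensor_list Es \<in> carrier_mat (q ^ length Es) (q ^ length Es)"
  by (induction Es) auto

lemma tensor_list_ones: "tensor_list (replicate n (1\<^sub>m q)) = 1\<^sub>m (q ^ n)"
  by (induction n) (auto simp: kronecker_one)

section \<open>Minimum distance and puncturing\<close>

definition detects :: "nat \<Rightarrow> nat \<Rightarrow> nat \<Rightarrow> complex mat \<Rightarrow> nat \<Rightarrow> bool" where
  "detects q n K U d \<longleftrightarrow> (\<forall>Es\<in>factor_lists q n. error_weight q Es < d \<longrightarrow>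
     (\<exists>c. adj U * tensor_list Es * U = c \<cdot>\<^sub>m 1\<^sub>m K))"

lemma factor_lists_tensor_carrier:
  "Es \<in> factor_lists q n \<Longrightarrow> tensor_list Es \<in> carrier_mat (q ^ n) (q ^ n)"
  using tensor_list_carrier[of Es q] by (auto simp: factor_lists_def)

lemma isometry_code_dim: "isometry (q ^ n) K U \<Longrightarrow> code_dim q n (mrange U) = K"
  unfolding code_dim_def by (rule isometry_dim)

lemma isometry_quantum_code: "isometry (q ^ n) K U \<Longrightarrow> K \<ge> 1 \<Longrightarrow> quantum_code q n (mrange U)"
  unfolding quantum_code_def using isometry_subspace isometry_code_dim by auto

text \<open>For K \<ge> 2 the purity clause has a false premise, and what remains is the
  Knill-Laflamme condition, rewritten with the isometry in place of the projection.\<close>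

lemma detects_below_iff:
  assumes iso: "isometry (q ^ n) K U" and K: "K \<ge> 2"
  shows "detects_below q n (mrange U) d \<longleftrightarrow> detects q n K U d"
  unfolding detects_below_def detects_def isometry_code_dim[OF iso] isometry_orth_projection[OF iso] Let_def
  using K isometry_knill_laflamme[OF iso factor_lists_tensor_carrier] by auto

text \<open>No error has weight below 0, so the maximum in \<open>min_distance\<close> is taken over
  a nonempty finite set.\<close>

lemma min_distance_set:
  "finite {d. d \<le> n + 1 \<and> detects_below q n Q d}" "0 \<in> {d. d \<le> n + 1 \<and> detects_below q n Q d}"
  by (auto simp: detects_below_def Let_def)

lemma min_distance_ge: "d \<le> n + 1 \<Longrightarrow> detects_below q n Q d \<Longrightarrow> d \<le> min_distance q n Q"
  unfolding min_distance_def using min_distance_set by (intro Max_ge) auto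

lemma min_distance_detects: "detects_below q n Q (min_distance q n Q)"
  and min_distance_le: "min_distance q n Q \<le> n + 1"
proof -
  have "min_distance q n Q \<in> {d. d \<le> n + 1 \<and> detects_below q n Q d}"
    unfolding min_distance_def by (rule Max_in[OF min_distance_set(1)]) (use min_distance_set(2) in blast)
  then show "detects_below q n Q (min_distance q n Q)" "min_distance q n Q \<le> n + 1" by auto
qed

lemma gram_diag:
  assumes "V \<in> carrier_mat N K" "l < K"
  shows "(adj V * V) $$ (l, l) = of_real (\<Sum>i<N. (cmod (V $$ (i, l)))\<^sup>2)"
  using assms by (subst mult_index[OF adj_carrier])
    (auto simp: complex_norm_square mult.commute simp del: of_real_power)

text \<open>Projecting the first qudit of a code onto a basis state \<open>j\<close> embeds a detectable single-qudit
  error in front of every error on the other qudits, so the projection is a multiple of an isometry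
  and costs at most one unit of distance.\<close>

lemma puncture:
  assumes iso: "isometry (q ^ Suc n) K U" and K: "K \<ge> 1"
    and det: "detects q (Suc n) K U (Suc d)" and d: "d \<ge> 1"
  obtains U' where "isometry (q ^ n) K U'" "detects q n K U' d"
proof -
  define N where "N = q ^ n"
  have U: "U \<in> carrier_mat (q * N) K" using isometry_carrier[OF iso] by (simp add: N_def)
  note aU = adj_carrier[OF U]
  \<comment> \<open>\<open>r j\<close> is the row vector reading off the basis state j,
    \<open>e j\<close> is the rank-one projector onto that state, and \<open>V j\<close> is the j-th
    block of N rows of \<open>U\<close>.\<close>
  define r where "r = (\<lambda>j. mat 1 q (\<lambda>(i :: nat, b). if b = j then 1 else 0 :: complex))"
  define e where "e = (\<lambda>j. adj (r j) * r j)"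
  define R where "R = (\<lambda>j. kronecker (r j) (1\<^sub>m N))"
  define V where "V = (\<lambda>j. R j * U)"
  have r: "r j \<in> carrier_mat 1 q" for j by (simp add: r_def)
  have e: "e j \<in> carrier_mat q q" for j unfolding e_def by (rule mult_carrier_mat[OF adj_carrier[OF r] r])
  have R: "R j \<in> carrier_mat N (q * N)" for j
    unfolding R_def using kronecker_carrier[OF r one_carrier_mat] by simp
  note aR = adj_carrier[OF R]
  have V: "V j \<in> carrier_mat N K" for j unfolding V_def by (rule mult_carrier_mat[OF R U])
  have RBR: "adj (R j) * B * R j = kronecker (e j) B" if B: "B \<in> carrier_mat N N" for j B
  proof -
    have "adj (R j) * B * R j = kronecker (adj (r j)) (1\<^sub>m N) * kronecker (1\<^sub>m 1) B * kronecker (r j) (1\<^sub>m N)"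
      by (simp only: R_def kronecker_adj kronecker_one_left adj_one)
    also have "\<dots> = kronecker (adj (r j)) B * kronecker (r j) (1\<^sub>m N)"
      by (simp only: kronecker_mult[OF adj_carrier[OF r] one_carrier_mat one_carrier_mat B]
          left_mult_one_mat[OF B] right_mult_one_mat[OF adj_carrier[OF r]])
    also have "\<dots> = kronecker (e j) B"
      by (simp only: kronecker_mult[OF adj_carrier[OF r] B r one_carrier_mat] e_def right_mult_one_mat[OF B])
    finally show ?thesis .
  qed
  have VBV: "adj (V j) * B * V j = adj U * kronecker (e j) B * U" if B: "B \<in> carrier_mat N N" for j B
  proof -
    note RB = mult_carrier_mat[OF aR B]
    have "adj (V j) * B * V j = adj U * adj (R j) * B * (R j * U)"
      by (simp add: V_def adj_mult[OF R U])
    also have "\<dots> = adj U * (adj (R j) * B) * (R j * U)"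
      by (simp only: assoc_mult_mat[OF aU aR B])
    also have "\<dots> = adj U * ((adj (R j) * B) * (R j * U))"
      by (rule assoc_mult_mat[OF aU RB mult_carrier_mat[OF R U]])
    also have "\<dots> = adj U * (adj (R j) * B * R j * U)"
      by (simp only: assoc_mult_mat[OF RB R U])
    also have "\<dots> = adj U * (adj (R j) * B * R j) * U"
      by (rule assoc_mult_mat[OF aU mult_carrier_mat[OF RB R] U, symmetric])
    finally show ?thesis by (simp add: RBR[OF B])
  qed
  \<comment> \<open>Putting \<open>e j\<close> in front raises the weight by at most one, so weight
    below d for the remaining qudits becomes weight below \<open>Suc d\<close>.\<close>
  have KL: "\<exists>c. adj (V j) * tensor_list Es * V j = c \<cdot>\<^sub>m 1\<^sub>m K"
    if Es: "Es \<in> factor_lists q n" "error_weight q Es < d" for Es j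
  proof -
    have "e j # Es \<in> factor_lists q (Suc n)" using Es e by (auto simp: factor_lists_def)
    moreover have "error_weight q (e j # Es) < Suc d" using Es by (simp add: error_weight_def)
    ultimately obtain c where "adj U * tensor_list (e j # Es) * U = c \<cdot>\<^sub>m 1\<^sub>m K"
      using det unfolding detects_def by blast
    then show ?thesis using VBV factor_lists_tensor_carrier[OF Es(1)] by (auto simp: N_def)
  qed
  \<comment> \<open>The identity is an error of weight 0, which lies below d because d \<ge> 1; so
    each \<open>V j\<close> is a scalar multiple of an isometry, possibly zero.\<close>
  have V1: "\<exists>c. adj (V j) * V j = c \<cdot>\<^sub>m 1\<^sub>m K" for j
  proof -
    have s: "scalar_op q (1\<^sub>m q)"
      unfolding scalar_op_def by (rule exI[of _ 1]) (auto intro!: eq_matI)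
    have "replicate n (1\<^sub>m q) \<in> factor_lists q n" "error_weight q (replicate n (1\<^sub>m q)) < d"
      using d s by (auto simp: factor_lists_def error_weight_def)
    then have "\<exists>c. adj (V j) * tensor_list (replicate n (1\<^sub>m q)) * V j = c \<cdot>\<^sub>m 1\<^sub>m K" by (rule KL)
    then show ?thesis
      by (simp add: tensor_list_ones N_def[symmetric] right_mult_one_mat[OF adj_carrier[OF V]])
  qed
  have Vindex: "V j $$ (i, l) = U $$ (j * N + i, l)" if "j < q" "i < N" "l < K" for i j l
  proof -
    have "j * N + i < Suc j * N" using that by simp
    also have "\<dots> \<le> q * N" using that by (intro mult_le_mono1) auto
    finally have lt: "j * N + i < q * N" .
    have "V j $$ (i, l) = (\<Sum>k<q * N. R j $$ (i, k) * U $$ (k, l))"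
      unfolding V_def using that by (intro mult_index[OF R U])
    also have "\<dots> = (\<Sum>k<q * N. if k = j * N + i then U $$ (k, l) else 0)"
    proof (intro sum.cong refl)
      fix k assume "k \<in> {..<q * N}"
      then have k: "k < q * N" by simp
      have "k = j * N + i \<longleftrightarrow> k div N = j \<and> i = k mod N"
      proof
        assume "k = j * N + i"
        then show "k div N = j \<and> i = k mod N" using that by simp
      next
        assume "k div N = j \<and> i = k mod N"
        then show "k = j * N + i" using div_mult_mod_eq[of k N] by simp
      qed
      then show "R j $$ (i, k) * U $$ (k, l) = (if k = j * N + i then U $$ (k, l) else 0)"
        using k that less_mult_div_mod[OF k] unfolding R_def by (auto simp: r_def)
    qed
    also have "\<dots> = U $$ (j * N + i, l)" using lt by simp
    finally show ?thesis .
  qed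
  \<comment> \<open>Column 0 of \<open>U\<close> has norm 1, and its squared norm is the sum of the
    squared norms of its q blocks, so some block does not vanish.\<close>
  have "\<exists>j<q. adj (V j) * V j \<noteq> 0 \<cdot>\<^sub>m 1\<^sub>m K"
  proof (rule ccontr)
    assume "\<not> ?thesis"
    then have z: "(adj (V j) * V j) $$ (0, 0) = 0" if "j < q" for j using that K by auto
    have "(\<Sum>i<N. (cmod (V j $$ (i, 0)))\<^sup>2) = 0" if "j < q" for j
      using z[OF that] gram_diag[OF V, of 0 j] K by (metis of_real_eq_0_iff less_eq_Suc_le One_nat_def)
    then have "(\<Sum>j<q. \<Sum>i<N. (cmod (U $$ (j * N + i, 0)))\<^sup>2) = 0"
      using K by (simp add: Vindex)
    then have "(adj U * U) $$ (0, 0) = 0"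
      using gram_diag[OF U, of 0] K by (simp add: sum_lessThan_mult)
    then show False using isometry_adj_mult[OF iso] K by simp
  qed
  then obtain j c where c: "adj (V j) * V j = c \<cdot>\<^sub>m 1\<^sub>m K" "c \<noteq> 0" using V1 by metis
  define t where "t = (\<Sum>i<N. (cmod (V j $$ (i, 0)))\<^sup>2)"
  have ct: "c = of_real t" using gram_diag[OF V, of 0 j] K c by (simp add: t_def)
  then have "t \<noteq> 0" using c(2) by auto
  moreover have "t \<ge> 0" by (simp add: t_def sum_nonneg)
  ultimately have t: "t > 0" by simp
  define s where "s = complex_of_real (1 / sqrt t)"
  have ss: "cnj s * s * c = 1"
    using t unfolding ct s_def by (simp flip: of_real_mult of_real_divide)
  define U' where "U' = s \<cdot>\<^sub>m V j"
  have U': "U' \<in> carrier_mat N K" using V by (simp add: U'_def)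
  have U'B: "adj U' * B * U' = (cnj s * s) \<cdot>\<^sub>m (adj (V j) * B * V j)" if B: "B \<in> carrier_mat N N" for B
  proof -
    note aV = adj_carrier[OF V]
    note aVB = mult_carrier_mat[OF aV B]
    have "adj U' * B * U' = cnj s \<cdot>\<^sub>m (adj (V j) * B) * (s \<cdot>\<^sub>m V j)"
      by (simp only: U'_def adj_smult mult_smult_assoc_mat[OF aV B])
    also have "\<dots> = cnj s \<cdot>\<^sub>m (adj (V j) * B * (s \<cdot>\<^sub>m V j))"
      by (rule mult_smult_assoc_mat[OF aVB smult_carrier_mat[OF V]])
    also have "\<dots> = cnj s \<cdot>\<^sub>m (s \<cdot>\<^sub>m (adj (V j) * B * V j))"
      by (simp only: mult_smult_distrib[OF aVB V])
    finally show ?thesis by (simp only: smult_smult_mat)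
  qed
  have "adj U' * U' = 1\<^sub>m K"
  proof -
    have "adj U' * U' = (cnj s * s) \<cdot>\<^sub>m (adj (V j) * V j)"
      using U'B[OF one_carrier_mat]
      by (simp only: right_mult_one_mat[OF adj_carrier[OF V]] right_mult_one_mat[OF adj_carrier[OF U']])
    then show ?thesis unfolding c(1) smult_smult_mat ss by (simp only: smult_one_mat)
  qed
  then have "isometry (q ^ n) K U'" using U' by (simp add: isometry_def N_def)
  moreover have "detects q n K U' d"
    unfolding detects_def
  proof (intro ballI impI)
    fix Es assume Es: "Es \<in> factor_lists q n" "error_weight q Es < d"
    from KL[OF this, of j] obtain b where b: "adj (V j) * tensor_list Es * V j = b \<cdot>\<^sub>m 1\<^sub>m K" by blast
    have "adj U' * tensor_list Es * U' = (cnj s * s * b) \<cdot>\<^sub>m 1\<^sub>m K"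
      using U'B[of "tensor_list Es"] factor_lists_tensor_carrier[OF Es(1)]
      by (simp only: N_def[symmetric] b smult_smult_mat)
    then show "\<exists>c. adj U' * tensor_list Es * U' = c \<cdot>\<^sub>m 1\<^sub>m K" by blast
  qed
  ultimately show thesis by (rule that)
qed

text \<open>If the distance D exceeds \<delta>(n + 1) + 1, then D - 1 is still above \<delta>(n + 1)
  \<ge> \<delta> n, so the lower bound survives a puncture. The process stops before length 0, where
  the one-dimensional space cannot contain a code with K \<ge> 2.\<close>

lemma puncture_to_distance:
  fixes \<delta> :: real
  assumes "isometry (q ^ n) K U" "K \<ge> 2" "0 \<le> \<delta>"
    and "\<delta> * n \<le> min_distance q n (mrange U)"
  shows "\<exists>n' U'. n' \<le> n \<and> isometry (q ^ n') K U' \<and> \<delta> * n' \<le> min_distance q n' (mrange U') \<and>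
    min_distance q n' (mrange U') \<le> \<delta> * n' + 1"
  using assms
proof (induction n arbitrary: U)
  case 0
  then show ?case using isometry_dim_le[OF 0(1)] by simp
next
  case (Suc n)
  define D where "D = min_distance q (Suc n) (mrange U)"
  show ?case
  proof (cases "real D \<le> \<delta> * Suc n + 1")
    case True
    then show ?thesis using Suc.prems unfolding D_def by blast
  next
    case False
    have "0 \<le> \<delta> * Suc n" using Suc.prems by simp
    then have "D > 1" using False by simp
    then obtain d where d: "D = Suc d" "d \<ge> 1" by (cases D) auto
    have "detects q (Suc n) K U (Suc d)"
      using min_distance_detects[of q "Suc n" "mrange U"] detects_below_iff[OF Suc.prems(1,2)] d D_def by simp
    then obtain U' where U': "isometry (q ^ n) K U'" "detects q n K U' d"
      using puncture[OF Suc.prems(1)] d Suc.prems(2) by (metis one_le_numeral order_trans)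
    have "d \<le> n + 1" using min_distance_le[of q "Suc n" "mrange U"] d D_def by simp
    then have "d \<le> min_distance q n (mrange U')"
      using U' detects_below_iff[OF U'(1) Suc.prems(2)] by (intro min_distance_ge) auto
    moreover have "\<delta> * n \<le> d"
      using False d Suc.prems(3) by (simp add: algebra_simps)
    ultimately have "\<delta> * n \<le> min_distance q n (mrange U')" by linarith
    from Suc.IH[OF U'(1) Suc.prems(2,3) this] show ?thesis using le_Suc_eq by blast
  qed
qed

section \<open>Spectral projections of a unitary of finite order\<close>

text \<open>The size N is an explicit argument, so that the empty sum is the zero matrix of the
  right shape.\<close>

definition msum :: "nat \<Rightarrow> nat \<Rightarrow> (nat \<Rightarrow> complex mat) \<Rightarrow> complex mat" where
  "msum N k f = mat N N (\<lambda>(i, j). \<Sum>l<k. f l $$ (i, j))"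

lemma msum_carrier [simp]: "msum N k f \<in> carrier_mat N N"
  by (simp add: msum_def)

lemma msum_index: "i < N \<Longrightarrow> j < N \<Longrightarrow> msum N k f $$ (i, j) = (\<Sum>l<k. f l $$ (i, j))"
  by (simp add: msum_def)

lemma msum_dim [simp]: "dim_row (msum N k f) = N" "dim_col (msum N k f) = N"
  by (simp_all add: msum_def)

lemma mult_msum:
  assumes A: "A \<in> carrier_mat N N" and f: "\<And>l. f l \<in> carrier_mat N N"
  shows "A * msum N k f = msum N k (\<lambda>l. A * f l)"
proof (rule eq_matI)
  fix i j assume "i < dim_row (msum N k (\<lambda>l. A * f l))" "j < dim_col (msum N k (\<lambda>l. A * f l))"
  then have ij: "i < N" "j < N" by auto
  have "(A * msum N k f) $$ (i, j) = (\<Sum>m<N. A $$ (i, m) * (\<Sum>l<k. f l $$ (m, j)))"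
    using ij by (subst mult_index[OF A msum_carrier]) (auto simp: msum_index)
  also have "\<dots> = (\<Sum>l<k. \<Sum>m<N. A $$ (i, m) * f l $$ (m, j))"
    by (subst sum.swap) (simp add: sum_distrib_left)
  also have "\<dots> = msum N k (\<lambda>l. A * f l) $$ (i, j)"
    using ij by (simp add: msum_index mult_index[OF A f] del: index_mult_mat)
  finally show "(A * msum N k f) $$ (i, j) = msum N k (\<lambda>l. A * f l) $$ (i, j)" .
qed (use A in auto)

lemma msum_mult:
  assumes A: "A \<in> carrier_mat N N" and f: "\<And>l. f l \<in> carrier_mat N N"
  shows "msum N k f * A = msum N k (\<lambda>l. f l * A)"
proof (rule eq_matI)
  fix i j assume "i < dim_row (msum N k (\<lambda>l. f l * A))" "j < dim_col (msum N k (\<lambda>l. f l * A))"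
  then have ij: "i < N" "j < N" by auto
  have "(msum N k f * A) $$ (i, j) = (\<Sum>m<N. (\<Sum>l<k. f l $$ (i, m)) * A $$ (m, j))"
    using ij by (subst mult_index[OF msum_carrier A]) (auto simp: msum_index)
  also have "\<dots> = (\<Sum>l<k. \<Sum>m<N. f l $$ (i, m) * A $$ (m, j))"
    by (subst sum.swap) (simp add: sum_distrib_right)
  also have "\<dots> = msum N k (\<lambda>l. f l * A) $$ (i, j)"
    using ij by (simp add: msum_index mult_index[OF f A] del: index_mult_mat)
  finally show "(msum N k f * A) $$ (i, j) = msum N k (\<lambda>l. f l * A) $$ (i, j)" .
qed (use A in auto)

lemma msum_const: "A \<in> carrier_mat N N \<Longrightarrow> msum N k (\<lambda>_. A) = of_nat k \<cdot>\<^sub>m A"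
  by (rule eq_matI) (auto simp: msum_index)

lemma adj_msum:
  assumes "\<And>l. f l \<in> carrier_mat N N"
  shows "adj (msum N k f) = msum N k (\<lambda>l. adj (f l))"
  by (rule eq_matI) (auto simp: msum_index carrier_matD[OF assms])

lemma mat_trace_msum:
  assumes "\<And>l. f l \<in> carrier_mat N N"
  shows "mat_trace (msum N k f) = (\<Sum>l<k. mat_trace (f l))"
proof -
  have "mat_trace (msum N k f) = (\<Sum>i<N. \<Sum>l<k. f l $$ (i, i))"
    by (simp add: mat_trace_def msum_index)
  also have "\<dots> = (\<Sum>l<k. mat_trace (f l))"
    by (subst sum.swap) (simp add: mat_trace_def carrier_matD[OF assms])
  finally show ?thesis .
qed

lemma mat_trace_smult: "A \<in> carrier_mat N N \<Longrightarrow> mat_trace (c \<cdot>\<^sub>m A) = c * mat_trace A"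
  by (auto simp: mat_trace_def sum_distrib_left)

lemma root_of_unity_sum:
  fixes w :: complex
  assumes "w ^ p = 1" "w \<noteq> 1"
  shows "(\<Sum>k<p. w ^ k) = 0"
  using assms geometric_sum[of w p] by simp

definition unity_root :: "nat \<Rightarrow> complex" where
  "unity_root p = cis (2 * pi / p)"

lemma unity_root_pow: "p > 0 \<Longrightarrow> unity_root p ^ p = 1"
  by (simp add: unity_root_def DeMoivre)

lemma norm_unity_root [simp]: "cmod (unity_root p) = 1"
  by (simp add: unity_root_def)

lemma unity_root_nonzero [simp]: "unity_root p \<noteq> 0"
  by (simp add: unity_root_def)

lemma unity_root_pow_inj:
  assumes "i < p" "j < p" "unity_root p ^ i = unity_root p ^ j"
  shows "i = j"
proof -
  have "cis (2 * pi * real i / real p) = cis (2 * pi * real j / real p)"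
    using assms(3) by (simp add: unity_root_def DeMoivre mult_ac)
  then show ?thesis
    using bij_betw_roots_unity[of p] assms(1,2) unfolding bij_betw_def inj_on_def by fastforce
qed

text \<open>The average over the powers of U. When U has order dividing p, this is the projection
  onto the fixed space of U; the other eigenspaces are reached by multiplying U by p-th roots of
  unity.\<close>

definition cyclic_projection :: "nat \<Rightarrow> nat \<Rightarrow> complex mat \<Rightarrow> complex mat" where
  "cyclic_projection N p U = (1 / of_nat p) \<cdot>\<^sub>m msum N p (\<lambda>j. U ^\<^sub>m j)"

context
  fixes N p :: nat and U :: "complex mat"
  assumes U: "U \<in> carrier_mat N N" and p: "p > 0" and Up: "U ^\<^sub>m p = 1\<^sub>m N"
begin

lemma cyclic_projection_carrier: "cyclic_projection N p U \<in> carrier_mat N N"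
  by (simp add: cyclic_projection_def)

lemma pow_carrier: "U ^\<^sub>m j \<in> carrier_mat N N"
  using U by (rule pow_carrier_mat)

lemma pow_Suc_left: "U ^\<^sub>m (Suc j) = U * U ^\<^sub>m j"
proof (induction j)
  case 0
  then show ?case using U by simp
next
  case (Suc j)
  have "U ^\<^sub>m Suc (Suc j) = U ^\<^sub>m Suc j * U" by simp
  also have "\<dots> = U * U ^\<^sub>m j * U" using Suc by simp
  also have "\<dots> = U * (U ^\<^sub>m j * U)" by (rule assoc_mult_mat[OF U pow_carrier U])
  finally show ?case by simp
qed

text \<open>Multiplication by U shifts the powers cyclically, since the power p equals the power
  0.\<close>

lemma mult_cyclic_projection: "U * cyclic_projection N p U = cyclic_projection N p U"
proof -
  have "U * msum N p (\<lambda>j. U ^\<^sub>m j) = msum N p (\<lambda>j. U ^\<^sub>m Suc j)"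
    by (simp only: mult_msum[OF U pow_carrier] pow_Suc_left)
  also have "\<dots> = msum N p (\<lambda>j. U ^\<^sub>m j)"
  proof (rule eq_matI)
    fix i j assume "i < dim_row (msum N p (\<lambda>j. U ^\<^sub>m j))" "j < dim_col (msum N p (\<lambda>j. U ^\<^sub>m j))"
    then have ij: "i < N" "j < N" by auto
    have "(\<Sum>l<Suc p. (U ^\<^sub>m l) $$ (i, j)) = (U ^\<^sub>m 0) $$ (i, j) + (\<Sum>l<p. (U ^\<^sub>m Suc l) $$ (i, j))"
      by (rule sum.lessThan_Suc_shift)
    moreover have "(\<Sum>l<Suc p. (U ^\<^sub>m l) $$ (i, j)) = (\<Sum>l<p. (U ^\<^sub>m l) $$ (i, j)) + (U ^\<^sub>m p) $$ (i, j)"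
      by simp
    moreover have "U ^\<^sub>m 0 = U ^\<^sub>m p" using U Up by simp
    ultimately show "msum N p (\<lambda>j. U ^\<^sub>m Suc j) $$ (i, j) = msum N p (\<lambda>j. U ^\<^sub>m j) $$ (i, j)"
      unfolding msum_index[OF ij] by (simp del: pow_mat.simps)
  qed auto
  finally show ?thesis
    unfolding cyclic_projection_def by (simp only: mult_smult_distrib[OF U msum_carrier])
qed

lemma average_const: "A \<in> carrier_mat N N \<Longrightarrow> (1 / of_nat p) \<cdot>\<^sub>m msum N p (\<lambda>_. A) = A"
  using p by (simp add: msum_const smult_smult_mat smult_one_mat)

lemma cyclic_projection_idem:
  "cyclic_projection N p U * cyclic_projection N p U = cyclic_projection N p U" (is "?Q * ?Q = ?Q")
proof -
  note Q = cyclic_projection_carrier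
  have pow: "U ^\<^sub>m j * ?Q = ?Q" for j
  proof (induction j)
    case 0
    then show ?case using U Q by (simp add: left_mult_one_mat[OF Q])
  next
    case (Suc j)
    have "U ^\<^sub>m Suc j * ?Q = U ^\<^sub>m j * (U * ?Q)"
      by (simp add: assoc_mult_mat[OF pow_carrier U Q])
    then show ?case using Suc mult_cyclic_projection by simp
  qed
  have "?Q * ?Q = (1 / of_nat p) \<cdot>\<^sub>m (msum N p (\<lambda>j. U ^\<^sub>m j) * ?Q)"
    by (subst cyclic_projection_def) (rule mult_smult_assoc_mat[OF msum_carrier Q])
  also have "\<dots> = ?Q"
    by (simp only: msum_mult[OF Q pow_carrier] pow average_const[OF Q])
  finally show ?thesis .
qed

text \<open>Unitarity turns U Q = Q into \<open>adj U * Q = Q\<close>; averaging over powers gives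
  \<open>adj Q * Q = Q\<close>, whose left side is visibly self-adjoint.\<close>

lemma cyclic_projection_herm:
  assumes unitary: "adj U * U = 1\<^sub>m N"
  shows "adj (cyclic_projection N p U) = cyclic_projection N p U" (is "adj ?Q = ?Q")
proof -
  note Q = cyclic_projection_carrier
  have aU: "adj U * ?Q = ?Q"
  proof -
    have "adj U * ?Q = adj U * (U * ?Q)" by (simp only: mult_cyclic_projection)
    also have "\<dots> = ?Q"
      by (simp only: assoc_mult_mat[OF adj_carrier[OF U] U Q, symmetric] unitary left_mult_one_mat[OF Q])
    finally show ?thesis .
  qed
  have pow: "adj (U ^\<^sub>m j) * ?Q = ?Q" for j
  proof (induction j)
    case 0
    then show ?case using U by (simp add: left_mult_one_mat[OF Q])
  next
    case (Suc j)
    have "adj (U ^\<^sub>m Suc j) * ?Q = adj U * (adj (U ^\<^sub>m j) * ?Q)"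
      by (simp add: adj_mult[OF pow_carrier U] assoc_mult_mat[OF adj_carrier[OF U] adj_carrier[OF pow_carrier] Q])
    then show ?case using Suc aU by simp
  qed
  have "adj ?Q = (1 / of_nat p) \<cdot>\<^sub>m msum N p (\<lambda>j. adj (U ^\<^sub>m j))"
    by (simp add: cyclic_projection_def adj_smult adj_msum[OF pow_carrier])
  then have "adj ?Q * ?Q = (1 / of_nat p) \<cdot>\<^sub>m (msum N p (\<lambda>j. adj (U ^\<^sub>m j)) * ?Q)"
    by (simp only: mult_smult_assoc_mat[OF msum_carrier Q])
  also have "\<dots> = ?Q"
    by (simp only: msum_mult[OF Q adj_carrier[OF pow_carrier]] pow average_const[OF Q])
  finally have eq: "adj ?Q * ?Q = ?Q" .
  have "adj (adj ?Q * ?Q) = adj ?Q * ?Q"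
    by (simp only: adj_mult[OF adj_carrier[OF Q] Q] adj_adj)
  then show ?thesis unfolding eq .
qed

lemma cyclic_projection_comm:
  assumes A: "A \<in> carrier_mat N N" and comm: "A * U = U * A"
  shows "A * cyclic_projection N p U = cyclic_projection N p U * A"
proof -
  have pow: "A * U ^\<^sub>m j = U ^\<^sub>m j * A" for j
  proof (induction j)
    case 0
    then show ?case using U A by simp
  next
    case (Suc j)
    have "A * U ^\<^sub>m Suc j = A * U ^\<^sub>m j * U"
      using assoc_mult_mat[OF A pow_carrier U] by simp
    also have "\<dots> = U ^\<^sub>m j * (A * U)" using Suc assoc_mult_mat[OF pow_carrier A U] by simp
    also have "\<dots> = U ^\<^sub>m Suc j * A" using comm assoc_mult_mat[OF pow_carrier U A] by simp
    finally show ?case .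
  qed
  show ?thesis
    unfolding cyclic_projection_def
    by (simp only: mult_smult_distrib[OF A msum_carrier] mult_smult_assoc_mat[OF msum_carrier A]
        mult_msum[OF A pow_carrier] msum_mult[OF A pow_carrier] pow)
qed

end

lemma pow_mat_smult:
  fixes A :: "complex mat"
  assumes A: "A \<in> carrier_mat N N"
  shows "(c \<cdot>\<^sub>m A) ^\<^sub>m k = (c ^ k) \<cdot>\<^sub>m (A ^\<^sub>m k)"
proof (induction k)
  case 0
  then show ?case using A by (simp add: smult_one_mat)
next
  case (Suc k)
  note Ak = pow_carrier_mat[OF A, of k]
  show ?case
    by (simp add: Suc mult_smult_assoc_mat[OF Ak smult_carrier_mat[OF A]] mult_smult_distrib[OF Ak A]
        smult_smult_mat mult.commute)
qed

text \<open>The projections onto the eigenspaces of \<open>A\<close> sum to the identity, so one of them captures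
  at least the average share of the trace.\<close>

lemma exists_cyclic_projection_trace:
  assumes A: "A \<in> carrier_mat N N" and P: "P \<in> carrier_mat N N" and p: "p > 0"
    and Ap: "A ^\<^sub>m p = c \<cdot>\<^sub>m 1\<^sub>m N" and c: "cmod c = 1"
  obtains z where "cmod z = 1" "(z \<cdot>\<^sub>m A) ^\<^sub>m p = 1\<^sub>m N"
    "Re (mat_trace (P * cyclic_projection N p (z \<cdot>\<^sub>m A))) \<ge> Re (mat_trace P) / p"
proof -
  \<comment> \<open>Only a scalar of modulus 1 separates the p-th power of A from the identity; a
    p-th root of its inverse rescales A to order p.\<close>
  obtain z0 where z0: "z0 ^ p = inverse c"
  proof -
    have "rcis (root p (cmod (inverse c))) (Arg (inverse c) / p) ^ p = inverse c"
      using p by (simp add: DeMoivre2 rcis_cmod_Arg)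
    then show thesis by (rule that)
  qed
  have z0n: "cmod z0 = 1"
  proof -
    have "cmod z0 ^ p = 1" using z0 c by (metis norm_power norm_inverse inverse_1)
    then show ?thesis using p by (metis norm_ge_zero power_eq_1_iff zero_less_iff_neq_zero abs_of_nonneg real_norm_def)
  qed
  define \<zeta> where "\<zeta> = unity_root p"
  have zp: "\<zeta> ^ p = 1" using p by (simp add: \<zeta>_def unity_root_pow)
  have zj: "\<zeta> ^ j \<noteq> 1" if j: "0 < j" "j < p" for j
    using unity_root_pow_inj[of j p 0] j by (auto simp: \<zeta>_def)
  \<comment> \<open>The \<open>z k\<close> are the p different p-th roots of the inverse of c, so
    \<open>Q k\<close> runs through the projections onto all eigenspaces of A.\<close>
  define z where "z = (\<lambda>k. z0 * \<zeta> ^ k)"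
  define Q where "Q = (\<lambda>k. cyclic_projection N p (z k \<cdot>\<^sub>m A))"
  have zn: "cmod (z k) = 1" for k by (simp add: z_def norm_mult norm_power z0n \<zeta>_def)
  have c0: "c \<noteq> 0" using c by auto
  have zkp: "z k ^ p * c = 1" for k
  proof -
    have "z k ^ p = z0 ^ p * (\<zeta> ^ p) ^ k"
      by (simp add: z_def power_mult_distrib flip: power_mult) (simp add: mult.commute)
    then show ?thesis using z0 zp c0 by simp
  qed
  have zA: "(z k \<cdot>\<^sub>m A) ^\<^sub>m p = 1\<^sub>m N" for k
    by (simp add: pow_mat_smult[OF A] Ap smult_smult_mat zkp smult_one_mat)
  have tr: "mat_trace (P * Q k) = (1 / of_nat p) * (\<Sum>j<p. z k ^ j * mat_trace (P * A ^\<^sub>m j))" for k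
  proof -
    note zAc = pow_carrier_mat[OF smult_carrier_mat[OF A, of "z k"]] and Aj = pow_carrier_mat[OF A]
    have "P * Q k = (1 / of_nat p) \<cdot>\<^sub>m msum N p (\<lambda>j. P * ((z k \<cdot>\<^sub>m A) ^\<^sub>m j))"
      by (simp only: Q_def cyclic_projection_def mult_smult_distrib[OF P msum_carrier] mult_msum[OF P zAc])
    then have "mat_trace (P * Q k) = (1 / of_nat p) * (\<Sum>j<p. mat_trace (P * ((z k \<cdot>\<^sub>m A) ^\<^sub>m j)))"
      by (simp only: mat_trace_smult[OF msum_carrier] mat_trace_msum[OF mult_carrier_mat[OF P zAc]])
    then show ?thesis
      by (simp only: pow_mat_smult[OF A] mult_smult_distrib[OF P Aj] mat_trace_smult[OF mult_carrier_mat[OF P Aj]])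
  qed
  \<comment> \<open>Summing over k, orthogonality of the roots of unity cancels every power of A
    except the zeroth.\<close>
  have "(\<Sum>k<p. mat_trace (P * Q k)) = mat_trace P"
  proof -
    have "(\<Sum>k<p. mat_trace (P * Q k)) =
        (1 / of_nat p) * (\<Sum>k<p. \<Sum>j<p. z0 ^ j * mat_trace (P * A ^\<^sub>m j) * (\<zeta> ^ j) ^ k)"
      by (simp only: tr sum_distrib_left[symmetric])
        (simp add: z_def power_mult_distrib mult_ac flip: power_mult)
    also have "\<dots> = (1 / of_nat p) * (\<Sum>j<p. z0 ^ j * mat_trace (P * A ^\<^sub>m j) * (\<Sum>k<p. (\<zeta> ^ j) ^ k))"
      by (subst sum.swap) (simp add: sum_distrib_left)
    also have "(\<Sum>j<p. z0 ^ j * mat_trace (P * A ^\<^sub>m j) * (\<Sum>k<p. (\<zeta> ^ j) ^ k)) =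
        (\<Sum>j<p. if j = 0 then mat_trace P * of_nat p else 0)"
    proof (intro sum.cong refl)
      fix j assume j: "j \<in> {..<p}"
      show "z0 ^ j * mat_trace (P * A ^\<^sub>m j) * (\<Sum>k<p. (\<zeta> ^ j) ^ k) =
          (if j = 0 then mat_trace P * of_nat p else 0)"
      proof (cases "j = 0")
        case True
        then show ?thesis using A P by simp
      next
        case False
        have "(\<zeta> ^ j) ^ p = 1" using zp by (metis power_commutes power_mult power_one mult.commute)
        then show ?thesis using root_of_unity_sum[of "\<zeta> ^ j" p] zj[of j] j False by simp
      qed
    qed
    finally show ?thesis using p by simp
  qed
  then have sum: "(\<Sum>k<p. Re (mat_trace (P * Q k))) = Re (mat_trace P)"
    by (metis Re_sum)
  have "\<exists>k<p. Re (mat_trace (P * Q k)) \<ge> Re (mat_trace P) / p"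
  proof (rule ccontr)
    assume "\<not> ?thesis"
    then have "(\<Sum>k<p. Re (mat_trace (P * Q k))) < (\<Sum>k<p. Re (mat_trace P) / p)"
      using p by (intro sum_strict_mono) (auto simp: not_le)
    then show False using sum p by simp
  qed
  then show thesis using that zn zA Q_def by blast
qed

section \<open>Weyl systems and stabilizer projections\<close>

text \<open>Closure is demanded for N by N matrices only, and L may contain others. Preimages such
  as \<open>{A. kronecker A B \<in> L}\<close> then qualify as they stand.\<close>

definition lin_closed :: "nat \<Rightarrow> complex mat set \<Rightarrow> bool" where
  "lin_closed N L \<longleftrightarrow> 0\<^sub>m N N \<in> L \<and>
     (\<forall>A\<in>carrier_mat N N. \<forall>B\<in>carrier_mat N N. A \<in> L \<longrightarrow> B \<in> L \<longrightarrow> A + B \<in> L) \<and>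
     (\<forall>c. \<forall>A\<in>carrier_mat N N. A \<in> L \<longrightarrow> c \<cdot>\<^sub>m A \<in> L)"

text \<open>A projective unitary representation W of a finite abelian group, with commutator pairing
  \<chi>. The interface is stable under direct powers, which is used twice: m-fold to build one
  qudit of dimension q = p^m, and n-fold to build n qudits. \<open>W_span\<close> says that the
  operators span, phrased so that it serves as an induction principle for linear conditions.\<close>

locale weyl_system = comm_group G for G (structure) +
  fixes N p :: nat and W :: "'a \<Rightarrow> complex mat" and \<chi> :: "'a \<Rightarrow> 'a \<Rightarrow> complex"
  assumes prime_p: "prime p" and finite_G: "finite (carrier G)" and N_pos: "N > 0"
    and W_carrier: "g \<in> carrier G \<Longrightarrow> W g \<in> carrier_mat N N"
    and W_one: "W \<one> = 1\<^sub>m N"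
    and W_mult: "g \<in> carrier G \<Longrightarrow> h \<in> carrier G \<Longrightarrow>
      \<exists>c. cmod c = 1 \<and> W g * W h = c \<cdot>\<^sub>m W (g \<otimes> h)"
    and W_comm: "g \<in> carrier G \<Longrightarrow> h \<in> carrier G \<Longrightarrow> W g * W h = \<chi> g h \<cdot>\<^sub>m (W h * W g)"
    and W_unitary: "g \<in> carrier G \<Longrightarrow> adj (W g) * W g = 1\<^sub>m N"
    and \<chi>_mult: "g \<in> carrier G \<Longrightarrow> h \<in> carrier G \<Longrightarrow> k \<in> carrier G \<Longrightarrow> \<chi> (g \<otimes> h) k = \<chi> g k * \<chi> h k"
    and \<chi>_swap: "g \<in> carrier G \<Longrightarrow> h \<in> carrier G \<Longrightarrow> \<chi> g h * \<chi> h g = 1"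
    and \<chi>_self: "g \<in> carrier G \<Longrightarrow> \<chi> g g = 1"
    and \<chi>_pow: "g \<in> carrier G \<Longrightarrow> h \<in> carrier G \<Longrightarrow> \<chi> g h ^ p = 1"
    and \<chi>_nondeg: "g \<in> carrier G \<Longrightarrow> g \<noteq> \<one> \<Longrightarrow> \<exists>h\<in>carrier G. \<chi> g h \<noteq> 1"
    and W_span: "lin_closed N L \<Longrightarrow> (\<And>g. g \<in> carrier G \<Longrightarrow> W g \<in> L) \<Longrightarrow> carrier_mat N N \<subseteq> L"
begin

lemma p_pos: "p > 0"
  using prime_p by (simp add: prime_gt_0_nat)

lemma \<chi>_swap': "g \<in> carrier G \<Longrightarrow> h \<in> carrier G \<Longrightarrow> \<chi> h g = inverse (\<chi> g h)"
  using \<chi>_swap by (metis inverse_unique)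

lemma \<chi>_mult_right:
  "g \<in> carrier G \<Longrightarrow> h \<in> carrier G \<Longrightarrow> k \<in> carrier G \<Longrightarrow> \<chi> k (g \<otimes> h) = \<chi> k g * \<chi> k h"
  using \<chi>_mult[of g h k] by (simp add: \<chi>_swap'[of _ k])

lemma \<chi>_nonzero: "g \<in> carrier G \<Longrightarrow> h \<in> carrier G \<Longrightarrow> \<chi> g h \<noteq> 0"
  using \<chi>_swap[of g h] by auto

lemma \<chi>_one_left: "g \<in> carrier G \<Longrightarrow> \<chi> \<one> g = 1"
  using \<chi>_mult[of \<one> \<one> g] \<chi>_nonzero[of \<one> g] by simp

lemma \<chi>_one_right: "g \<in> carrier G \<Longrightarrow> \<chi> g \<one> = 1"
  by (simp add: \<chi>_swap'[of \<one> g] \<chi>_one_left)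

lemma \<chi>_inv_left: "g \<in> carrier G \<Longrightarrow> h \<in> carrier G \<Longrightarrow> \<chi> (inv g) h = inverse (\<chi> g h)"
  using \<chi>_mult[of g "inv g" h] \<chi>_one_left[of h] by (simp add: inverse_unique)

lemma \<chi>_nat_pow: "g \<in> carrier G \<Longrightarrow> h \<in> carrier G \<Longrightarrow> \<chi> (g [^] (k :: nat)) h = \<chi> g h ^ k"
  by (induction k) (simp_all add: \<chi>_one_left \<chi>_mult)

text \<open>The p-th power of g pairs trivially with everything, so nondegeneracy makes it the
  identity: exponent p comes from the pairing.\<close>

lemma pow_p: "g \<in> carrier G \<Longrightarrow> g [^] p = \<one>"
  using \<chi>_nondeg[of "g [^] p"] by (auto simp: \<chi>_nat_pow \<chi>_pow)

lemma W_pow: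
  assumes g: "g \<in> carrier G"
  shows "\<exists>c. cmod c = 1 \<and> W g ^\<^sub>m k = c \<cdot>\<^sub>m W (g [^] k)"
proof (induction k)
  case 0
  then show ?case using W_carrier[OF g] by (auto simp: W_one smult_one_mat intro!: exI[of _ 1])
next
  case (Suc k)
  then obtain c where c: "cmod c = 1" "W g ^\<^sub>m k = c \<cdot>\<^sub>m W (g [^] k)" by blast
  obtain d where d: "cmod d = 1" "W (g [^] k) * W g = d \<cdot>\<^sub>m W (g [^] k \<otimes> g)"
    using W_mult[of "g [^] k" g] g by auto
  have "W g ^\<^sub>m Suc k = (c * d) \<cdot>\<^sub>m W (g [^] Suc k)"
    using mult_smult_assoc_mat[OF W_carrier[of "g [^] k"] W_carrier[OF g]] g
    by (simp add: c d smult_smult_mat)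
  then show ?case using c d by (intro exI[of _ "c * d"]) (simp add: norm_mult)
qed

lemma W_pow_p: "g \<in> carrier G \<Longrightarrow> \<exists>c. cmod c = 1 \<and> W g ^\<^sub>m p = c \<cdot>\<^sub>m 1\<^sub>m N"
  using W_pow[of g p] by (simp add: pow_p W_one)

section \<open>Duality of subgroups under the commutator pairing\<close>

definition perp :: "'a set \<Rightarrow> 'a set" where
  "perp S = {g \<in> carrier G. \<forall>s\<in>S. \<chi> g s = 1}"

lemma perp_subset: "perp S \<subseteq> carrier G"
  by (auto simp: perp_def)

lemma perp_antimono: "S \<subseteq> T \<Longrightarrow> perp T \<subseteq> perp S"
  by (auto simp: perp_def)

lemma perp_subgroup:
  assumes "S \<subseteq> carrier G"
  shows "subgroup (perp S) G"
  using assms by (intro subgroupI) (auto simp: perp_def subset_iff \<chi>_mult \<chi>_inv_left \<chi>_one_left)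

text \<open>Translation by t permutes H and multiplies the sum by \<psi> t, which differs from
  1.\<close>

lemma character_sum_eq_0:
  fixes \<psi> :: "'a \<Rightarrow> complex"
  assumes H: "subgroup H G" and mult: "\<And>g h. g \<in> H \<Longrightarrow> h \<in> H \<Longrightarrow> \<psi> (g \<otimes> h) = \<psi> g * \<psi> h"
    and t: "t \<in> H" "\<psi> t \<noteq> 1"
  shows "(\<Sum>h\<in>H. \<psi> h) = 0"
proof -
  interpret H: subgroup H G by (rule H)
  have "bij_betw (\<lambda>h. t \<otimes> h) H H"
  proof (rule bij_betw_byWitness[where f' = "\<lambda>h. inv t \<otimes> h"])
    show "\<forall>h\<in>H. inv t \<otimes> (t \<otimes> h) = h" "\<forall>h\<in>H. t \<otimes> (inv t \<otimes> h) = h"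
      using t by (auto simp: m_assoc[symmetric])
  qed (use t in auto)
  then have "(\<Sum>h\<in>H. \<psi> (t \<otimes> h)) = (\<Sum>h\<in>H. \<psi> h)"
    by (rule sum.reindex_bij_betw)
  then have "\<psi> t * (\<Sum>h\<in>H. \<psi> h) = (\<Sum>h\<in>H. \<psi> h)"
    using mult t by (simp add: sum_distrib_left)
  then show ?thesis using t by (simp add: mult_cancel_right1)
qed

lemma finite_subgroup: "subgroup H G \<Longrightarrow> finite H"
  using finite_G by (meson finite_subset subgroup.subset)

text \<open>Double counting of the sum of \<chi> g s over all g and all s in S. Summing over s first
  leaves |S| for each g in \<open>perp S\<close>; summing over g first leaves |G| at s = 1 alone, by
  nondegeneracy.\<close>

lemma card_perp:
  assumes S: "subgroup S G"
  shows "card S * card (perp S) = card (carrier G)"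
proof -
  have Sc: "S \<subseteq> carrier G" using S by (rule subgroup.subset)
  have inner: "(\<Sum>s\<in>S. \<chi> g s) = (if g \<in> perp S then of_nat (card S) else 0)" if g: "g \<in> carrier G" for g
  proof (cases "g \<in> perp S")
    case True
    then show ?thesis by (simp add: perp_def)
  next
    case False
    then obtain t where "t \<in> S" "\<chi> g t \<noteq> 1" using g by (auto simp: perp_def)
    then have "(\<Sum>s\<in>S. \<chi> g s) = 0"
      using Sc g by (intro character_sum_eq_0[OF S]) (auto intro!: \<chi>_mult_right)
    then show ?thesis using False by simp
  qed
  have outer: "(\<Sum>g\<in>carrier G. \<chi> g s) = (if s = \<one> then of_nat (card (carrier G)) else 0)"
    if s: "s \<in> S" for s
  proof (cases "s = \<one>")
    case True
    then show ?thesis by (simp add: \<chi>_one_right)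
  next
    case False
    have sc: "s \<in> carrier G" using s Sc by auto
    then obtain t where "t \<in> carrier G" "\<chi> t s \<noteq> 1"
      using \<chi>_nondeg[OF _ False] \<chi>_swap by (metis mult.right_neutral)
    then have "(\<Sum>g\<in>carrier G. \<chi> g s) = 0"
      using sc by (intro character_sum_eq_0[OF subgroup_self]) (auto intro!: \<chi>_mult)
    then show ?thesis using False by simp
  qed
  have "of_nat (card S * card (perp S)) = (\<Sum>g\<in>carrier G. \<Sum>s\<in>S. \<chi> g s)"
    using perp_subset[of S] finite_G
    by (simp add: inner sum.If_cases Int_absorb1 mult.commute)
  also have "\<dots> = (\<Sum>s\<in>S. \<Sum>g\<in>carrier G. \<chi> g s)" by (rule sum.swap)
  also have "\<dots> = of_nat (card (carrier G))"
    using subgroup.one_closed[OF S] finite_subgroup[OF S] by (simp add: outer)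
  finally show ?thesis by (metis of_nat_eq_iff)
qed

text \<open>The inclusion of S in its double complement is immediate, and two applications of the
  cardinality formula show that both sets have the same size.\<close>

lemma perp_perp:
  assumes S: "subgroup S G"
  shows "perp (perp S) = S"
proof -
  have Sc: "S \<subseteq> carrier G" using S by (rule subgroup.subset)
  note P = perp_subgroup[OF Sc]
  note PP = perp_subgroup[OF perp_subset[of S]]
  have "card (perp S) * card S = card (perp S) * card (perp (perp S))"
    using card_perp[OF S] card_perp[OF P] by (simp add: mult.commute)
  moreover have "card (perp S) > 0"
    using finite_subgroup[OF P] subgroup.one_closed[OF P] by (auto simp: card_gt_0_iff)
  ultimately have "card S = card (perp (perp S))" by simp
  moreover have "S \<subseteq> perp (perp S)"
  proof
    fix s assume s: "s \<in> S"
    have "\<chi> s g = 1" if "g \<in> perp S" for g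
      using that s Sc \<chi>_swap[of s g] by (auto simp: perp_def)
    then show "s \<in> perp (perp S)" using s Sc by (auto simp: perp_def)
  qed
  ultimately show ?thesis using finite_subgroup[OF PP] by (metis card_subset_eq)
qed

text \<open>The sum of \<psi> h ^ j over j < p is p on the kernel and 0 elsewhere. Interchanging the
  sums leaves only j = 0, because all powers with 0 < j < p are nontrivial characters.\<close>

lemma card_kernel:
  fixes \<psi> :: "'a \<Rightarrow> complex"
  assumes H: "subgroup H G" and mult: "\<And>g h. g \<in> H \<Longrightarrow> h \<in> H \<Longrightarrow> \<psi> (g \<otimes> h) = \<psi> g * \<psi> h"
    and pow: "\<And>h. h \<in> H \<Longrightarrow> \<psi> h ^ p = 1"
    and t: "t \<in> H" "\<psi> t \<noteq> 1"
  shows "p * card {h \<in> H. \<psi> h = 1} = card H"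
proof -
  \<comment> \<open>Here p has to be prime: with x an inverse of j modulo p, \<psi> t ^ j = 1 would
    give \<psi> t = \<psi> t ^ (j x) = 1.\<close>
  have nt: "\<psi> t ^ j \<noteq> 1" if j: "0 < j" "j < p" for j
  proof
    assume a: "\<psi> t ^ j = 1"
    have "coprime j p"
      using prime_p j by (metis coprime_commute nat_dvd_not_less prime_imp_coprime)
    then obtain x where "[j * x = 1] (mod p)" using cong_solve_coprime_nat by auto
    then obtain y where "j * x = 1 + p * y"
    proof -
      assume c: "[j * x = 1] (mod p)"
      have "p > 1" using prime_p by (rule prime_gt_1_nat)
      then have "j * x mod p = 1" using c by (simp add: cong_def)
      then have "j * x = 1 + p * (j * x div p)" by (metis mod_mult_div_eq)
      then show thesis by (rule that)
    qed
    then have "\<psi> t ^ (j * x) = \<psi> t" using pow[OF t(1)] by (simp add: power_add power_mult)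
    moreover have "\<psi> t ^ (j * x) = 1" using a by (simp add: power_mult)
    ultimately show False using t by simp
  qed
  have fin: "finite H" by (rule finite_subgroup[OF H])
  have "(\<Sum>j<p. \<Sum>h\<in>H. \<psi> h ^ j) = (\<Sum>j<p. if j = 0 then of_nat (card H) else 0)"
  proof (intro sum.cong refl)
    fix j assume j: "j \<in> {..<p}"
    show "(\<Sum>h\<in>H. \<psi> h ^ j) = (if j = 0 then of_nat (card H) else 0)"
    proof (cases "j = 0")
      case False
      then have "(\<Sum>h\<in>H. \<psi> h ^ j) = 0"
        using j nt t by (intro character_sum_eq_0[OF H, of _ t]) (auto simp: mult power_mult_distrib)
      then show ?thesis using False by simp
    qed simp
  qed
  also have "\<dots> = of_nat (card H)" using p_pos by simp
  finally have "of_nat (card H) = (\<Sum>h\<in>H. \<Sum>j<p. \<psi> h ^ j)" by (simp add: sum.swap[of _ H])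
  also have "\<dots> = (\<Sum>h\<in>H. if \<psi> h = 1 then of_nat p else 0)"
    using pow root_of_unity_sum by (intro sum.cong refl) auto
  also have "\<dots> = of_nat (p * card {h \<in> H. \<psi> h = 1})"
    using fin by (simp add: sum.If_cases Int_def mult.commute)
  finally show ?thesis by (metis of_nat_eq_iff)
qed

section \<open>Stabilizers of projections and their refinement\<close>

definition stab :: "complex mat \<Rightarrow> 'a set" where
  "stab P = {g \<in> carrier G. \<exists>c. c \<noteq> 0 \<and> W g * P = c \<cdot>\<^sub>m P}"

text \<open>The commutation clause takes the place of an explicit formula for P as an average over
  its stabilizer. It is inherited under refinement, since a larger stabilizer has a smaller
  complement. The positive trace keeps P nonzero.\<close>

definition stabilizer_projection :: "complex mat \<Rightarrow> bool" where
  "stabilizer_projection P \<longleftrightarrow> P \<in> carrier_mat N N \<and> P * P = P \<and> adj P = P \<and>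
     Re (mat_trace P) > 0 \<and> (\<forall>g\<in>perp (stab P). W g * P = P * W g)"

lemma stab_subset: "stab P \<subseteq> carrier G"
  by (auto simp: stab_def)

lemma stab_subgroup:
  assumes P: "P \<in> carrier_mat N N"
  shows "subgroup (stab P) G"
proof (rule subgroupI)
  show "stab P \<subseteq> carrier G" by (rule stab_subset)
  show "stab P \<noteq> {}"
    using P by (auto simp: stab_def W_one smult_one_mat intro!: exI[of _ \<one>] exI[of _ 1])
next
  fix g assume "g \<in> stab P"
  then obtain c where g: "g \<in> carrier G" and c: "c \<noteq> 0" "W g * P = c \<cdot>\<^sub>m P" by (auto simp: stab_def)
  note Wg = W_carrier[OF g] and Wi = W_carrier[OF inv_closed[OF g]]
  obtain d where d: "cmod d = 1" "W (inv g) * W g = d \<cdot>\<^sub>m W (inv g \<otimes> g)"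
    using W_mult[OF inv_closed[OF g] g] by blast
  have "c \<cdot>\<^sub>m (W (inv g) * P) = W (inv g) * (W g * P)"
    by (simp only: c mult_smult_distrib[OF Wi P])
  also have "\<dots> = d \<cdot>\<^sub>m P"
    using P by (simp only: assoc_mult_mat[OF Wi Wg P, symmetric] d)
      (simp add: g W_one mult_smult_assoc_mat[OF one_carrier_mat P])
  finally have "inverse c \<cdot>\<^sub>m (c \<cdot>\<^sub>m (W (inv g) * P)) = inverse c \<cdot>\<^sub>m (d \<cdot>\<^sub>m P)" by simp
  then have "W (inv g) * P = (inverse c * d) \<cdot>\<^sub>m P"
    using c by (simp add: smult_smult_mat smult_one_mat)
  moreover have "inverse c * d \<noteq> 0" using c d by auto
  ultimately show "inv g \<in> stab P"
    unfolding stab_def using g by blast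
next
  fix g h assume "g \<in> stab P" "h \<in> stab P"
  then obtain c d where g: "g \<in> carrier G" and c: "c \<noteq> 0" "W g * P = c \<cdot>\<^sub>m P"
    and h: "h \<in> carrier G" and d: "d \<noteq> 0" "W h * P = d \<cdot>\<^sub>m P" by (auto simp: stab_def)
  note Wg = W_carrier[OF g] and Wh = W_carrier[OF h] and Wgh = W_carrier[OF m_closed[OF g h]]
  obtain b where b: "cmod b = 1" "W g * W h = b \<cdot>\<^sub>m W (g \<otimes> h)"
    using W_mult[OF g h] by blast
  have "b \<cdot>\<^sub>m (W (g \<otimes> h) * P) = W g * (W h * P)"
    by (simp only: assoc_mult_mat[OF Wg Wh P, symmetric] b mult_smult_assoc_mat[OF Wgh P])
  also have "\<dots> = (d * c) \<cdot>\<^sub>m P"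
    by (simp only: d mult_smult_distrib[OF Wg P] c smult_smult_mat)
  finally have "inverse b \<cdot>\<^sub>m (b \<cdot>\<^sub>m (W (g \<otimes> h) * P)) = inverse b \<cdot>\<^sub>m ((d * c) \<cdot>\<^sub>m P)" by simp
  moreover have b0: "b \<noteq> 0" using b by auto
  ultimately have "W (g \<otimes> h) * P = (inverse b * (d * c)) \<cdot>\<^sub>m P"
    by (simp add: smult_smult_mat smult_one_mat)
  moreover have "inverse b * (d * c) \<noteq> 0" using b0 c d by auto
  ultimately show "g \<otimes> h \<in> stab P"
    unfolding stab_def using m_closed[OF g h] by blast
qed

lemma nonzero_smult_cancel:
  fixes P :: "complex mat"
  assumes "P \<in> carrier_mat N N" "mat_trace P \<noteq> 0" "a \<cdot>\<^sub>m P = b \<cdot>\<^sub>m P"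
  shows "a = b"
  using arg_cong[OF assms(3), of mat_trace] assms(1,2) by (simp add: mat_trace_smult)

text \<open>On the nonzero range of P both operators act as nonzero scalars, hence commute there,
  which leaves 1 as the only possible commutation factor.\<close>

lemma stab_isotropic:
  assumes P: "P \<in> carrier_mat N N" "mat_trace P \<noteq> 0"
  shows "stab P \<subseteq> perp (stab P)"
proof
  fix g assume g: "g \<in> stab P"
  have "\<chi> g h = 1" if h: "h \<in> stab P" for h
  proof -
    obtain c d where gc: "g \<in> carrier G" and c: "c \<noteq> 0" "W g * P = c \<cdot>\<^sub>m P"
      and hc: "h \<in> carrier G" and d: "d \<noteq> 0" "W h * P = d \<cdot>\<^sub>m P" using g h by (auto simp: stab_def)
    note Wg = W_carrier[OF gc] and Wh = W_carrier[OF hc]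
    have "(d * c) \<cdot>\<^sub>m P = W g * (W h * P)"
      by (simp only: d mult_smult_distrib[OF Wg P(1)] c smult_smult_mat)
    also have "\<dots> = \<chi> g h \<cdot>\<^sub>m (W h * (W g * P))"
      by (simp only: assoc_mult_mat[OF Wg Wh P(1), symmetric] W_comm[OF gc hc]
          mult_smult_assoc_mat[OF mult_carrier_mat[OF Wh Wg] P(1)] assoc_mult_mat[OF Wh Wg P(1)])
    also have "\<dots> = (\<chi> g h * (c * d)) \<cdot>\<^sub>m P"
      by (simp only: c mult_smult_distrib[OF Wh P(1)] d smult_smult_mat)
    finally have "d * c = \<chi> g h * (c * d)" by (rule nonzero_smult_cancel[OF P])
    then show ?thesis using c d by simp
  qed
  then show "g \<in> perp (stab P)" using g stab_subset by (auto simp: perp_def)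
qed

lemma stabilizer_projection_one: "stabilizer_projection (1\<^sub>m N)"
  unfolding stabilizer_projection_def
proof (intro conjI ballI)
  fix g assume "g \<in> perp (stab (1\<^sub>m N))"
  then have "W g \<in> carrier_mat N N" using perp_subset W_carrier by blast
  then show "W g * 1\<^sub>m N = 1\<^sub>m N * W g" by simp
qed (use N_pos in \<open>auto simp: mat_trace_one\<close>)

text \<open>The new projection is P Q, where Q projects onto an eigenspace of \<open>W s\<close>. As
  s lies in the complement of the stabilizer, \<open>W s\<close> and therefore Q commute with P, so
  the product is again a projection.\<close>

lemma stabilizer_projection_extend:
  assumes sP: "stabilizer_projection P" and s: "s \<in> perp (stab P)"
  obtains P' where "stabilizer_projection P'" "Re (mat_trace P') \<ge> Re (mat_trace P) / p"
    "stab P \<subseteq> stab P'" "s \<in> stab P'"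
proof -
  have P: "P \<in> carrier_mat N N" and idem: "P * P = P" and herm: "adj P = P"
    and tr: "Re (mat_trace P) > 0" and comm: "\<And>g. g \<in> perp (stab P) \<Longrightarrow> W g * P = P * W g"
    using sP by (auto simp: stabilizer_projection_def)
  have sc: "s \<in> carrier G" using s perp_subset by auto
  note Ws = W_carrier[OF sc]
  obtain c where c: "cmod c = 1" "W s ^\<^sub>m p = c \<cdot>\<^sub>m 1\<^sub>m N" using W_pow_p[OF sc] by blast
  obtain z where z: "cmod z = 1" "(z \<cdot>\<^sub>m W s) ^\<^sub>m p = 1\<^sub>m N"
    "Re (mat_trace (P * cyclic_projection N p (z \<cdot>\<^sub>m W s))) \<ge> Re (mat_trace P) / p"
    by (rule exists_cyclic_projection_trace[OF Ws P p_pos c(2,1)])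
  define U where "U = z \<cdot>\<^sub>m W s"
  define Q where "Q = cyclic_projection N p U"
  have U: "U \<in> carrier_mat N N" using Ws by (simp add: U_def)
  have Up: "U ^\<^sub>m p = 1\<^sub>m N" using z by (simp add: U_def)
  have z0: "z \<noteq> 0" using z by auto
  have zz: "cnj z * z = 1" using z(1) by (metis complex_norm_square mult.commute of_real_1 power_one)
  have Uun: "adj U * U = 1\<^sub>m N"
    by (simp add: U_def adj_smult mult_smult_assoc_mat[OF adj_carrier[OF Ws] smult_carrier_mat[OF Ws]]
       mult_smult_distrib[OF adj_carrier[OF Ws] Ws] W_unitary[OF sc] smult_smult_mat zz smult_one_mat)
  have Q: "Q \<in> carrier_mat N N"
    unfolding Q_def by (rule cyclic_projection_carrier[OF U p_pos Up])
  have QQ: "Q * Q = Q" unfolding Q_def by (rule cyclic_projection_idem[OF U p_pos Up])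
  have aQ: "adj Q = Q" unfolding Q_def by (rule cyclic_projection_herm[OF U p_pos Up Uun])
  have UQ: "U * Q = Q" unfolding Q_def by (rule mult_cyclic_projection[OF U p_pos Up])
  have commQ: "A * Q = Q * A" if "A \<in> carrier_mat N N" "A * W s = W s * A" for A
    unfolding Q_def
    by (rule cyclic_projection_comm[OF U p_pos Up that(1)])
      (simp only: U_def mult_smult_distrib[OF that(1) Ws] mult_smult_assoc_mat[OF Ws that(1)] that(2))
  have PQ: "P * Q = Q * P" by (rule commQ[OF P]) (simp add: comm[OF s])
  have WsQ: "W s * Q = inverse z \<cdot>\<^sub>m Q"
  proof -
    have "inverse z \<cdot>\<^sub>m (z \<cdot>\<^sub>m (W s * Q)) = inverse z \<cdot>\<^sub>m Q"
      using UQ by (simp add: U_def mult_smult_assoc_mat[OF Ws Q])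
    then show ?thesis using z0 by (simp add: smult_smult_mat smult_one_mat)
  qed
  define P' where "P' = P * Q"
  have P': "P' \<in> carrier_mat N N" unfolding P'_def by (rule mult_carrier_mat[OF P Q])
  have stab1: "stab P \<subseteq> stab P'"
  proof
    fix t assume "t \<in> stab P"
    then obtain a where t: "t \<in> carrier G" and a: "a \<noteq> 0" "W t * P = a \<cdot>\<^sub>m P" by (auto simp: stab_def)
    have "W t * P' = a \<cdot>\<^sub>m P'"
      by (simp only: P'_def assoc_mult_mat[OF W_carrier[OF t] P Q, symmetric] a mult_smult_assoc_mat[OF P Q])
    then show "t \<in> stab P'" using t a by (auto simp: stab_def)
  qed
  have "W s * P' = inverse z \<cdot>\<^sub>m P'"
    by (simp only: P'_def assoc_mult_mat[OF Ws P Q, symmetric] comm[OF s] assoc_mult_mat[OF P Ws Q] WsQ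
      mult_smult_distrib[OF P Q])
  moreover have "inverse z \<noteq> 0" using z0 by simp
  ultimately have stab2: "s \<in> stab P'" unfolding stab_def using sc by blast
  have "stabilizer_projection P'"
    unfolding stabilizer_projection_def
  proof (intro conjI ballI P')
    have "P' * P' = P * Q * P * Q"
      unfolding P'_def by (rule assoc_mult_mat[OF mult_carrier_mat[OF P Q] P Q, symmetric])
    also have "\<dots> = P * (Q * P) * Q" by (simp only: assoc_mult_mat[OF P Q P])
    also have "\<dots> = P * P * Q * Q"
      by (simp only: PQ[symmetric] assoc_mult_mat[OF P P Q])
    also have "\<dots> = P'"
      by (simp only: idem assoc_mult_mat[OF P Q Q] QQ P'_def)
    finally show "P' * P' = P'" .
    show "adj P' = P'" using adj_mult[OF P Q] by (simp only: P'_def herm aQ PQ)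
    show "Re (mat_trace P') > 0"
    proof -
      have "0 < Re (mat_trace P) / p" using tr p_pos by simp
      also have "\<dots> \<le> Re (mat_trace P')" using z(3) by (simp add: P'_def Q_def U_def)
      finally show ?thesis .
    qed
    \<comment> \<open>Commutation with P holds because g lies in the complement of the smaller
      stabilizer too, and commutation with Q because s now belongs to the stabilizer.\<close>
    fix g assume g: "g \<in> perp (stab P')"
    have gc: "g \<in> carrier G" using g perp_subset by auto
    note Wg = W_carrier[OF gc]
    have gP: "W g * P = P * W g" using g perp_antimono[OF stab1] comm by auto
    have "\<chi> g s = 1" using g stab2 by (auto simp: perp_def)
    then have gQ: "W g * Q = Q * W g"
      using W_comm[OF gc sc] by (intro commQ[OF Wg]) (simp add: smult_one_mat)
    show "W g * P' = P' * W g"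
      by (simp only: P'_def assoc_mult_mat[OF Wg P Q, symmetric] gP assoc_mult_mat[OF P Wg Q] gQ
        assoc_mult_mat[OF P Q Wg])
  qed
  moreover have "Re (mat_trace P') \<ge> Re (mat_trace P) / p" using z(3) by (simp add: P'_def Q_def U_def)
  ultimately show thesis using stab1 stab2 by (rule that)
qed

definition undetected :: "'a set \<Rightarrow> complex mat \<Rightarrow> 'a set" where
  "undetected L P = L \<inter> (perp (stab P) - stab P)"

text \<open>A label is harmless for one of two reasons: its operator is a scalar on the range of P,
  or it fails to commute with some stabilizing operator, and then P W(e) P vanishes.\<close>

lemma undetected_empty_imp:
  assumes sP: "stabilizer_projection P" and L: "L \<subseteq> carrier G" and empty: "undetected L P = {}"
    and e: "e \<in> L"
  shows "\<exists>c. P * W e * P = c \<cdot>\<^sub>m P"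
proof -
  have P: "P \<in> carrier_mat N N" and idem: "P * P = P" 
    and tr: "Re (mat_trace P) > 0" and comm: "\<And>g. g \<in> perp (stab P) \<Longrightarrow> W g * P = P * W g"
    using sP by (auto simp: stabilizer_projection_def)
  have ec: "e \<in> carrier G" using e L by auto
  note We = W_carrier[OF ec]
  show ?thesis
  proof (cases "e \<in> stab P")
    case True
    then obtain c where c: "W e * P = c \<cdot>\<^sub>m P" by (auto simp: stab_def)
    have "P * W e * P = c \<cdot>\<^sub>m P"
      by (simp only: assoc_mult_mat[OF P We P] c mult_smult_distrib[OF P P] idem)
    then show ?thesis by blast
  next
    case False
    then have "e \<notin> perp (stab P)" using empty e by (auto simp: undetected_def)
    then obtain s where s: "s \<in> stab P" "\<chi> e s \<noteq> 1" using ec by (auto simp: perp_def)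
    then obtain c where sc: "s \<in> carrier G" and c: "c \<noteq> 0" "W s * P = c \<cdot>\<^sub>m P" by (auto simp: stab_def)
    note Ws = W_carrier[OF sc]
    have "mat_trace P \<noteq> 0" using tr by auto
    then have PWs: "P * W s = c \<cdot>\<^sub>m P"
      using comm[of s] s stab_isotropic[OF P] c by auto
    note PWe = mult_carrier_mat[OF P We]
    \<comment> \<open>Moving \<open>W s\<close> through from right to left reproduces the same
      expression with the extra factor \<chi> e s, which is not 1.\<close>
    have "c \<cdot>\<^sub>m (P * W e * P) = P * (W e * W s) * P"
      by (simp only: mult_smult_distrib[OF PWe P, symmetric] c(2)[symmetric]
          assoc_mult_mat[OF PWe Ws P, symmetric] assoc_mult_mat[OF P We Ws])
    also have "\<dots> = \<chi> e s \<cdot>\<^sub>m (P * (W s * W e) * P)"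
      by (simp only: W_comm[OF ec sc] mult_smult_distrib[OF P mult_carrier_mat[OF Ws We]]
          mult_smult_assoc_mat[OF mult_carrier_mat[OF P mult_carrier_mat[OF Ws We]] P])
    also have "P * (W s * W e) * P = c \<cdot>\<^sub>m (P * W e * P)"
      by (simp only: assoc_mult_mat[OF P Ws We, symmetric] PWs mult_smult_assoc_mat[OF P We]
          mult_smult_assoc_mat[OF PWe P])
    finally have eq: "c \<cdot>\<^sub>m (P * W e * P) = (\<chi> e s * c) \<cdot>\<^sub>m (P * W e * P)"
      by (simp only: smult_smult_mat)
    have M: "P * W e * P \<in> carrier_mat N N" by (rule mult_carrier_mat[OF PWe P])
    have "P * W e * P = 0 \<cdot>\<^sub>m P"
    proof (rule eq_matI)
      fix i j assume "i < dim_row (0 \<cdot>\<^sub>m P)" "j < dim_col (0 \<cdot>\<^sub>m P)"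
      then have ij: "i < N" "j < N" using P by auto
      have "c * (P * W e * P) $$ (i, j) = \<chi> e s * c * (P * W e * P) $$ (i, j)"
        using arg_cong[OF eq, of "\<lambda>A. A $$ (i, j)"] M ij by (metis carrier_matD index_smult_mat(1))
      then have "(P * W e * P) $$ (i, j) = 0" using c(1) s(2) by auto
      then show "(P * W e * P) $$ (i, j) = (0 \<cdot>\<^sub>m P) $$ (i, j)" using P ij by simp
    qed (use P M in auto)
    then show ?thesis by blast
  qed
qed

lemma exists_halving_element:
  assumes sP: "stabilizer_projection P" and L: "L \<subseteq> carrier G"
  obtains s where "s \<in> perp (stab P)" "p * card {e \<in> undetected L P. \<chi> e s = 1} \<le> card (undetected L P)"
proof -
  have P: "P \<in> carrier_mat N N" using sP by (auto simp: stabilizer_projection_def)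
  define S where "S = stab P"
  define H where "H = perp S"
  define B where "B = undetected L P"
  have S: "subgroup S G" unfolding S_def by (rule stab_subgroup[OF P])
  have H: "subgroup H G" unfolding H_def S_def by (rule perp_subgroup[OF stab_subset])
  have Hc: "H \<subseteq> carrier G" using H by (rule subgroup.subset)
  have finH: "finite H" by (rule finite_subgroup[OF H])
  have finB: "finite B" unfolding B_def undetected_def using L finite_G by (auto intro: finite_subset)
  have cH: "card H > 0" using finH subgroup.one_closed[OF H] by (auto simp: card_gt_0_iff)
  have ker: "p * card {s \<in> H. \<chi> e s = 1} = card H" if e: "e \<in> B" for e
  proof -
    have ec: "e \<in> carrier G" and "e \<notin> S" using e L by (auto simp: B_def undetected_def S_def)
    then have "e \<notin> perp H" using perp_perp[OF S] by (simp add: H_def)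
    then obtain t where "t \<in> H" "\<chi> e t \<noteq> 1" using ec by (auto simp: perp_def)
    then show ?thesis
      using Hc ec by (intro card_kernel[OF H, of "\<chi> e" t]) (auto intro!: \<chi>_mult_right \<chi>_pow)
  qed
  \<comment> \<open>The pairs (s, e) with \<chi> e s = 1 are counted in both orders. If every s were
    bad, their number would exceed the value that the kernels prescribe.\<close>
  have "\<exists>s\<in>H. p * card {e \<in> B. \<chi> e s = 1} \<le> card B"
  proof (rule ccontr)
    assume "\<not> ?thesis"
    then have "(\<Sum>s\<in>H. card B) < (\<Sum>s\<in>H. p * card {e \<in> B. \<chi> e s = 1})"
      using finH cH by (intro sum_strict_mono) (auto simp: not_le)
    also have "\<dots> = p * (\<Sum>s\<in>H. \<Sum>e\<in>B. if \<chi> e s = 1 then 1 else 0)"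
      using finB by (simp add: sum_distrib_left sum.If_cases Int_def)
    also have "\<dots> = (\<Sum>e\<in>B. p * card {s \<in> H. \<chi> e s = 1})"
      using finH by (subst sum.swap) (simp add: sum_distrib_left sum.If_cases Int_def)
    also have "\<dots> = (\<Sum>e\<in>B. card H)" by (intro sum.cong refl ker)
    finally show False by (simp add: mult.commute)
  qed
  then show thesis using that by (auto simp: B_def H_def S_def)
qed

lemma exists_detecting_projection:
  assumes L: "L \<subseteq> carrier G" and r: "p ^ r > card L"
  obtains P where "P \<in> carrier_mat N N" "P * P = P" "adj P = P" "Re (mat_trace P) \<ge> N / p ^ r"
    "\<And>e. e \<in> L \<Longrightarrow> \<exists>c. P * W e * P = c \<cdot>\<^sub>m P"
proof -
  have finL: "finite L" using L finite_G by (rule finite_subset)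
  have "\<exists>P. stabilizer_projection P \<and> Re (mat_trace P) \<ge> N / p ^ k \<and>
      p ^ k * card (undetected L P) \<le> card L" for k
  proof (induction k)
    case 0
    have "card (undetected L (1\<^sub>m N)) \<le> card L"
      using finL by (intro card_mono) (auto simp: undetected_def)
    then show ?case using stabilizer_projection_one by (auto simp: mat_trace_one intro!: exI[of _ "1\<^sub>m N"])
  next
    case (Suc k)
    then obtain P where P: "stabilizer_projection P" "Re (mat_trace P) \<ge> N / p ^ k"
      "p ^ k * card (undetected L P) \<le> card L" by blast
    obtain s where s: "s \<in> perp (stab P)"
      "p * card {e \<in> undetected L P. \<chi> e s = 1} \<le> card (undetected L P)"
      by (rule exists_halving_element[OF P(1) L])
    obtain P' where P': "stabilizer_projection P'" "Re (mat_trace P') \<ge> Re (mat_trace P) / p"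
      "stab P \<subseteq> stab P'" "s \<in> stab P'"
      by (rule stabilizer_projection_extend[OF P(1) s(1)])
    \<comment> \<open>A label undetected by P' must commute with s, now in the stabilizer, and it
      was already undetected by P, because the stabilizer has grown and its complement has
      shrunk.\<close>
    have sub: "undetected L P' \<subseteq> {e \<in> undetected L P. \<chi> e s = 1}"
      using P'(3,4) perp_antimono[OF P'(3)] by (auto simp: undetected_def perp_def)
    have "finite (undetected L P)" using finL by (simp add: undetected_def)
    then have "card (undetected L P') \<le> card {e \<in> undetected L P. \<chi> e s = 1}"
      by (intro card_mono sub) auto
    then have "p * card (undetected L P') \<le> card (undetected L P)"
      using s(2) by (meson mult_le_mono2 order_trans)
    then have "p ^ k * (p * card (undetected L P')) \<le> card L"
      using P(3) by (meson mult_le_mono2 order_trans)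
    then have "p ^ Suc k * card (undetected L P') \<le> card L"
      by (simp only: power_Suc mult.assoc mult.left_commute)
    moreover have "N / p ^ Suc k \<le> Re (mat_trace P')"
    proof -
      have "N / p ^ Suc k = N / p ^ k / p" by simp
      also have "\<dots> \<le> Re (mat_trace P) / p" using P(2) by (intro divide_right_mono) auto
      finally show ?thesis using P'(2) by simp
    qed
    ultimately show ?case using P'(1) by blast
  qed
  then obtain P where P: "stabilizer_projection P" "Re (mat_trace P) \<ge> N / p ^ r"
      "p ^ r * card (undetected L P) \<le> card L" by blast
  \<comment> \<open>After r rounds p^r times this number is at most |L| < p^r.\<close>
  have "card (undetected L P) = 0"
  proof (rule ccontr)
    assume "card (undetected L P) \<noteq> 0"
    then have "p ^ r \<le> p ^ r * card (undetected L P)" by simp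
    then show False using P(3) r by linarith
  qed
  then have empty: "undetected L P = {}" using finL by (simp add: undetected_def)
  show thesis
    by (rule that[of P]) (use P undetected_empty_imp[OF P(1) L empty] in \<open>auto simp: stabilizer_projection_def\<close>)
qed

end

section \<open>Tensor powers of the shift and clock operators\<close>

lemma lin_closed_zero: "lin_closed N L \<Longrightarrow> 0\<^sub>m N N \<in> L"
  and lin_closed_add: "lin_closed N L \<Longrightarrow> A \<in> carrier_mat N N \<Longrightarrow> B \<in> carrier_mat N N \<Longrightarrow>
    A \<in> L \<Longrightarrow> B \<in> L \<Longrightarrow> A + B \<in> L"
  and lin_closed_smult: "lin_closed N L \<Longrightarrow> A \<in> carrier_mat N N \<Longrightarrow> A \<in> L \<Longrightarrow> c \<cdot>\<^sub>m A \<in> L"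
  by (auto simp: lin_closed_def)

lemma lin_closed_msum:
  assumes L: "lin_closed N L" and f: "\<And>l. l < k \<Longrightarrow> f l \<in> carrier_mat N N" "\<And>l. l < k \<Longrightarrow> f l \<in> L"
  shows "msum N k f \<in> L"
  using f
proof (induction k)
  case 0
  have "msum N 0 f = 0\<^sub>m N N" by (rule eq_matI) (auto simp: msum_index)
  then show ?case using lin_closed_zero[OF L] by simp
next
  case (Suc k)
  have "msum N (Suc k) f = msum N k f + f k"
    using Suc.prems(1)[of k] by (intro eq_matI) (auto simp: msum_index)
  then show ?case using Suc by (auto intro!: lin_closed_add[OF L])
qed

definition mat_unit :: "nat \<Rightarrow> nat \<Rightarrow> nat \<Rightarrow> complex mat" where
  "mat_unit N i j = mat N N (\<lambda>(k, l). if k = i \<and> l = j then 1 else 0)"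

lemma mat_unit_carrier [simp]: "mat_unit N i j \<in> carrier_mat N N"
  by (simp add: mat_unit_def)

text \<open>Reduces spanning statements to matrix units, which factor through Kronecker products
  while a general matrix does not.\<close>

lemma lin_closed_mat_units:
  assumes L: "lin_closed N L" and units: "\<And>i j. i < N \<Longrightarrow> j < N \<Longrightarrow> mat_unit N i j \<in> L"
  shows "carrier_mat N N \<subseteq> L"
proof
  fix A :: "complex mat" assume A: "A \<in> carrier_mat N N"
  have "A = msum N N (\<lambda>i. msum N N (\<lambda>j. A $$ (i, j) \<cdot>\<^sub>m mat_unit N i j))"
  proof (rule eq_matI)
    fix k l assume "k < dim_row (msum N N (\<lambda>i. msum N N (\<lambda>j. A $$ (i, j) \<cdot>\<^sub>m mat_unit N i j)))"
      "l < dim_col (msum N N (\<lambda>i. msum N N (\<lambda>j. A $$ (i, j) \<cdot>\<^sub>m mat_unit N i j)))"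
    then have kl: "k < N" "l < N" by auto
    have "(\<Sum>i<N. \<Sum>j<N. A $$ (i, j) * (if k = i \<and> l = j then 1 else 0)) =
        (\<Sum>i<N. \<Sum>j<N. if j = l then if i = k then A $$ (k, l) else 0 else 0)"
      by (intro sum.cong refl) auto
    also have "\<dots> = A $$ (k, l)" using kl by simp
    finally show "A $$ (k, l) = msum N N (\<lambda>i. msum N N (\<lambda>j. A $$ (i, j) \<cdot>\<^sub>m mat_unit N i j)) $$ (k, l)"
      using kl by (simp add: msum_index mat_unit_def)
  qed (use A in auto)
  moreover have "msum N N (\<lambda>i. msum N N (\<lambda>j. A $$ (i, j) \<cdot>\<^sub>m mat_unit N i j)) \<in> L"
    using units by (intro lin_closed_msum[OF L] lin_closed_smult[OF L]) auto
  ultimately show "A \<in> L" by simp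
qed

lemma mat_unit_kronecker:
  assumes "i < a * b" "j < a * b"
  shows "mat_unit (a * b) i j = kronecker (mat_unit a (i div b) (j div b)) (mat_unit b (i mod b) (j mod b))"
proof (rule eq_matI)
  fix k l assume "k < dim_row (kronecker (mat_unit a (i div b) (j div b)) (mat_unit b (i mod b) (j mod b)))"
    "l < dim_col (kronecker (mat_unit a (i div b) (j div b)) (mat_unit b (i mod b) (j mod b)))"
  then have kl: "k < a * b" "l < a * b" by (auto simp: mat_unit_def)
  have "k = i \<longleftrightarrow> k div b = i div b \<and> k mod b = i mod b" "l = j \<longleftrightarrow> l div b = j div b \<and> l mod b = j mod b"
    by (metis div_mult_mod_eq)+
  then show "mat_unit (a * b) i j $$ (k, l) =
      kronecker (mat_unit a (i div b) (j div b)) (mat_unit b (i mod b) (j mod b)) $$ (k, l)"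
    using kl less_mult_div_mod[OF kl(1)] less_mult_div_mod[OF kl(2)] by (auto simp: mat_unit_def)
qed (auto simp: mat_unit_def)

lemma lin_closed_kronecker_left:
  assumes L: "lin_closed (a * b) L" and B: "B \<in> carrier_mat b b"
  shows "lin_closed a {A. kronecker A B \<in> L}"
proof -
  have "kronecker (0\<^sub>m a a) B = 0\<^sub>m (a * b) (a * b)"
    using B by (intro eq_matI) (auto simp: less_mult_div_mod)
  then show ?thesis
    using L B unfolding lin_closed_def by (auto simp: kronecker_add1 kronecker_smult1)
qed

lemma lin_closed_kronecker_right:
  assumes L: "lin_closed (a * b) L" and A: "A \<in> carrier_mat a a"
  shows "lin_closed b {B. kronecker A B \<in> L}"
proof -
  have "kronecker A (0\<^sub>m b b) = 0\<^sub>m (a * b) (a * b)"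
    using A by (intro eq_matI) (auto simp: less_mult_div_mod)
  then show ?thesis
    using L A unfolding lin_closed_def by (auto simp: kronecker_add2 kronecker_smult2)
qed

section \<open>Direct powers of a Weyl system\<close>

definition list_group :: "nat \<Rightarrow> ('a, 'b) monoid_scheme \<Rightarrow> 'a list monoid" where
  "list_group n G = \<lparr>carrier = {xs. length xs = n \<and> set xs \<subseteq> carrier G},
     mult = map2 (mult G), one = replicate n (one G)\<rparr>"

lemma list_group_simps [simp]:
  "carrier (list_group n G) = {xs. length xs = n \<and> set xs \<subseteq> carrier G}"
  "mult (list_group n G) = map2 (mult G)" "one (list_group n G) = replicate n (one G)"
  by (simp_all add: list_group_def)

lemma list_group_comm_group:
  assumes "comm_group G"
  shows "comm_group (list_group n G)"
proof -
  interpret comm_group G by fact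
  show ?thesis
  proof (rule comm_groupI)
    fix xs ys assume "xs \<in> carrier (list_group n G)" "ys \<in> carrier (list_group n G)"
    then have len: "length xs = n" "length ys = n" and c: "\<And>i. i < n \<Longrightarrow> xs ! i \<in> carrier G" "\<And>i. i < n \<Longrightarrow> ys ! i \<in> carrier G"
      by (auto simp: subset_iff)
    show "xs \<otimes>\<^bsub>list_group n G\<^esub> ys \<in> carrier (list_group n G)"
      using len c by (auto simp: set_zip)
    show "xs \<otimes>\<^bsub>list_group n G\<^esub> ys = ys \<otimes>\<^bsub>list_group n G\<^esub> xs"
      using len c by (auto intro!: nth_equalityI simp: m_comm)
    fix zs assume "zs \<in> carrier (list_group n G)"
    then have "length zs = n" "\<And>i. i < n \<Longrightarrow> zs ! i \<in> carrier G" by (auto simp: subset_iff)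
    then show "xs \<otimes>\<^bsub>list_group n G\<^esub> ys \<otimes>\<^bsub>list_group n G\<^esub> zs = xs \<otimes>\<^bsub>list_group n G\<^esub> (ys \<otimes>\<^bsub>list_group n G\<^esub> zs)"
      using len c by (auto intro!: nth_equalityI simp: m_assoc)
  next
    show "\<one>\<^bsub>list_group n G\<^esub> \<in> carrier (list_group n G)" by auto
  next
    fix xs assume "xs \<in> carrier (list_group n G)"
    then have len: "length xs = n" and c: "\<And>i. i < n \<Longrightarrow> xs ! i \<in> carrier G" by (auto simp: subset_iff)
    show "\<one>\<^bsub>list_group n G\<^esub> \<otimes>\<^bsub>list_group n G\<^esub> xs = xs"
      using len c by (auto intro!: nth_equalityI)
    show "\<exists>ys\<in>carrier (list_group n G). ys \<otimes>\<^bsub>list_group n G\<^esub> xs = \<one>\<^bsub>list_group n G\<^esub>"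
    proof
      show "map (m_inv G) xs \<in> carrier (list_group n G)"
        using len c by (auto simp: in_set_conv_nth)
      show "map (m_inv G) xs \<otimes>\<^bsub>list_group n G\<^esub> xs = \<one>\<^bsub>list_group n G\<^esub>"
        using len c by (auto intro!: nth_equalityI)
    qed
  qed
qed

fun list_char :: "('a \<Rightarrow> 'a \<Rightarrow> complex) \<Rightarrow> 'a list \<Rightarrow> 'a list \<Rightarrow> complex" where
  "list_char \<chi> (x # xs) (y # ys) = \<chi> x y * list_char \<chi> xs ys"
| "list_char \<chi> _ _ = 1"

definition list_op :: "('a \<Rightarrow> complex mat) \<Rightarrow> 'a list \<Rightarrow> complex mat" where
  "list_op W xs = tensor_list (map W xs)"

lemma list_op_simps [simp]:
  "list_op W [] = 1\<^sub>m 1" "list_op W (x # xs) = kronecker (W x) (list_op W xs)"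
  by (simp_all add: list_op_def)

context weyl_system
begin

lemma list_op_carrier:
  "set xs \<subseteq> carrier G \<Longrightarrow> list_op W xs \<in> carrier_mat (N ^ length xs) (N ^ length xs)"
  unfolding list_op_def using tensor_list_carrier[of "map W xs" N] W_carrier by auto

lemma list_op_mult:
  assumes "length xs = length ys" "set xs \<subseteq> carrier G" "set ys \<subseteq> carrier G"
  shows "\<exists>c. cmod c = 1 \<and> list_op W xs * list_op W ys = c \<cdot>\<^sub>m list_op W (map2 (\<otimes>) xs ys)"
  using assms
proof (induction xs ys rule: list_induct2)
  case Nil
  then show ?case by (auto simp: smult_one_mat intro!: exI[of _ 1])
next
  case (Cons x xs y ys)
  then obtain c where c: "cmod c = 1" "list_op W xs * list_op W ys = c \<cdot>\<^sub>m list_op W (map2 (\<otimes>) xs ys)"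
    by auto
  obtain d where d: "cmod d = 1" "W x * W y = d \<cdot>\<^sub>m W (x \<otimes> y)" using W_mult[of x y] Cons.prems by auto
  have "list_op W (x # xs) * list_op W (y # ys) = kronecker (W x * W y) (list_op W xs * list_op W ys)"
    using Cons.prems Cons.hyps list_op_carrier[of xs] list_op_carrier[of ys]
    by (simp add: kronecker_mult[OF W_carrier _ W_carrier])
  also have "\<dots> = (d * c) \<cdot>\<^sub>m list_op W (map2 (\<otimes>) (x # xs) (y # ys))"
    by (simp add: c d kronecker_smult)
  finally show ?case using c d by (intro exI[of _ "d * c"]) (simp add: norm_mult)
qed

lemma list_op_comm:
  assumes "length xs = length ys" "set xs \<subseteq> carrier G" "set ys \<subseteq> carrier G"
  shows "list_op W xs * list_op W ys = list_char \<chi> xs ys \<cdot>\<^sub>m (list_op W ys * list_op W xs)"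
  using assms
proof (induction xs ys rule: list_induct2)
  case Nil
  then show ?case by (simp add: smult_one_mat)
next
  case (Cons x xs y ys)
  have xy: "x \<in> carrier G" "y \<in> carrier G" "set xs \<subseteq> carrier G" "set ys \<subseteq> carrier G" using Cons.prems by auto
  note T = list_op_carrier[OF xy(3)] and T' = list_op_carrier[OF xy(4), folded Cons.hyps]
  show ?case
    using Cons.IH[OF xy(3,4)] W_comm[OF xy(1,2)]
    by (simp add: kronecker_mult[OF W_carrier[OF xy(1)] T W_carrier[OF xy(2)] T']
       kronecker_mult[OF W_carrier[OF xy(2)] T' W_carrier[OF xy(1)] T] kronecker_smult)
qed

lemma list_op_unitary:
  "set xs \<subseteq> carrier G \<Longrightarrow> adj (list_op W xs) * list_op W xs = 1\<^sub>m (N ^ length xs)"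
proof (induction xs)
  case (Cons x xs)
  then have xy: "x \<in> carrier G" "set xs \<subseteq> carrier G" by auto
  note T = list_op_carrier[OF xy(2)] and Wx = W_carrier[OF xy(1)]
  show ?case
    using Cons.IH[OF xy(2)] W_unitary[OF xy(1)]
    by (simp add: kronecker_adj kronecker_mult[OF adj_carrier[OF Wx] adj_carrier[OF T] Wx T] kronecker_one)
qed simp

text \<open>The two tensor factors are freed one at a time: with \<open>W g\<close> fixed in front
  the induction hypothesis gives every tail, and with the tail fixed \<open>W_span\<close> gives
  every first factor. Matrix units of the product are such tensor products.\<close>

lemma list_op_span:
  assumes L: "lin_closed (N ^ n) L"
    and all: "\<And>xs. length xs = n \<Longrightarrow> set xs \<subseteq> carrier G \<Longrightarrow> list_op W xs \<in> L"
  shows "carrier_mat (N ^ n) (N ^ n) \<subseteq> L"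
  using assms
proof (induction n arbitrary: L)
  case 0
  have "mat_unit 1 0 0 = 1\<^sub>m 1" by (rule eq_matI) (auto simp: mat_unit_def)
  then show ?case using 0 by (intro lin_closed_mat_units) auto
next
  case (Suc n)
  have L: "lin_closed (N * N ^ n) L" using Suc.prems(1) by simp
  have 1: "kronecker (W g) B \<in> L" if g: "g \<in> carrier G" and B: "B \<in> carrier_mat (N ^ n) (N ^ n)" for g B
  proof -
    have "carrier_mat (N ^ n) (N ^ n) \<subseteq> {B. kronecker (W g) B \<in> L}"
    proof (rule Suc.IH)
      show "lin_closed (N ^ n) {B. kronecker (W g) B \<in> L}"
        by (rule lin_closed_kronecker_right[OF L W_carrier[OF g]])
      fix xs assume "length xs = n" "set xs \<subseteq> carrier G"
      then show "list_op W xs \<in> {B. kronecker (W g) B \<in> L}"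
        using Suc.prems(2)[of "g # xs"] g by simp
    qed
    then show ?thesis using B by auto
  qed
  have 2: "kronecker A B \<in> L" if A: "A \<in> carrier_mat N N" and B: "B \<in> carrier_mat (N ^ n) (N ^ n)" for A B
    using W_span[OF lin_closed_kronecker_left[OF L B]] 1[OF _ B] A by auto
  have "carrier_mat (N * N ^ n) (N * N ^ n) \<subseteq> L"
    by (rule lin_closed_mat_units[OF L]) (auto simp: mat_unit_kronecker intro!: 2)
  then show ?case by simp
qed

lemma list_char_mult:
  assumes "length xs = length ys" "length ys = length zs"
    "set xs \<subseteq> carrier G" "set ys \<subseteq> carrier G" "set zs \<subseteq> carrier G"
  shows "list_char \<chi> (map2 (\<otimes>) xs ys) zs = list_char \<chi> xs zs * list_char \<chi> ys zs"
  using assms by (induction xs ys zs rule: list_induct3) (auto simp: \<chi>_mult)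

lemma list_char_swap:
  assumes "length xs = length ys" "set xs \<subseteq> carrier G" "set ys \<subseteq> carrier G"
  shows "list_char \<chi> xs ys * list_char \<chi> ys xs = 1"
  using assms
proof (induction xs ys rule: list_induct2)
  case (Cons x xs y ys)
  then have "\<chi> x y * \<chi> y x = 1" "list_char \<chi> xs ys * list_char \<chi> ys xs = 1" by (auto simp: \<chi>_swap)
  moreover have "list_char \<chi> (x # xs) (y # ys) * list_char \<chi> (y # ys) (x # xs) =
    (\<chi> x y * \<chi> y x) * (list_char \<chi> xs ys * list_char \<chi> ys xs)" by (simp add: mult_ac)
  ultimately show ?case by simp
qed simp

lemma list_char_self: "set xs \<subseteq> carrier G \<Longrightarrow> list_char \<chi> xs xs = 1"
  by (induction xs) (auto simp: \<chi>_self)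

lemma list_char_pow:
  assumes "length xs = length ys" "set xs \<subseteq> carrier G" "set ys \<subseteq> carrier G"
  shows "list_char \<chi> xs ys ^ p = 1"
  using assms by (induction xs ys rule: list_induct2) (auto simp: power_mult_distrib \<chi>_pow)

lemma list_char_one_right:
  "set xs \<subseteq> carrier G \<Longrightarrow> list_char \<chi> xs (replicate (length xs) \<one>) = 1"
  by (induction xs) (auto simp: \<chi>_one_right)

text \<open>The witness is trivial except at the first coordinate where \<open>xs\<close> is not, so
  the product reduces to a single factor.\<close>

lemma list_char_nondeg:
  "set xs \<subseteq> carrier G \<Longrightarrow> xs \<noteq> replicate (length xs) \<one> \<Longrightarrow>
    \<exists>ys. length ys = length xs \<and> set ys \<subseteq> carrier G \<and> list_char \<chi> xs ys \<noteq> 1"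
proof (induction xs)
  case (Cons x xs)
  show ?case
  proof (cases "x = \<one>")
    case True
    then obtain ys where "length ys = length xs" "set ys \<subseteq> carrier G" "list_char \<chi> xs ys \<noteq> 1"
      using Cons by auto
    then show ?thesis using True by (intro exI[of _ "\<one> # ys"]) (auto simp: \<chi>_one_right)
  next
    case False
    then obtain y where "y \<in> carrier G" "\<chi> x y \<noteq> 1" using \<chi>_nondeg[of x] Cons.prems by auto
    then show ?thesis
      using Cons.prems
      by (intro exI[of _ "y # replicate (length xs) \<one>"]) (auto simp: list_char_one_right)
  qed
qed simp

lemma weyl_system_list: "weyl_system (list_group n G) (N ^ n) p (list_op W) (list_char \<chi>)"
proof -
  interpret l: comm_group "list_group n G" by (rule list_group_comm_group) (rule comm_group_axioms)
  show ?thesis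
  proof (unfold_locales)
    show "finite (carrier (list_group n G))"
      using finite_lists_length_eq[OF finite_G] by (simp add: conj_commute)
    show "list_op W \<one>\<^bsub>list_group n G\<^esub> = 1\<^sub>m (N ^ n)"
      by (simp add: list_op_def W_one tensor_list_ones)
    show "carrier_mat (N ^ n) (N ^ n) \<subseteq> L"
      if "lin_closed (N ^ n) L" "\<And>g. g \<in> carrier (list_group n G) \<Longrightarrow> list_op W g \<in> L" for L
      using that by (intro list_op_span) auto
    fix xs assume xs: "xs \<in> carrier (list_group n G)"
    then show "list_op W xs \<in> carrier_mat (N ^ n) (N ^ n)" using list_op_carrier[of xs] by auto
    show "adj (list_op W xs) * list_op W xs = 1\<^sub>m (N ^ n)" using xs list_op_unitary[of xs] by auto
    show "list_char \<chi> xs xs = 1" using xs by (simp add: list_char_self)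
    show "\<exists>h\<in>carrier (list_group n G). list_char \<chi> xs h \<noteq> 1" if "xs \<noteq> \<one>\<^bsub>list_group n G\<^esub>"
      using xs that list_char_nondeg[of xs] by auto
    fix ys assume ys: "ys \<in> carrier (list_group n G)"
    show "\<exists>c. cmod c = 1 \<and> list_op W xs * list_op W ys = c \<cdot>\<^sub>m list_op W (xs \<otimes>\<^bsub>list_group n G\<^esub> ys)"
      using xs ys list_op_mult[of xs ys] by simp
    show "list_op W xs * list_op W ys = list_char \<chi> xs ys \<cdot>\<^sub>m (list_op W ys * list_op W xs)"
      using xs ys by (intro list_op_comm) auto
    show "list_char \<chi> xs ys * list_char \<chi> ys xs = 1" using xs ys by (intro list_char_swap) auto
    show "list_char \<chi> xs ys ^ p = 1" using xs ys by (intro list_char_pow) auto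
    fix zs assume "zs \<in> carrier (list_group n G)"
    then show "list_char \<chi> (xs \<otimes>\<^bsub>list_group n G\<^esub> ys) zs = list_char \<chi> xs zs * list_char \<chi> ys zs"
      using xs ys list_char_mult[of xs ys zs] by simp
  qed (use prime_p N_pos in auto)
qed

text \<open>Expanding each tensor factor in the operators W, a scalar factor contributes the
  identity label only. Every label in the expansion is thus supported where the error is, so its
  weight does not exceed that of the error.\<close>

lemma tensor_list_in_span:
  assumes "set Es \<subseteq> carrier_mat N N" and "lin_closed (N ^ length Es) L"
    and "\<And>ws. list_all2 (\<lambda>E w. w \<in> carrier G \<and> (scalar_op N E \<longrightarrow> w = \<one>)) Es ws \<Longrightarrow> list_op W ws \<in> L"
  shows "tensor_list Es \<in> L"
  using assms
proof (induction Es arbitrary: L)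
  case Nil
  then show ?case using Nil(3)[of "[]"] by simp
next
  case (Cons E Es)
  define n where "n = length Es"
  have L: "lin_closed (N * N ^ n) L" using Cons.prems(2) by (simp add: n_def)
  have E: "E \<in> carrier_mat N N" and Es: "set Es \<subseteq> carrier_mat N N" using Cons.prems by auto
  have T: "tensor_list Es \<in> carrier_mat (N ^ n) (N ^ n)"
    unfolding n_def by (rule tensor_list_carrier[OF Es])
  have W: "kronecker (W w) (tensor_list Es) \<in> L"
    if w: "w \<in> carrier G" "scalar_op N E \<longrightarrow> w = \<one>" for w
  proof -
    have "tensor_list Es \<in> {B. kronecker (W w) B \<in> L}"
    proof (rule Cons.IH[OF Es])
      show "lin_closed (N ^ length Es) {B. kronecker (W w) B \<in> L}"
        using lin_closed_kronecker_right[OF L W_carrier[OF w(1)]] by (simp add: n_def)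
      fix ws assume "list_all2 (\<lambda>E w. w \<in> carrier G \<and> (scalar_op N E \<longrightarrow> w = \<one>)) Es ws"
      then show "list_op W ws \<in> {B. kronecker (W w) B \<in> L}"
        using Cons.prems(3)[of "w # ws"] w by simp
    qed
    then show ?thesis by simp
  qed
  note closed = lin_closed_kronecker_left[OF L T]
  have "E \<in> {A. kronecker A (tensor_list Es) \<in> L}"
  proof (cases "scalar_op N E")
    case True
    then obtain c where c: "E = c \<cdot>\<^sub>m 1\<^sub>m N" by (auto simp: scalar_op_def)
    have "1\<^sub>m N \<in> {A. kronecker A (tensor_list Es) \<in> L}" using W[of \<one>] by (simp add: W_one)
    then show ?thesis unfolding c by (intro lin_closed_smult[OF closed]) auto
  next
    case False
    then show ?thesis using W_span[OF closed] W E by blast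
  qed
  then show ?case by simp
qed

end

section \<open>The Weyl system on complex p-space\<close>

definition shift_clock_group :: "nat \<Rightarrow> (nat \<times> nat) monoid" where
  "shift_clock_group p = \<lparr>carrier = {..<p} \<times> {..<p},
     mult = (\<lambda>(a, b) (c, d). ((a + c) mod p, (b + d) mod p)), one = (0, 0)\<rparr>"

text \<open>The operator X^a Z^b, which sends the basis vector j to \<omega>^(b j) times the basis
  vector j + a modulo p.\<close>

definition shift_clock :: "nat \<Rightarrow> nat \<times> nat \<Rightarrow> complex mat" where
  "shift_clock p = (\<lambda>(a, b). mat p p (\<lambda>(i, j). if i = (j + a) mod p then unity_root p ^ (b * j) else 0))"

text \<open>The standard symplectic form on pairs, \<omega>^(b c - a d), as a quotient because the
  exponents are natural numbers.\<close>

definition shift_clock_char :: "nat \<Rightarrow> nat \<times> nat \<Rightarrow> nat \<times> nat \<Rightarrow> complex" where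
  "shift_clock_char p = (\<lambda>(a, b) (c, d). unity_root p ^ (b * c) / unity_root p ^ (a * d))"

lemma unity_root_mod:
  assumes "p > 0"
  shows "unity_root p ^ (a mod p) = unity_root p ^ a"
proof -
  have "unity_root p ^ a = unity_root p ^ (p * (a div p) + a mod p)" by simp
  then show ?thesis using assms by (simp only: power_add power_mult unity_root_pow) simp
qed

lemma unity_root_mod_mult:
  assumes "p > 0"
  shows "unity_root p ^ ((a mod p) * b) = unity_root p ^ (a * b)"
    "unity_root p ^ (b * (a mod p)) = unity_root p ^ (b * a)"
proof -
  have "((a mod p) * b) mod p = (a * b) mod p" by (rule mod_mult_left_eq)
  then show "unity_root p ^ ((a mod p) * b) = unity_root p ^ (a * b)"
    by (metis unity_root_mod[OF assms])
  then show "unity_root p ^ (b * (a mod p)) = unity_root p ^ (b * a)"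
    by (simp only: mult.commute)
qed

lemma unity_root_pow_pow: "p > 0 \<Longrightarrow> (unity_root p ^ k) ^ p = 1"
  by (metis power_mult mult.commute unity_root_pow power_one)

lemma shift_clock_carrier: "shift_clock p g \<in> carrier_mat p p"
  by (simp add: shift_clock_def split: prod.split)

lemma shift_clock_group_comm_group:
  assumes "p > 0"
  shows "comm_group (shift_clock_group p)"
proof (rule comm_groupI)
  fix x assume "x \<in> carrier (shift_clock_group p)"
  then obtain a b where x: "x = (a, b)" "a < p" "b < p" by (auto simp: shift_clock_group_def)
  then show "\<exists>y\<in>carrier (shift_clock_group p). y \<otimes>\<^bsub>shift_clock_group p\<^esub> x = \<one>\<^bsub>shift_clock_group p\<^esub>"
    by (intro bexI[of _ "((p - a) mod p, (p - b) mod p)"])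
      (auto simp: shift_clock_group_def mod_add_left_eq)
qed (use assms in \<open>auto simp: shift_clock_group_def mod_add_left_eq mod_add_right_eq add_ac\<close>)

lemma shift_clock_mult:
  assumes "a < p" "b < p" "c < p" "d < p"
  shows "shift_clock p (a, b) * shift_clock p (c, d) =
    unity_root p ^ (b * c) \<cdot>\<^sub>m shift_clock p ((a + c) mod p, (b + d) mod p)"
proof (rule eq_matI)
  have p: "p > 0" using assms by simp
  fix i j assume "i < dim_row (unity_root p ^ (b * c) \<cdot>\<^sub>m shift_clock p ((a + c) mod p, (b + d) mod p))"
    "j < dim_col (unity_root p ^ (b * c) \<cdot>\<^sub>m shift_clock p ((a + c) mod p, (b + d) mod p))"
  then have ij: "i < p" "j < p" by (auto simp: shift_clock_def)
  have "(shift_clock p (a, b) * shift_clock p (c, d)) $$ (i, j) =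
      (\<Sum>k<p. shift_clock p (a, b) $$ (i, k) * shift_clock p (c, d) $$ (k, j))"
    by (rule mult_index[OF shift_clock_carrier shift_clock_carrier ij])
  also have "\<dots> = (\<Sum>k<p. if k = (j + c) mod p then
      (if i = (k + a) mod p then unity_root p ^ (b * k) * unity_root p ^ (d * j) else 0) else 0)"
    using ij by (intro sum.cong refl) (auto simp: shift_clock_def)
  also have "\<dots> = (if i = ((j + c) mod p + a) mod p then
      unity_root p ^ (b * ((j + c) mod p)) * unity_root p ^ (d * j) else 0)"
    using p by simp
  also have "\<dots> = unity_root p ^ (b * c) * (if i = (j + (a + c) mod p) mod p then
      unity_root p ^ (((b + d) mod p) * j) else 0)"
    by (simp add: unity_root_mod_mult[OF p] mod_add_left_eq mod_add_right_eq add_ac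
        distrib_left distrib_right power_add)
  finally show "(shift_clock p (a, b) * shift_clock p (c, d)) $$ (i, j) =
      (unity_root p ^ (b * c) \<cdot>\<^sub>m shift_clock p ((a + c) mod p, (b + d) mod p)) $$ (i, j)"
    using ij by (simp add: shift_clock_def)
qed (auto simp: shift_clock_def)

lemma shift_clock_unitary:
  assumes "a < p" "b < p"
  shows "adj (shift_clock p (a, b)) * shift_clock p (a, b) = 1\<^sub>m p"
proof (rule eq_matI)
  fix i j assume "i < dim_row (1\<^sub>m p)" "j < dim_col (1\<^sub>m p)"
  then have ij: "i < p" "j < p" by auto
  have inj: "(i + a) mod p = (j + a) mod p \<longleftrightarrow> i = j"
    using ij by (metis cong_def cong_add_rcancel_nat mod_less)
  have "(adj (shift_clock p (a, b)) * shift_clock p (a, b)) $$ (i, j) =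
      (\<Sum>k<p. cnj (shift_clock p (a, b) $$ (k, i)) * shift_clock p (a, b) $$ (k, j))"
    using ij by (subst mult_index[OF adj_carrier[OF shift_clock_carrier] shift_clock_carrier])
      (auto simp: carrier_matD[OF shift_clock_carrier])
  also have "\<dots> = (\<Sum>k<p. if k = (j + a) mod p then
      (if i = j then cnj (unity_root p ^ (b * i)) * unity_root p ^ (b * j) else 0) else 0)"
    using ij inj by (intro sum.cong refl) (auto simp: shift_clock_def)
  also have "\<dots> = (if i = j then cnj (unity_root p ^ (b * i)) * unity_root p ^ (b * i) else 0)"
    using ij by simp
  also have "cnj (unity_root p ^ (b * i)) * unity_root p ^ (b * i) = 1"
  proof -
    have "cmod (unity_root p ^ (b * i)) = 1" by (simp add: norm_power)
    then show ?thesis by (metis complex_norm_square mult.commute of_real_1 power_one)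
  qed
  finally show "(adj (shift_clock p (a, b)) * shift_clock p (a, b)) $$ (i, j) = 1\<^sub>m p $$ (i, j)"
    using ij by simp
qed (auto simp: shift_clock_def)

text \<open>For fixed a, Fourier inversion in the clock exponent b isolates a single entry on the
  shifted diagonal.\<close>

lemma shift_clock_span:
  assumes L: "lin_closed p L" and all: "\<And>a b. a < p \<Longrightarrow> b < p \<Longrightarrow> shift_clock p (a, b) \<in> L"
  shows "carrier_mat p p \<subseteq> L"
proof (rule lin_closed_mat_units[OF L])
  fix i j assume ij: "i < p" "j < p"
  \<comment> \<open>The shift i - j modulo p, which places the entry (i, j) on the support.\<close>
  define a where "a = (i + (p - j)) mod p"
  let ?\<omega> = "unity_root p"
  have aj: "(j + a) mod p = i" using ij by (simp add: a_def mod_add_right_eq)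
  have "mat_unit p i j = msum p p (\<lambda>b. (1 / of_nat p * (1 / ?\<omega> ^ (b * j))) \<cdot>\<^sub>m shift_clock p (a, b))"
  proof (rule eq_matI)
    fix k l assume "k < dim_row (msum p p (\<lambda>b. (1 / of_nat p * (1 / ?\<omega> ^ (b * j))) \<cdot>\<^sub>m shift_clock p (a, b)))"
      "l < dim_col (msum p p (\<lambda>b. (1 / of_nat p * (1 / ?\<omega> ^ (b * j))) \<cdot>\<^sub>m shift_clock p (a, b)))"
    then have kl: "k < p" "l < p" by auto
    have "msum p p (\<lambda>b. (1 / of_nat p * (1 / ?\<omega> ^ (b * j))) \<cdot>\<^sub>m shift_clock p (a, b)) $$ (k, l) =
      (\<Sum>b<p. (if k = (l + a) mod p then 1 / of_nat p * (?\<omega> ^ l / ?\<omega> ^ j) ^ b else 0))"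
      using kl unfolding msum_index[OF kl]
      by (intro sum.cong refl) (auto simp: shift_clock_def power_divide mult.commute simp flip: power_mult)
    also have "\<dots> = (if k = (l + a) mod p then 1 / of_nat p * (\<Sum>b<p. (?\<omega> ^ l / ?\<omega> ^ j) ^ b) else 0)"
      by (simp add: sum_distrib_left)
    also have "\<dots> = (if k = i \<and> l = j then 1 else 0)"
    proof (cases "l = j")
      case True
      then show ?thesis using aj ij by auto
    next
      case False
      have "?\<omega> ^ l / ?\<omega> ^ j \<noteq> 1" using unity_root_pow_inj[of l p j] False kl ij by auto
      moreover have "(?\<omega> ^ l / ?\<omega> ^ j) ^ p = 1"
        using ij by (simp add: power_divide unity_root_pow_pow)
      ultimately show ?thesis using root_of_unity_sum False by simp
    qed
    finally show "mat_unit p i j $$ (k, l) =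
      msum p p (\<lambda>b. (1 / of_nat p * (1 / ?\<omega> ^ (b * j))) \<cdot>\<^sub>m shift_clock p (a, b)) $$ (k, l)"
      using kl by (simp add: mat_unit_def)
  qed (auto simp: mat_unit_def)
  also have "\<dots> \<in> L"
    using ij by (intro lin_closed_msum[OF L] lin_closed_smult[OF L] smult_carrier_mat shift_clock_carrier all)
      (auto simp: a_def)
  finally show "mat_unit p i j \<in> L" .
qed

lemma weyl_system_shift_clock:
  assumes prime: "prime p"
  shows "weyl_system (shift_clock_group p) p p (shift_clock p) (shift_clock_char p)"
proof -
  have p: "p > 0" "1 < p" using prime using prime_gt_0_nat[OF prime] prime_gt_1_nat[OF prime] by auto
  note mods = unity_root_mod_mult[OF p(1)]
  interpret comm_group "shift_clock_group p" by (rule shift_clock_group_comm_group[OF p(1)])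
  have carrier: "carrier (shift_clock_group p) = {..<p} \<times> {..<p}" by (simp add: shift_clock_group_def)
  have mult: "(a, b) \<otimes>\<^bsub>shift_clock_group p\<^esub> (c, d) = ((a + c) mod p, (b + d) mod p)" for a b c d
    by (simp add: shift_clock_group_def)
  show ?thesis
  proof unfold_locales
    show "shift_clock p \<one>\<^bsub>shift_clock_group p\<^esub> = 1\<^sub>m p"
      by (rule eq_matI) (auto simp: shift_clock_def shift_clock_group_def)
    show "carrier_mat p p \<subseteq> L"
      if "lin_closed p L" "\<And>g. g \<in> carrier (shift_clock_group p) \<Longrightarrow> shift_clock p g \<in> L" for L
      using that by (intro shift_clock_span) (auto simp: carrier)
    fix g assume g: "g \<in> carrier (shift_clock_group p)"
    obtain a b where ab: "g = (a, b)" "a < p" "b < p" using g by (auto simp: carrier)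
    show "adj (shift_clock p g) * shift_clock p g = 1\<^sub>m p" using ab by (simp add: shift_clock_unitary)
    show "shift_clock_char p g g = 1" by (simp add: ab shift_clock_char_def mult.commute)
    show "\<exists>h\<in>carrier (shift_clock_group p). shift_clock_char p g h \<noteq> 1" if "g \<noteq> \<one>\<^bsub>shift_clock_group p\<^esub>"
    \<comment> \<open>The clock detects a nontrivial shift part and the shift detects a nontrivial
      clock part: the pairings are \<omega>^(-a) and \<omega>^b.\<close>
    proof (cases "b = 0")
      case True
      then have "a \<noteq> 0" using that ab by (simp add: shift_clock_group_def)
      then have "unity_root p ^ a \<noteq> 1" using unity_root_pow_inj[of a p 0] ab by auto
      then show ?thesis using p by (intro bexI[of _ "(0, 1)"]) (auto simp: ab shift_clock_char_def carrier)
    next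
      case False
      then have "unity_root p ^ b \<noteq> 1" using unity_root_pow_inj[of b p 0] ab by auto
      then show ?thesis using p by (intro bexI[of _ "(1, 0)"]) (auto simp: ab shift_clock_char_def carrier)
    qed
    fix h assume h: "h \<in> carrier (shift_clock_group p)"
    obtain c d where cd: "h = (c, d)" "c < p" "d < p" using h by (auto simp: carrier)
    show "\<exists>c. cmod c = 1 \<and> shift_clock p g * shift_clock p h = c \<cdot>\<^sub>m shift_clock p (g \<otimes>\<^bsub>shift_clock_group p\<^esub> h)"
      using ab cd by (intro exI[of _ "unity_root p ^ (b * c)"]) (simp add: shift_clock_mult mult norm_power)
    show "shift_clock p g * shift_clock p h = shift_clock_char p g h \<cdot>\<^sub>m (shift_clock p h * shift_clock p g)"
      using ab cd by (simp add: shift_clock_mult smult_smult_mat shift_clock_char_def add.commute mult.commute)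
    show "shift_clock_char p g h * shift_clock_char p h g = 1"
      by (simp add: ab cd shift_clock_char_def mult.commute)
    show "shift_clock_char p g h ^ p = 1"
      using p by (simp add: ab cd shift_clock_char_def power_divide unity_root_pow_pow)
    fix k assume k: "k \<in> carrier (shift_clock_group p)"
    show "shift_clock_char p (g \<otimes>\<^bsub>shift_clock_group p\<^esub> h) k = shift_clock_char p g k * shift_clock_char p h k"
      by (cases k) (simp add: ab cd mult shift_clock_char_def mods distrib_right power_add)
  qed (use prime p in \<open>auto simp: carrier shift_clock_carrier\<close>)
qed

section \<open>Hamming balls and the Gilbert--Varshamov bound\<close>

definition words :: "'a set \<Rightarrow> nat \<Rightarrow> 'a list set" where
  "words C n = {ws. length ws = n \<and> set ws \<subseteq> C}"

definition word_weight :: "'a \<Rightarrow> 'a list \<Rightarrow> nat" where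
  "word_weight e ws = length (filter (\<lambda>w. w \<noteq> e) ws)"

lemma words_Suc: "words C (Suc n) = (\<lambda>(w, ws). w # ws) ` (C \<times> words C n)"
  by (auto simp: words_def length_Suc_conv image_iff)

lemma finite_words: "finite C \<Longrightarrow> finite (words C n)"
  unfolding words_def using finite_lists_length_eq[of C n] by (simp add: conj_commute)

text \<open>The sum factors over coordinates; each contributes 1 for the letter e and x for every
  other letter.\<close>

lemma weight_enumerator:
  fixes x :: real
  assumes C: "finite C" "e \<in> C"
  shows "(\<Sum>ws\<in>words C n. x ^ word_weight e ws) = (1 + (real (card C) - 1) * x) ^ n"
proof (induction n)
  case 0
  have "words C 0 = {[]}" by (auto simp: words_def)
  then show ?case by (simp add: word_weight_def)
next
  case (Suc n)
  have "(\<Sum>ws\<in>words C (Suc n). x ^ word_weight e ws) =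
      (\<Sum>(w, ws)\<in>C \<times> words C n. x ^ word_weight e (w # ws))"
    unfolding words_Suc by (subst sum.reindex) (auto simp: inj_on_def intro!: sum.cong)
  also have "\<dots> = (\<Sum>w\<in>C. \<Sum>ws\<in>words C n. (if w = e then 1 else x) * x ^ word_weight e ws)"
    by (subst sum.cartesian_product[symmetric]) (auto simp: word_weight_def intro!: sum.cong)
  also have "\<dots> = (\<Sum>w\<in>C. if w = e then 1 else x) * (1 + (real (card C) - 1) * x) ^ n"
    by (simp add: Suc sum_distrib_left[symmetric] sum_distrib_right[symmetric])
  also have "(\<Sum>w\<in>C. if w = e then 1 else x) = 1 + (\<Sum>w\<in>C - {e}. if w = e then 1 else x)"
    using C by (subst sum.remove[of _ e]) auto
  also have "(\<Sum>w\<in>C - {e}. if w = e then 1 else x) = (real (card C) - 1) * x"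
  proof -
    have "card C > 0" using C by (auto simp: card_gt_0_iff)
    then show ?thesis using C by (simp add: of_nat_diff card_Diff_singleton Suc_leI)
  qed
  finally show ?case by simp
qed

text \<open>A Chernoff-type bound: as x \<le> 1, each word of the ball has x^weight \<ge> x^t, so
  the ball is dominated by the full weight enumerator.\<close>

lemma card_ball_le:
  fixes x :: real
  assumes C: "finite C" "e \<in> C" and x: "0 < x" "x \<le> 1"
  shows "card {ws \<in> words C n. word_weight e ws \<le> t} * x ^ t \<le> (1 + (real (card C) - 1) * x) ^ n"
proof -
  let ?B = "{ws \<in> words C n. word_weight e ws \<le> t}"
  have "card ?B * x ^ t = (\<Sum>ws\<in>?B. x ^ t)" by simp
  also have "\<dots> \<le> (\<Sum>ws\<in>?B. x ^ word_weight e ws)"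
    using x by (intro sum_mono power_decreasing) auto
  also have "\<dots> \<le> (\<Sum>ws\<in>words C n. x ^ word_weight e ws)"
    using finite_words[OF C(1)] x by (intro sum_mono2) auto
  finally show ?thesis by (simp add: weight_enumerator[OF C])
qed

lemma card_ball_0_le:
  "card {ws \<in> words C n. word_weight e ws \<le> 0} \<le> 1"
proof -
  have "{ws \<in> words C n. word_weight e ws \<le> 0} \<subseteq> {replicate n e}"
  proof
    fix ws assume "ws \<in> {ws \<in> words C n. word_weight e ws \<le> 0}"
    then have "length ws = n" "\<forall>w\<in>set ws. w = e"
      by (auto simp: words_def word_weight_def filter_empty_conv)
    then show "ws \<in> {replicate n e}" by (metis replicate_eqI singletonI)
  qed
  then show ?thesis using card_mono[of "{replicate n e}"] by force
qed

text \<open>The exponential rate of the Hamming ball volume over the \<open>q\<^sup>2\<close>-letter alphabet of error labels.\<close>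

definition ball_rate :: "nat \<Rightarrow> real \<Rightarrow> real" where
  "ball_rate q \<delta> = \<delta> * log (real q) (real q + 1) + entropy_q q \<delta>"

text \<open>Splitting q^2 - 1 as (q + 1)(q - 1) exhibits the rate as twice the q^2-ary entropy of
  \<delta>.\<close>

lemma ball_rate_eq:
  assumes "q \<ge> 2"
  shows "ball_rate q \<delta> = \<delta> * log q ((real q)\<^sup>2 - 1) - \<delta> * log q \<delta> - (1 - \<delta>) * log q (1 - \<delta>)"
proof -
  have "(real q)\<^sup>2 - 1 = (real q + 1) * (real q - 1)" by (simp add: power2_eq_square algebra_simps)
  moreover have "log q ((real q + 1) * (real q - 1)) = log q (real q + 1) + log q (real q - 1)"
    using assms by (simp add: log_mult)
  ultimately show ?thesis by (simp add: ball_rate_def entropy_q_def distrib_left)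
qed

text \<open>If 1 - \<delta> < 1/q^2, then -log_q(1 - \<delta>) is at least L = log_q(q^2 - 1), so
  the rate is at least \<delta> L + (1 - \<delta>) L = L \<ge> 1. The conclusion is the condition
  under which the parameter x of the ball estimate is at most 1.\<close>

lemma ball_rate_less_1_imp:
  assumes q: "q \<ge> 2" and \<delta>: "0 \<le> \<delta>" "\<delta> \<le> 1" and less: "ball_rate q \<delta> < 1"
  shows "\<delta> * (real q)\<^sup>2 \<le> (real q)\<^sup>2 - 1"
proof (rule ccontr)
  assume "\<not> ?thesis"
  then have small: "(1 - \<delta>) * (real q)\<^sup>2 < 1" by (simp add: algebra_simps)
  define L where "L = log q ((real q)\<^sup>2 - 1)"
  have q1: "real q > 1" using q by simp
  have "real q * 2 \<le> real q * real q" using q by (intro mult_left_mono) auto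
  then have qq: "real q \<le> (real q)\<^sup>2 - 1" unfolding power2_eq_square using q1 by linarith
  have L1: "L \<ge> 1"
  proof -
    have "log q (real q) \<le> L" unfolding L_def using q1 qq by (intro log_mono) auto
    then show ?thesis using q1 by simp
  qed
  have "(1 - \<delta>) * L \<le> - ((1 - \<delta>) * log q (1 - \<delta>))"
  proof (cases "\<delta> = 1")
    case False
    then have d: "1 - \<delta> > 0" using \<delta> by simp
    have "L \<le> log q (inverse (1 - \<delta>))"
      unfolding L_def
    proof (rule log_mono[OF q1])
      show "(real q)\<^sup>2 - 1 \<le> inverse (1 - \<delta>)"
        using small d by (simp add: field_simps)
      show "0 < (real q)\<^sup>2 - 1" using qq q1 by linarith
    qed
    also have "\<dots> = - log q (1 - \<delta>)" using d by (simp add: log_inverse)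
    finally have "(1 - \<delta>) * L \<le> (1 - \<delta>) * - log q (1 - \<delta>)" using d by (intro mult_left_mono) auto
    then show ?thesis by simp
  qed simp
  moreover have "\<delta> * log q \<delta> \<le> 0"
  proof (cases "\<delta> = 0")
    case False
    then have "log q \<delta> \<le> 0" using \<delta> q1 by (simp add: log_le_zero_cancel_iff)
    then show ?thesis using \<delta> by (simp add: mult_nonneg_nonpos)
  qed simp
  ultimately have "\<delta> * L + (1 - \<delta>) * L \<le> ball_rate q \<delta>"
    unfolding ball_rate_eq[OF q] L_def[symmetric] by linarith
  then show False using L1 less by (simp add: algebra_simps)
qed

lemma card_ball_le_powr:
  assumes C: "finite C" "e \<in> C" "card C = q\<^sup>2" and q: "q \<ge> 2"
    and \<delta>: "0 \<le> \<delta>" "\<delta> \<le> 1" and less: "ball_rate q \<delta> < 1" and t: "real t \<le> \<delta> * n"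
  shows "card {ws \<in> words C n. word_weight e ws \<le> t} \<le> real q powr (n * ball_rate q \<delta>)"
proof (cases "\<delta> = 0")
  \<comment> \<open>For \<delta> = 0 the optimal parameter would be x = 0, so the ball of radius 0
    is counted directly.\<close>
  case True
  then have "t = 0" using t by simp
  moreover have "ball_rate q \<delta> = 0" using True by (simp add: ball_rate_def entropy_q_def)
  ultimately show ?thesis using card_ball_0_le[of C n e] q by simp
next
  case False
  define s where "s = (real q)\<^sup>2"
  have q1: "real q > 1" using q by simp
  have s1: "s > 1" using q1 unfolding s_def by (rule one_less_power) simp
  have \<delta>s: "\<delta> * s \<le> s - 1" using ball_rate_less_1_imp[OF q \<delta> less] by (simp add: s_def)
  have \<delta>1: "\<delta> < 1" using \<delta>s \<delta> s1 by (cases "\<delta> = 1") auto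
  have \<delta>0: "\<delta> > 0" using \<delta> False by simp
  \<comment> \<open>The minimiser of (1 + (s - 1) x) / x^\<delta>, found by setting the logarithmic
    derivative to zero.\<close>
  define x where "x = \<delta> / ((1 - \<delta>) * (s - 1))"
  have pos: "(1 - \<delta>) * (s - 1) > 0" using \<delta>1 s1 by simp
  have x0: "0 < x" using \<delta>0 pos by (simp add: x_def)
  have x1: "x \<le> 1" using \<delta>s pos by (simp add: x_def field_simps)
  have base: "1 + (s - 1) * x = 1 / (1 - \<delta>)"
  proof -
    have "(s - 1) * x = \<delta> / (1 - \<delta>)" using \<delta>1 s1 by (simp add: x_def)
    then show ?thesis using \<delta>1 by (simp add: field_simps)
  qed
  define B where "B = real (card {ws \<in> words C n. word_weight e ws \<le> t})"
  have "B * x powr (\<delta> * n) \<le> B * x ^ t"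
  proof -
    have "x powr (\<delta> * n) \<le> x powr t" using x0 x1 t by (intro powr_mono') auto
    then show ?thesis using x0 by (intro mult_left_mono) (auto simp: powr_realpow B_def)
  qed
  also have "\<dots> \<le> (1 / (1 - \<delta>)) ^ n"
    using card_ball_le[OF C(1,2) x0 x1, of n t] C(3) base by (simp add: B_def s_def)
  finally have "B \<le> (1 / (1 - \<delta>)) ^ n / x powr (\<delta> * n)"
    using x0 by (subst pos_le_divide_eq) auto
  also have "\<dots> = real q powr (n * ball_rate q \<delta>)"
  proof -
    have lx: "log q x = log q \<delta> - (log q (1 - \<delta>) + log q (s - 1))"
      using \<delta>0 \<delta>1 s1 unfolding x_def by (simp add: log_divide log_mult)
    have "(1 / (1 - \<delta>)) ^ n = real q powr (log q (1 / (1 - \<delta>)) * n)"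
      using \<delta>1 q1 by (simp add: powr_powr[symmetric] powr_realpow)
    moreover have "log q (1 / (1 - \<delta>)) = - log q (1 - \<delta>)"
      using \<delta>1 by (simp add: log_divide)
    moreover have "x powr (\<delta> * n) = real q powr (log q x * (\<delta> * n))"
      using x0 q1 by (simp add: powr_powr[symmetric])
    ultimately have "(1 / (1 - \<delta>)) ^ n / x powr (\<delta> * n) =
        real q powr (- log q (1 - \<delta>) * n - log q x * (\<delta> * n))"
      by (simp only: powr_diff)
    also have "- log q (1 - \<delta>) * n - log q x * (\<delta> * n) = n * ball_rate q \<delta>"
      unfolding ball_rate_eq[OF q] lx s_def[symmetric] by (simp add: algebra_simps)
    finally show ?thesis .
  qed
  finally show ?thesis by (simp add: B_def)
qed

section \<open>From error labels to codes\<close>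

text \<open>P A P is linear in A, so detection of an arbitrary error follows from detection of the
  labels in its expansion.\<close>

lemma detecting_matrices_lin_closed:
  assumes P: "P \<in> carrier_mat N N"
  shows "lin_closed N {A \<in> carrier_mat N N. \<exists>c. P * A * P = c \<cdot>\<^sub>m P}"
  unfolding lin_closed_def
proof (intro conjI ballI allI impI)
  have "P * 0\<^sub>m N N * P = 0 \<cdot>\<^sub>m P"
    using P by (intro eq_matI) auto
  then show "0\<^sub>m N N \<in> {A \<in> carrier_mat N N. \<exists>c. P * A * P = c \<cdot>\<^sub>m P}" by auto
next
  fix A B assume A: "A \<in> carrier_mat N N" and B: "B \<in> carrier_mat N N"
    and "A \<in> {A \<in> carrier_mat N N. \<exists>c. P * A * P = c \<cdot>\<^sub>m P}"
    and "B \<in> {A \<in> carrier_mat N N. \<exists>c. P * A * P = c \<cdot>\<^sub>m P}"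
  then obtain c d where cd: "P * A * P = c \<cdot>\<^sub>m P" "P * B * P = d \<cdot>\<^sub>m P" by blast
  have "P * (A + B) * P = (c + d) \<cdot>\<^sub>m P"
    by (simp only: mult_add_distrib_mat[OF P A B] add_mult_distrib_mat[OF mult_carrier_mat[OF P A] mult_carrier_mat[OF P B] P]
       cd add_smult_distrib_right_mat[OF P])
  then show "A + B \<in> {A \<in> carrier_mat N N. \<exists>c. P * A * P = c \<cdot>\<^sub>m P}" using A B by auto
next
  fix c A assume A: "A \<in> carrier_mat N N" and "A \<in> {A \<in> carrier_mat N N. \<exists>c. P * A * P = c \<cdot>\<^sub>m P}"
  then obtain d where d: "P * A * P = d \<cdot>\<^sub>m P" by blast
  have "P * (c \<cdot>\<^sub>m A) * P = (c * d) \<cdot>\<^sub>m P"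
    by (simp only: mult_smult_distrib[OF P A] mult_smult_assoc_mat[OF mult_carrier_mat[OF P A] P] d smult_smult_mat)
  then show "c \<cdot>\<^sub>m A \<in> {A \<in> carrier_mat N N. \<exists>c. P * A * P = c \<cdot>\<^sub>m P}" using A by auto
qed

lemma word_weight_le:
  "list_all2 (\<lambda>E w. w \<in> C \<and> (scalar_op q E \<longrightarrow> w = e)) Es ws \<Longrightarrow> word_weight e ws \<le> error_weight q Es"
  by (induction rule: list_all2_induct) (auto simp: word_weight_def error_weight_def)

lemma exists_code:
  assumes sys: "weyl_system G q p W \<chi>"
    and B_def: "B = card {ws \<in> words (carrier G) n. word_weight \<one>\<^bsub>G\<^esub> ws \<le> t}"
  obtains k U where "isometry (q ^ n) k U" "detects q n k U (Suc t)" "real (q ^ n) / (p * B) \<le> k"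
proof -
  interpret w: weyl_system G q p W \<chi> by (rule sys)
  interpret l: weyl_system "list_group n G" "q ^ n" p "list_op W" "list_char \<chi>" by (rule w.weyl_system_list)
  define L where "L = {ws \<in> words (carrier G) n. word_weight \<one>\<^bsub>G\<^esub> ws \<le> t}"
  have L: "L \<subseteq> carrier (list_group n G)" by (auto simp: L_def words_def)
  have finL: "finite L" using L l.finite_G by (rule finite_subset)
  have "replicate n \<one>\<^bsub>G\<^esub> \<in> L" by (auto simp: L_def words_def word_weight_def)
  then have B: "B = card L" "B > 0" using finL by (auto simp: B_def L_def card_gt_0_iff)
  have p1: "p > 1" using w.prime_p by (rule prime_gt_1_nat)
  have ex: "\<exists>r. p ^ r > B"
    using p1[unfolded One_nat_def] by (intro exI[of _ B] power_gt_expt)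
  \<comment> \<open>Rounding up to a power of p loses at most a factor p: minimality of r gives p^r
    \<le> p B.\<close>
  define r where "r = (LEAST r. p ^ r > B)"
  have r: "p ^ r > B" unfolding r_def using ex by (rule LeastI_ex)
  have r0: "r \<noteq> 0" using r B by (intro notI) simp
  have "\<not> p ^ (r - 1) > B"
    using r0 not_less_Least[of "r - 1" "\<lambda>r. p ^ r > B"] by (simp add: r_def)
  then have "p ^ (r - 1) \<le> B" by simp
  then have pr: "p ^ r \<le> p * B" using r0 by (cases r) auto
  obtain P where P: "P \<in> carrier_mat (q ^ n) (q ^ n)" "P * P = P" "adj P = P"
    "Re (mat_trace P) \<ge> real (q ^ n) / real (p ^ r)"
    and det: "\<And>e. e \<in> L \<Longrightarrow> \<exists>c. P * list_op W e * P = c \<cdot>\<^sub>m P"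
    using l.exists_detecting_projection[OF L, of r] r B by auto
  obtain k U where iso: "isometry (q ^ n) k U" and PU: "P = U * adj U" and tr: "mat_trace P = of_nat k"
    by (rule projection_mrange[OF P(1-3)])
  have "detects q n k U (Suc t)"
    unfolding detects_def
  proof (intro ballI impI)
    fix Es assume Es: "Es \<in> factor_lists q n" and wt: "error_weight q Es < Suc t"
    have len: "length Es = n" "set Es \<subseteq> carrier_mat q q" using Es by (auto simp: factor_lists_def)
    have "tensor_list Es \<in> {A \<in> carrier_mat (q ^ n) (q ^ n). \<exists>c. P * A * P = c \<cdot>\<^sub>m P}"
    proof (rule w.tensor_list_in_span[OF len(2)])
      show "lin_closed (q ^ length Es) {A \<in> carrier_mat (q ^ n) (q ^ n). \<exists>c. P * A * P = c \<cdot>\<^sub>m P}"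
        unfolding len(1) by (rule detecting_matrices_lin_closed[OF P(1)])
      fix ws assume ws: "list_all2 (\<lambda>E w. w \<in> carrier G \<and> (scalar_op q E \<longrightarrow> w = \<one>\<^bsub>G\<^esub>)) Es ws"
      have "length ws = n" using list_all2_lengthD[OF ws] len by simp
      moreover have "set ws \<subseteq> carrier G" using ws by (auto simp: list_all2_conv_all_nth in_set_conv_nth)
      moreover have "word_weight \<one>\<^bsub>G\<^esub> ws \<le> t" using word_weight_le[OF ws] wt by simp
      ultimately have "ws \<in> L" by (simp add: L_def words_def)
      then show "list_op W ws \<in> {A \<in> carrier_mat (q ^ n) (q ^ n). \<exists>c. P * A * P = c \<cdot>\<^sub>m P}"
        using det L l.W_carrier by blast
    qed
    then obtain c where "P * tensor_list Es * P = c \<cdot>\<^sub>m P" by blast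
    then show "\<exists>c. adj U * tensor_list Es * U = c \<cdot>\<^sub>m 1\<^sub>m k"
      using isometry_knill_laflamme[OF iso factor_lists_tensor_carrier[OF Es]] PU by auto
  qed
  moreover have "real (q ^ n) / (p * B) \<le> k"
  proof -
    have "real (q ^ n) / real (p * B) \<le> real (q ^ n) / real (p ^ r)"
      using pr B p1 by (intro divide_left_mono) (auto simp flip: of_nat_mult of_nat_power)
    then show ?thesis using P(4) tr by simp
  qed
  ultimately show thesis using that iso by blast
qed

lemma exists_code_primepow:
  assumes q: "primepow q" and \<delta>: "0 \<le> \<delta>" "\<delta> \<le> 1" and less: "ball_rate q \<delta> < 1"
  obtains K U where "isometry (q ^ n) K U" "detects q n K U (Suc (nat \<lfloor>\<delta> * n\<rfloor>))"
    "real q powr (n * (1 - ball_rate q \<delta>) - 1) \<le> K"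
proof -
  obtain p m where p: "prime p" and m: "m > 0" and qpm: "q = p ^ m"
    using q by (auto simp: primepow_def)
  have pq: "p \<le> q" unfolding qpm using prime_gt_0_nat[OF p] m by (intro self_le_power) auto
  have q2: "q \<ge> 2" using pq prime_ge_2_nat[OF p] by simp
  interpret w: weyl_system "list_group m (shift_clock_group p)" q p
    "list_op (shift_clock p)" "list_char (shift_clock_char p)"
    unfolding qpm by (rule weyl_system.weyl_system_list[OF weyl_system_shift_clock[OF p]])
  let ?G = "list_group m (shift_clock_group p)"
  have "carrier ?G = {xs. set xs \<subseteq> {..<p} \<times> {..<p} \<and> length xs = m}"
    by (auto simp: shift_clock_group_def)
  then have "card (carrier ?G) = card ({..<p} \<times> {..<p}) ^ m"
    by (simp only: card_lists_length_eq finite_cartesian_product finite_lessThan)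
  then have cardG: "card (carrier ?G) = q\<^sup>2"
    by (simp add: qpm power2_eq_square power_mult_distrib)
  define t where "t = nat \<lfloor>\<delta> * n\<rfloor>"
  have t: "real t \<le> \<delta> * n" using \<delta> by (simp add: t_def)
  define B where "B = card {ws \<in> words (carrier ?G) n. word_weight \<one>\<^bsub>?G\<^esub> ws \<le> t}"
  have B: "real B \<le> real q powr (n * ball_rate q \<delta>)"
    unfolding B_def by (rule card_ball_le_powr[OF w.finite_G w.one_closed cardG q2 \<delta> less t])
  have B0: "B > 0"
  proof -
    have "replicate n \<one>\<^bsub>?G\<^esub> \<in> {ws \<in> words (carrier ?G) n. word_weight \<one>\<^bsub>?G\<^esub> ws \<le> t}"
      using w.one_closed by (auto simp: words_def word_weight_def simp del: list_group_simps)
    then show ?thesis unfolding B_def card_gt_0_iff using finite_words[OF w.finite_G] by auto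
  qed
  obtain K U where KU: "isometry (q ^ n) K U" "detects q n K U (Suc t)" "real (q ^ n) / (p * B) \<le> K"
    by (rule exists_code[OF w.weyl_system_axioms B_def])
  \<comment> \<open>The -1 in the exponent pays for the factor p \<le> q lost in rounding.\<close>
  have "real q powr (n * (1 - ball_rate q \<delta>) - 1) = real q powr n / (q * real q powr (n * ball_rate q \<delta>))"
    using q2 by (simp add: powr_diff right_diff_distrib divide_divide_eq_left mult.commute)
  also have "\<dots> \<le> real q powr n / (p * B)"
  proof -
    have "real p * real B \<le> real q * real q powr (n * ball_rate q \<delta>)"
      using pq B by (intro mult_mono) auto
    moreover have "0 < real p * real B" using B0 prime_gt_0_nat[OF p] by simp
    ultimately show ?thesis using q2 by (intro divide_left_mono mult_pos_pos) auto
  qed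
  also have "\<dots> \<le> K" using KU(3) q2 by (simp add: powr_realpow)
  finally show thesis using that KU(1,2) by (simp add: t_def)
qed

lemma gilbert_varshamov_codes:
  fixes n :: nat and \<delta> :: real
  assumes q: "primepow q" and \<delta>: "0 \<le> \<delta>" "\<delta> \<le> 1" and pos: "ball_rate q \<delta> < 1"
    and large: "n * (1 - ball_rate q \<delta>) \<ge> 2"
  obtains n' Q where "n' \<le> n" "n' > 0" "quantum_code q n' Q"
    "n * (1 - ball_rate q \<delta>) - 1 \<le> log q (code_dim q n' Q)" "log q (code_dim q n' Q) \<le> n'"
    "\<delta> * n' \<le> min_distance q n' Q" "min_distance q n' Q \<le> \<delta> * n' + 1"
proof -
  have q2: "q \<ge> 2" using primepow_gt_Suc_0[OF q] by simp
  then have q1: "real q > 1" by simp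
  obtain K U where KU: "isometry (q ^ n) K U" "detects q n K U (Suc (nat \<lfloor>\<delta> * n\<rfloor>))"
    "real q powr (n * (1 - ball_rate q \<delta>) - 1) \<le> K"
    by (rule exists_code_primepow[OF q \<delta> pos])
  \<comment> \<open>The assumption \<open>large\<close> makes the exponent at least 1, so K \<ge> q
    \<ge> 2 and the purity convention never applies.\<close>
  have "real q powr 1 \<le> real q powr (n * (1 - ball_rate q \<delta>) - 1)"
    using q1 large by (intro powr_mono) auto
  then have "real q \<le> real K" using KU(3) q1 by simp
  then have K2: "K \<ge> 2" using q2 by simp
  have "nat \<lfloor>\<delta> * n\<rfloor> \<le> n"
  proof -
    have "\<delta> * n \<le> 1 * real n" using \<delta> by (intro mult_right_mono) auto
    then show ?thesis by (simp add: nat_le_iff floor_le_iff)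
  qed
  then have "Suc (nat \<lfloor>\<delta> * n\<rfloor>) \<le> min_distance q n (mrange U)"
    using KU(2) detects_below_iff[OF KU(1) K2] by (intro min_distance_ge) auto
  moreover have "\<delta> * n \<le> Suc (nat \<lfloor>\<delta> * n\<rfloor>)" using \<delta> by linarith
  ultimately have "\<delta> * n \<le> min_distance q n (mrange U)" by linarith
  then obtain n' U' where n': "n' \<le> n" and iso: "isometry (q ^ n') K U'"
    and dist: "\<delta> * n' \<le> min_distance q n' (mrange U')" "min_distance q n' (mrange U') \<le> \<delta> * n' + 1"
    using puncture_to_distance[OF KU(1) K2 \<delta>(1)] by blast
  have dim: "code_dim q n' (mrange U') = K" by (rule isometry_code_dim[OF iso])
  have "n' > 0"
  proof (rule ccontr)
    assume "\<not> n' > 0"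
    then show False using isometry_dim_le[OF iso] K2 by simp
  qed
  moreover have "quantum_code q n' (mrange U')" using iso K2 by (intro isometry_quantum_code) auto
  moreover have "n * (1 - ball_rate q \<delta>) - 1 \<le> log q K"
    using KU(3) q1 K2 by (simp add: le_log_iff)
  moreover have "log q K \<le> n'"
  proof -
    have "real K \<le> real q powr n'"
      using isometry_dim_le[OF iso] q1 by (simp add: powr_realpow flip: of_nat_power)
    then show ?thesis using q1 K2 by (simp add: log_le_iff)
  qed
  ultimately show thesis using that[OF n', of "mrange U'"] dist by (simp add: dim)
qed

section \<open>Passing to the limit\<close>

lemma bounded_real_subsequence:
  fixes X :: "nat \<Rightarrow> real"
  assumes "\<And>i. X i \<in> {0..1}"
  obtains r R where "strict_mono r" "(X \<circ> r) \<longlonglongrightarrow> R"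
proof -
  obtain r where r: "strict_mono r" "monoseq (\<lambda>i. X (r i))" using seq_monosub[of X] by auto
  have "Bseq (\<lambda>i. X (r i))" using assms by (intro BseqI'[of _ 1]) auto
  then have "convergent (\<lambda>i. X (r i))" using r by (intro Bseq_monoseq_convergent)
  then show thesis using that r(1) by (auto simp: convergent_def o_def)
qed

text \<open>Puncturing preserves the dimension and only shortens the code, so the rate is at least
  log_q K / N \<ge> f - 1/N. It need not converge, hence the subsequence; the relative distance is
  within 1/n of \<delta> along the whole sequence.\<close>

lemma U_Q_rate_ge:
  assumes q: "primepow q" and \<delta>: "0 \<le> \<delta>" "\<delta> \<le> 1" and less: "ball_rate q \<delta> < 1"
  obtains R where "(\<delta>, R) \<in> U_Q q" "1 - ball_rate q \<delta> \<le> R"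
proof -
  define f where "f = 1 - ball_rate q \<delta>"
  have f: "f > 0" using less by (simp add: f_def)
  obtain N0 :: nat where N0: "2 / f \<le> N0" using real_arch_simple by blast
  define N where "N = (\<lambda>i. i + N0 + 1)"
  have large: "N i * f \<ge> 2" for i
  proof -
    have "2 / f \<le> N i" using N0 by (simp add: N_def)
    then show ?thesis using f by (simp add: pos_divide_le_eq)
  qed
  have "\<forall>i. \<exists>n' Q. n' \<le> N i \<and> n' > 0 \<and> quantum_code q n' Q \<and>
    N i * f - 1 \<le> log q (code_dim q n' Q) \<and> log q (code_dim q n' Q) \<le> n' \<and>
    \<delta> * n' \<le> min_distance q n' Q \<and> min_distance q n' Q \<le> \<delta> * n' + 1"
  proof
    fix i
    show "\<exists>n' Q. n' \<le> N i \<and> n' > 0 \<and> quantum_code q n' Q \<and>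
      N i * f - 1 \<le> log q (code_dim q n' Q) \<and> log q (code_dim q n' Q) \<le> n' \<and>
      \<delta> * n' \<le> min_distance q n' Q \<and> min_distance q n' Q \<le> \<delta> * n' + 1"
      by (rule gilbert_varshamov_codes[OF q \<delta> less large[of i, unfolded f_def]]) (unfold f_def, blast)
  qed
  then obtain n Q where nN: "\<And>i. n i \<le> N i" and n0: "\<And>i. n i > 0" and code: "\<And>i. quantum_code q (n i) (Q i)"
    and lower: "\<And>i. N i * f - 1 \<le> log q (code_dim q (n i) (Q i))"
    and upper: "\<And>i. log q (code_dim q (n i) (Q i)) \<le> n i"
    and dist: "\<And>i. \<delta> * n i \<le> min_distance q (n i) (Q i)" "\<And>i. min_distance q (n i) (Q i) \<le> \<delta> * n i + 1"
    by metis
  define X where "X = (\<lambda>i. log q (code_dim q (n i) (Q i)) / n i)"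
  have X0: "log q (code_dim q (n i) (Q i)) > 0" for i using lower[of i] large[of i] by linarith
  have X01: "X i \<in> {0..1}" for i
    using X0[of i] upper[of i] n0[of i] by (simp add: X_def)
  have Xge: "f - 1 / N i \<le> X i" for i
  proof -
    have "f - 1 / N i = (N i * f - 1) / N i" by (simp add: N_def field_simps)
    also have "\<dots> \<le> log q (code_dim q (n i) (Q i)) / N i"
      using lower by (intro divide_right_mono) auto
    also have "\<dots> \<le> X i"
      unfolding X_def using X0[of i] nN[of i] n0[of i] by (intro divide_left_mono mult_pos_pos) auto
    finally show ?thesis .
  qed
  have Nlim: "filterlim N at_top sequentially"
    unfolding N_def by (rule filterlim_subseq) (simp add: strict_mono_def)
  \<comment> \<open>The punctured lengths are bounded below by log_q K \<ge> N f - 1, which grows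
    without bound.\<close>
  have nlim: "filterlim n at_top sequentially"
    unfolding filterlim_at_top
  proof
    fix M :: nat
    obtain i0 :: nat where i0: "(M + 1) / f \<le> i0" using real_arch_simple by blast
    have "M \<le> n i" if "i \<ge> i0" for i
    proof -
      have "(M + 1) / f \<le> N i" using i0 that by (simp add: N_def)
      then have "M + 1 \<le> N i * f" using f by (simp add: pos_divide_le_eq)
      then have "real M \<le> real (n i)" using lower[of i] upper[of i] by linarith
      then show ?thesis by simp
    qed
    then show "eventually (\<lambda>i. M \<le> n i) sequentially" by (auto simp: eventually_sequentially)
  qed
  obtain r R where r: "strict_mono r" and R: "(X \<circ> r) \<longlonglongrightarrow> R" by (rule bounded_real_subsequence[OF X01])
  have rlim: "filterlim r at_top sequentially" by (rule filterlim_subseq[OF r])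
  have nr: "filterlim (\<lambda>i. n (r i)) at_top sequentially" by (rule filterlim_compose[OF nlim rlim])
  have R01: "R \<in> {0..1}"
    using R X01 by (auto intro: LIMSEQ_le_const LIMSEQ_le_const2)
  have inv0: "(\<lambda>i. 1 / real (g i)) \<longlonglongrightarrow> 0" if "filterlim g at_top sequentially" for g :: "nat \<Rightarrow> nat"
    by (rule filterlim_compose[OF lim_1_over_n that])
  have "(\<lambda>i. min_distance q (n (r i)) (Q (r i)) / n (r i)) \<longlonglongrightarrow> \<delta>"
  proof (rule tendsto_sandwich[of "\<lambda>_. \<delta>" _ _ "\<lambda>i. \<delta> + 1 / n (r i)"])
    show "\<forall>\<^sub>F i in sequentially. \<delta> \<le> min_distance q (n (r i)) (Q (r i)) / n (r i)"
      using dist(1) n0 by (intro always_eventually allI) (simp add: pos_le_divide_eq)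
    show "\<forall>\<^sub>F i in sequentially. min_distance q (n (r i)) (Q (r i)) / n (r i) \<le> \<delta> + 1 / n (r i)"
    proof (intro always_eventually allI)
      fix i
      show "min_distance q (n (r i)) (Q (r i)) / n (r i) \<le> \<delta> + 1 / n (r i)"
        using dist(2)[of "r i"] n0[of "r i"] by (simp add: field_simps)
    qed
    show "(\<lambda>i. \<delta> + 1 / n (r i)) \<longlonglongrightarrow> \<delta>" using tendsto_add[OF tendsto_const inv0[OF nr], of \<delta>] by simp
  qed simp
  then have "(\<delta>, R) \<in> U_Q q"
    unfolding U_Q_def using \<delta> R01 R code nr
    by (auto simp: X_def o_def intro!: exI[of _ "\<lambda>i. n (r i)"] exI[of _ "\<lambda>i. Q (r i)"])
  moreover have "f \<le> R"
  proof (rule LIMSEQ_le[OF _ R])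
    show "(\<lambda>i. f - 1 / N (r i)) \<longlonglongrightarrow> f"
      using tendsto_diff[OF tendsto_const inv0[OF filterlim_compose[OF Nlim rlim]], of f] by simp
    show "\<exists>M. \<forall>i\<ge>M. f - 1 / N (r i) \<le> (X \<circ> r) i" using Xge by auto
  qed
  ultimately show thesis using that by (simp add: f_def)
qed

theorem theorem4p4:
  fixes q :: nat and \<delta> :: real
  assumes "primepow q"
    and "\<delta> \<in> {0..1}"
  shows "alpha_Q q \<delta> \<ge> 1 - \<delta> * log (real q) (real q + 1) - entropy_q q \<delta>"
proof -
  have bdd: "bdd_above {R. (\<delta>, R) \<in> U_Q q}" by (rule bdd_aboveI[of _ 1]) (auto simp: U_Q_def)
  have ge: "R \<le> alpha_Q q \<delta>" if "(\<delta>, R) \<in> U_Q q" for R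
    using that bdd by (auto simp: alpha_Q_def intro!: cSup_upper)
  have "1 - ball_rate q \<delta> \<le> alpha_Q q \<delta>"
  proof (cases "ball_rate q \<delta> < 1")
    case True
    then obtain R where "(\<delta>, R) \<in> U_Q q" "1 - ball_rate q \<delta> \<le> R"
      using U_Q_rate_ge[of q \<delta>] assms by auto
    then show ?thesis using ge by fastforce
  next
    \<comment> \<open>The bound is at most 0 here, and \<open>alpha_Q\<close> is nonnegative in
      either branch of its definition: rates lie in [0,1], and the default value is 0.\<close>
    case False
    have "0 \<le> alpha_Q q \<delta>"
    proof (cases "\<exists>R. (\<delta>, R) \<in> U_Q q")
      case True
      then obtain R where R: "(\<delta>, R) \<in> U_Q q" by blast
      then have "0 \<le> R" by (auto simp: U_Q_def)
      then show ?thesis using ge[OF R] by simp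
    qed (simp add: alpha_Q_def)
    then show ?thesis using False by simp
  qed
  then show ?thesis by (simp add: ball_rate_def)
qed

end
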